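(* Let $k$ be a field, $\mathcal U$ a small category and $\mathcal A=(\mathcal A,m,f,c)$ a prestack of $k$-linear categories on $\mathcal U$. The second cohomology group $H^2(\mathbf C^\bullet_{\mathrm{GS}}(\mathcal A),d)$ classifies first order deformations of $\mathcal A$ as a prestack: every class in $H^2\mathbf C^\bullet_{\mathrm{GS}}(\mathcal A)$ is represented by a normalized reduced cocycle $(m_1,f_1,c_1)\in \mathbf C^{0,2}(\mathcal A)\oplus\mathbf C^{1,1}(\mathcal A)\oplus\mathbf C^{2,0}(\mathcal A)$, and sending this class to the equivalence class of $(\mathcal A[\epsilon],m+m_1\epsilon,f+f_1\epsilon,c+c_1\epsilon)$ gives a well-defined bijection between $H^2\mathbf C^\bullet_{\mathrm{GS}}(\mathcal A)$ and the set of equivalence classes of first order deformations of $\mathcal A$.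
   Context: **Prestacks.** A prestack $\mathcal A=(\mathcal A,m,f,c)$ on $\mathcal U$ consists of: for each object $U$ a $k$-linear category $\mathcal A(U)$ with composition $m^U$ (written as juxtaposition); for each $u:V\to U$ a $k$-linear functor $u^*=f^u:\mathcal A(U)\to\mathcal A(V)$, with $(1_U)^*=1$; for $v:W\to V$, $u:V\to U$ a natural isomorphism $c^{u,v}:v^*u^*\to(uv)^*$, equal to the identity if $u$ or $v$ is an identity, such that $c^{u,vw}(c^{v,w}u^* )=c^{uv,w}(w^*c^{u,v})$ for all $w:T\to W$. **Morphisms of prestacks.** A morphism $(g,\tau):\mathcal A\to\mathcal A'$ consists of functors $g^U:\mathcal A(U)\to\mathcal A'(U)$ and, for $u:V\to U$ and $A\in\mathcal A(U)$, morphisms $\tau^{u,A}:u'^*g^U(A)\to g^V(u^*A)$ in $\mathcal A'(V)$ such that: $g^V(u^*a)\,\tau^{u,A}=\tau^{u,B}\,u'^*(g^U(a))$ for $a:A\to B$; $\tau^{uv}c'^{u,v}=g^W(c^{u,v})\,\tau^v\,v'^*(\tau^u)$ for $v:W\to V$; and $\tau^{1_U}$ is the identity. **Simplices.** A $p$-simplex of the nerve $\mathcal N_p(\mathcal U)$ is $\sigma=(u_1,\dots,u_p)$, $U_0\xrightarrow{u_1}U_1\to\cdots\xrightarrow{u_p}U_p$. Put $\sigma^*=(u_p\cdots u_1)^*$, $\sigma^\star=u_1^*\cdots u_p^*:\mathcal A(U_p)\to\mathcal A(U_0)$ (identities if $p=0$), $L_k\sigma=(u_1,\dots,u_k)$,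 $R_k\sigma=(u_{k+1},\dots,u_p)$, and let $\partial_i\sigma$ be the usual faces: $\partial_0\sigma=(u_2,\dots,u_p)$, $\partial_i\sigma=(u_1,\dots,u_{i+1}u_i,\dots,u_p)$, $\partial_p\sigma=(u_1,\dots,u_{p-1})$. Put $c^{\sigma,k}=c^{u_p\cdots u_{k+1},\,u_k\cdots u_1}:(L_k\sigma)^*(R_k\sigma)^*\to\sigma^*$ (identity for $k=0,p$) and, for $1\le k\le p-1$, $\epsilon^{\sigma,k}=u_1^*\cdots u_{k-1}^*c^{u_{k+1},u_k}u_{k+2}^*\cdots u_p^*:\sigma^\star\to(\partial_k\sigma)^\star$; components at $A$ are written $c^{\sigma,k,A}$, $\epsilon^{\sigma,k,A}$. A $q$-simplex $a=(a_1,\dots,a_q)$ in a category is $A_0\xrightarrow{a_q}A_1\to\cdots\xrightarrow{a_1}A_q$, so $a_i:A_{q-i}\to A_{q-i+1}$. **Cochains.** $\mathbf C^{p,q}(\mathcal A)=\prod_{\sigma\in\mathcal N_p(\mathcal U)}\prod_{A_0,\dots,A_q\in\mathcal A(U_p)}\mathrm{Hom}_k\big(\mathcal A(U_p)(A_{q-1},A_q)\otimes\cdots\otimes\mathcal A(U_p)(A_0,A_1),\mathcal A(U_0)(\sigma^\star A_0,\sigma^*A_q)\big)$ (for $q=0$ the Hom is just $\mathcal A(U_0)(\sigma^\star A_0,\sigma^*A_0)$), and $\mathbf C^n_{\mathrm{GS}}(\mathcal A)=\prod_{p+q=n}\mathbf C^{p,q}(\mathcal A)$. **Paths.** For $\sigma=(u_1,\dots,u_n)$,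 $n\ge1$, the paths $r=(r_1,\dots,r_{n-1})\in\mathcal P(\sigma)$ are chains of natural transformations $T_0\xrightarrow{r_{n-1}}T_1\to\cdots\xrightarrow{r_1}T_{n-1}$ from $T_0=\sigma^\star$ to $T_{n-1}=\sigma^*$, with a sign $(-1)^r$: $\mathcal P(u_1)$ has only the empty path (with $T_0=u_1^*$, sign $1$); for $n\ge2$, $\mathcal P(\sigma)=\{(r_1,\dots,r_{n-2},\epsilon^{\sigma,i}):1\le i\le n-1,\ r\in\mathcal P(\partial_i\sigma)\}$ with sign $(-1)^i(-1)^r$. Paths are indexed by the choices made, so there are $(n-1)!$ of them. **Shuffles.** $S_{m,l}$ is the set of permutations $\beta$ of $\{1,\dots,m+l\}$ increasing on $\{1,\dots,m\}$ and on $\{m+1,\dots,m+l\}$; $(-1)^\beta$ is its sign. Given an $m$-simplex $a$ in $\mathcal A(U)$ and a chain $r=(r_1,\dots,r_l)$, $T_0\xrightarrow{r_l}\cdots\xrightarrow{r_1}T_l$, of natural transformations of functors $\mathcal A(U)\to\mathcal A(V)$, place the $i$-th entry of $(a_1,\dots,a_m,r_1,\dots,r_l)$ in position $\beta(i)$. Then $\beta(a,r)=(b_1,\dots,b_{m+l})$ is the simplex in $\mathcal A(V)$ from $T_0(A_0)$ to $T_l(A_m)$ with $b_x=T_{l-y}(a_i)$ if position $x$ holds $a_i$ and $y$ of the $r$'s are in positions $<x$, and $b_x=r_i(A_{m-y})$ if position $x$ holds $r_i$ and $y$ of the $a$'s are in positions $<x$. **Differential.** For $\phi\in\mathbf C^{p,q}(\mathcal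 A)$, $p+q=n-1$, $d\phi=\sum_{j=0}^{q+1}d_j\phi$ with $d_j\phi\in\mathbf C^{p+j,q+1-j}(\mathcal A)$: $(d_0\phi)^\sigma(a_1,\dots,a_{q+1})=\sigma^*(a_1)\phi^\sigma(a_2,\dots,a_{q+1})+\sum_{i=1}^q(-1)^i\phi^\sigma(\dots,a_ia_{i+1},\dots)+(-1)^{q+1}\phi^\sigma(a_1,\dots,a_q)\sigma^\star(a_{q+1})$; $d_1\phi=(-1)^nd_{\mathrm{simp}}\phi$, $(d_{\mathrm{simp}}\phi)^\sigma(a)=c^{\sigma,1,A_q}u_1^*(\phi^{\partial_0\sigma}(a))+\sum_{i=1}^p(-1)^i\phi^{\partial_i\sigma}(a)\epsilon^{\sigma,i,A_0}+(-1)^{p+1}c^{\sigma,p,A_q}\phi^{\partial_{p+1}\sigma}(u_{p+1}^*a_1,\dots,u_{p+1}^*a_q)$ for a $(p+1)$-simplex $\sigma$; for $j\ge2$, $t=q+1-j$, $\sigma$ a $(p+j)$-simplex: $(d_j\phi)^\sigma(a_1,\dots,a_t)=\sum_{r\in\mathcal P(R_p\sigma),\,\beta\in S_{t,j-1}}(-1)^r(-1)^\beta(-1)^t\,c^{\sigma,p,A_t}\,\phi^{L_p\sigma}(\beta(a,r))$. **Normalized reduced.** $\phi=(\phi^\sigma)_\sigma$ is normalized if $\phi^\sigma(a)=0$ whenever some $a_i$ is an identity, and reduced if $\phi^\sigma=0$ whenever some arrow $u_i$ of $\sigma$ is an identity. **Deformations.** $k[\epsilon]$ has $\epsilon^2=0$.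 A first order deformation of $\mathcal A$ is a prestack $(\mathcal A[\epsilon],m+m_1\epsilon,f+f_1\epsilon,c+c_1\epsilon)$ of $k[\epsilon]$-linear categories with $(m_1,f_1,c_1)\in\mathbf C^{0,2}(\mathcal A)\oplus\mathbf C^{1,1}(\mathcal A)\oplus\mathbf C^{2,0}(\mathcal A)$. Here $\mathcal A[\epsilon](U)$ has the objects of $\mathcal A(U)$, morphisms $\mathcal A(U)(A,B)\otimes_kk[\epsilon]$ and the same identities; restriction functors are unchanged on objects; $\bar c^{u,v,A}=c^{u,v,A}+c_1^{(v,u)}(A)\epsilon$. Two deformations are equivalent if there is an isomorphism of prestacks between them of the form $(1+g_1\epsilon,1+\tau_1\epsilon)$ (identity on objects) with $(g_1,\tau_1)\in\mathbf C^{0,1}(\mathcal A)\oplus\mathbf C^{1,0}(\mathcal A)$. *)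

theory Defs
  imports "HOL-Algebra.Module" "HOL-Algebra.Coset" "HOL-Combinatorics.Permutations"
begin

section \<open>Small categories and linear categories\<close>

text \<open>Composition is written in the usual order: \<open>Cmp U u v\<close> is \<open>u\<close> after \<open>v\<close>.\<close>

record ('o, 'u) cat =
  Obj :: "'o set"
  Arr :: "'u set"
  Dom :: "'u \<Rightarrow> 'o"
  Cod :: "'u \<Rightarrow> 'o"
  Ident :: "'o \<Rightarrow> 'u"
  Cmp :: "'u \<Rightarrow> 'u \<Rightarrow> 'u"

locale small_category =
  fixes U :: "('o, 'u) cat"
  assumes Dom_closed: "u \<in> Arr U \<Longrightarrow> Dom U u \<in> Obj U"
    and Cod_closed: "u \<in> Arr U \<Longrightarrow> Cod U u \<in> Obj U"
    and Ident_closed: "X \<in> Obj U \<Longrightarrow> Ident U X \<in> Arr U"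
    and Dom_Ident: "X \<in> Obj U \<Longrightarrow> Dom U (Ident U X) = X"
    and Cod_Ident: "X \<in> Obj U \<Longrightarrow> Cod U (Ident U X) = X"
    and Cmp_closed: "\<lbrakk>u \<in> Arr U; v \<in> Arr U; Cod U v = Dom U u\<rbrakk> \<Longrightarrow> Cmp U u v \<in> Arr U"
    and Dom_Cmp: "\<lbrakk>u \<in> Arr U; v \<in> Arr U; Cod U v = Dom U u\<rbrakk> \<Longrightarrow> Dom U (Cmp U u v) = Dom U v"
    and Cod_Cmp: "\<lbrakk>u \<in> Arr U; v \<in> Arr U; Cod U v = Dom U u\<rbrakk> \<Longrightarrow> Cod U (Cmp U u v) = Cod U u"
    and Cmp_Ident_left: "u \<in> Arr U \<Longrightarrow> Cmp U (Ident U (Cod U u)) u = u"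
    and Cmp_Ident_right: "u \<in> Arr U \<Longrightarrow> Cmp U u (Ident U (Dom U u)) = u"
    and Cmp_assoc: "\<lbrakk>u \<in> Arr U; v \<in> Arr U; w \<in> Arr U; Cod U v = Dom U u; Cod U w = Dom U v\<rbrakk>
          \<Longrightarrow> Cmp U (Cmp U u v) w = Cmp U u (Cmp U v w)"

definition linear_map ::
  "('k, 'z) ring_scheme \<Rightarrow> ('k, 'm) module \<Rightarrow> ('k, 'n) module \<Rightarrow> ('m \<Rightarrow> 'n) \<Rightarrow> bool" where
  "linear_map K M N f \<longleftrightarrow>
     f \<in> carrier M \<rightarrow> carrier N \<and>
     (\<forall>x\<in>carrier M. \<forall>y\<in>carrier M. f (x \<oplus>\<^bsub>M\<^esub> y) = f x \<oplus>\<^bsub>N\<^esub> f y) \<and>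
     (\<forall>s\<in>carrier K. \<forall>x\<in>carrier M. f (s \<odot>\<^bsub>M\<^esub> x) = s \<odot>\<^bsub>N\<^esub> f x)"

text \<open>Morphisms do not carry their source and target, so that composition, and later the action
  of a functor on morphisms, takes the objects involved as arguments: \<open>Comp C P Q R g f\<close> is
  \<open>g\<close> after \<open>f\<close> for \<open>f\<close> in \<open>Mor C P Q\<close> and \<open>g\<close> in \<open>Mor C Q R\<close>.
  The fields \<open>mult\<close> and \<open>one\<close> of the module records \<open>Mor C P Q\<close> play no role.\<close>

record ('a, 'm, 'k) lincat =
  Ob :: "'a set"
  Mor :: "'a \<Rightarrow> 'a \<Rightarrow> ('k, 'm) module"
  Id :: "'a \<Rightarrow> 'm"
  Comp :: "'a \<Rightarrow> 'a \<Rightarrow> 'a \<Rightarrow> 'm \<Rightarrow> 'm \<Rightarrow> 'm"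

locale linear_category =
  fixes K :: "('k, 'z) ring_scheme" and C :: "('a, 'm, 'k) lincat"
  assumes Mor_module: "\<lbrakk>P \<in> Ob C; Q \<in> Ob C\<rbrakk> \<Longrightarrow> module K (Mor C P Q)"
    and Id_closed: "P \<in> Ob C \<Longrightarrow> Id C P \<in> carrier (Mor C P P)"
    and Comp_linear_right: "\<lbrakk>P \<in> Ob C; Q \<in> Ob C; R \<in> Ob C; g \<in> carrier (Mor C Q R)\<rbrakk>
          \<Longrightarrow> linear_map K (Mor C P Q) (Mor C P R) (\<lambda>f. Comp C P Q R g f)"
    and Comp_linear_left: "\<lbrakk>P \<in> Ob C; Q \<in> Ob C; R \<in> Ob C; f \<in> carrier (Mor C P Q)\<rbrakk>
          \<Longrightarrow> linear_map K (Mor C Q R) (Mor C P R) (\<lambda>g. Comp C P Q R g f)"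
    and Comp_Id_left: "\<lbrakk>P \<in> Ob C; Q \<in> Ob C; f \<in> carrier (Mor C P Q)\<rbrakk>
          \<Longrightarrow> Comp C P Q Q (Id C Q) f = f"
    and Comp_Id_right: "\<lbrakk>P \<in> Ob C; Q \<in> Ob C; f \<in> carrier (Mor C P Q)\<rbrakk>
          \<Longrightarrow> Comp C P P Q f (Id C P) = f"
    and Comp_assoc: "\<lbrakk>P \<in> Ob C; Q \<in> Ob C; R \<in> Ob C; S \<in> Ob C; f \<in> carrier (Mor C P Q);
          g \<in> carrier (Mor C Q R); h \<in> carrier (Mor C R S)\<rbrakk>
          \<Longrightarrow> Comp C P Q S (Comp C Q R S h g) f = Comp C P R S h (Comp C P Q R g f)"

locale linear_functor =
  fixes K :: "('k, 'z) ring_scheme" and C :: "('a, 'm, 'k) lincat" and D :: "('b, 'n, 'k) lincat"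
    and fo :: "'a \<Rightarrow> 'b" and fm :: "'a \<Rightarrow> 'a \<Rightarrow> 'm \<Rightarrow> 'n"
  assumes fo_closed: "P \<in> Ob C \<Longrightarrow> fo P \<in> Ob D"
    and fm_linear: "\<lbrakk>P \<in> Ob C; Q \<in> Ob C\<rbrakk>
          \<Longrightarrow> linear_map K (Mor C P Q) (Mor D (fo P) (fo Q)) (fm P Q)"
    and fm_Id: "P \<in> Ob C \<Longrightarrow> fm P P (Id C P) = Id D (fo P)"
    and fm_Comp: "\<lbrakk>P \<in> Ob C; Q \<in> Ob C; R \<in> Ob C; f \<in> carrier (Mor C P Q);
          g \<in> carrier (Mor C Q R)\<rbrakk>
          \<Longrightarrow> fm P R (Comp C P Q R g f) = Comp D (fo P) (fo Q) (fo R) (fm Q R g) (fm P Q f)"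

definition is_iso :: "('a, 'm, 'k) lincat \<Rightarrow> 'a \<Rightarrow> 'a \<Rightarrow> 'm \<Rightarrow> bool" where
  "is_iso C P Q f \<longleftrightarrow> f \<in> carrier (Mor C P Q) \<and>
     (\<exists>g\<in>carrier (Mor C Q P). Comp C P Q P g f = Id C P \<and> Comp C Q P Q f g = Id C Q)"


section \<open>Prestacks\<close>

text \<open>\<open>Robj A u\<close> and \<open>Rmor A u\<close> form the restriction functor \<open>u\<^sup>*\<close>, and \<open>Tw A u v P\<close> is the
  component at \<open>P\<close> of the twist from \<open>v\<^sup>* u\<^sup>*\<close> to \<open>(u v)\<^sup>*\<close>, where \<open>u\<close> is composed after \<open>v\<close>.\<close>

record ('o, 'u, 'a, 'm, 'k) prestack_data =
  Fib :: "'o \<Rightarrow> ('a, 'm, 'k) lincat"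
  Robj :: "'u \<Rightarrow> 'a \<Rightarrow> 'a"
  Rmor :: "'u \<Rightarrow> 'a \<Rightarrow> 'a \<Rightarrow> 'm \<Rightarrow> 'm"
  Tw :: "'u \<Rightarrow> 'u \<Rightarrow> 'a \<Rightarrow> 'm"

locale prestack =
  fixes K :: "('k, 'z) ring_scheme" and U :: "('o, 'u) cat"
    and A :: "('o, 'u, 'a, 'm, 'k) prestack_data"
  assumes Fib_linear_category: "X \<in> Obj U \<Longrightarrow> linear_category K (Fib A X)"
    and restriction_functor: "u \<in> Arr U
          \<Longrightarrow> linear_functor K (Fib A (Cod U u)) (Fib A (Dom U u)) (Robj A u) (Rmor A u)"
    and Robj_Ident: "\<lbrakk>X \<in> Obj U; P \<in> Ob (Fib A X)\<rbrakk> \<Longrightarrow> Robj A (Ident U X) P = P"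
    and Rmor_Ident: "\<lbrakk>X \<in> Obj U; P \<in> Ob (Fib A X); Q \<in> Ob (Fib A X);
          a \<in> carrier (Mor (Fib A X) P Q)\<rbrakk> \<Longrightarrow> Rmor A (Ident U X) P Q a = a"
    and Tw_iso: "\<lbrakk>u \<in> Arr U; v \<in> Arr U; Cod U v = Dom U u; P \<in> Ob (Fib A (Cod U u))\<rbrakk>
          \<Longrightarrow> is_iso (Fib A (Dom U v)) (Robj A v (Robj A u P)) (Robj A (Cmp U u v) P) (Tw A u v P)"
    and Tw_natural: "\<lbrakk>u \<in> Arr U; v \<in> Arr U; Cod U v = Dom U u;
          P \<in> Ob (Fib A (Cod U u)); Q \<in> Ob (Fib A (Cod U u));
          a \<in> carrier (Mor (Fib A (Cod U u)) P Q)\<rbrakk>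
          \<Longrightarrow> Comp (Fib A (Dom U v)) (Robj A v (Robj A u P)) (Robj A (Cmp U u v) P) (Robj A (Cmp U u v) Q)
                (Rmor A (Cmp U u v) P Q a) (Tw A u v P)
            = Comp (Fib A (Dom U v)) (Robj A v (Robj A u P)) (Robj A v (Robj A u Q)) (Robj A (Cmp U u v) Q)
                (Tw A u v Q) (Rmor A v (Robj A u P) (Robj A u Q) (Rmor A u P Q a))"
    and Tw_Ident_left: "\<lbrakk>v \<in> Arr U; P \<in> Ob (Fib A (Cod U v))\<rbrakk>
          \<Longrightarrow> Tw A (Ident U (Cod U v)) v P = Id (Fib A (Dom U v)) (Robj A v P)"
    and Tw_Ident_right: "\<lbrakk>u \<in> Arr U; P \<in> Ob (Fib A (Cod U u))\<rbrakk>
          \<Longrightarrow> Tw A u (Ident U (Dom U u)) P = Id (Fib A (Dom U u)) (Robj A u P)"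
    and Tw_coherence: "\<lbrakk>u \<in> Arr U; v \<in> Arr U; w \<in> Arr U; Cod U v = Dom U u; Cod U w = Dom U v;
          P \<in> Ob (Fib A (Cod U u))\<rbrakk>
          \<Longrightarrow> Comp (Fib A (Dom U w)) (Robj A w (Robj A v (Robj A u P)))
                (Robj A (Cmp U v w) (Robj A u P)) (Robj A (Cmp U u (Cmp U v w)) P)
                (Tw A u (Cmp U v w) P) (Tw A v w (Robj A u P))
            = Comp (Fib A (Dom U w)) (Robj A w (Robj A v (Robj A u P)))
                (Robj A w (Robj A (Cmp U u v) P)) (Robj A (Cmp U u (Cmp U v w)) P)
                (Tw A (Cmp U u v) w P)
                (Rmor A w (Robj A v (Robj A u P)) (Robj A (Cmp U u v) P) (Tw A u v P))"

text \<open>A morphism \<open>(g, \<tau>)\<close> from \<open>A\<close> to \<open>A'\<close>; the functors \<open>g\<^sup>X\<close> are given by their action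
  \<open>go X\<close> on objects and \<open>gm X\<close> on morphisms, and \<open>t u P\<close> is \<open>\<tau>\<close> at \<open>u, P\<close>.\<close>

locale prestack_morphism =
  fixes K :: "('k, 'z) ring_scheme" and U :: "('o, 'u) cat"
    and A :: "('o, 'u, 'a, 'm, 'k) prestack_data" and A' :: "('o, 'u, 'b, 'n, 'k) prestack_data"
    and go :: "'o \<Rightarrow> 'a \<Rightarrow> 'b" and gm :: "'o \<Rightarrow> 'a \<Rightarrow> 'a \<Rightarrow> 'm \<Rightarrow> 'n" and t :: "'u \<Rightarrow> 'a \<Rightarrow> 'n"
  assumes g_functor: "X \<in> Obj U \<Longrightarrow> linear_functor K (Fib A X) (Fib A' X) (go X) (gm X)"
    and t_closed: "\<lbrakk>u \<in> Arr U; P \<in> Ob (Fib A (Cod U u))\<rbrakk>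
          \<Longrightarrow> t u P \<in> carrier (Mor (Fib A' (Dom U u))
                (Robj A' u (go (Cod U u) P)) (go (Dom U u) (Robj A u P)))"
    and t_natural: "\<lbrakk>u \<in> Arr U; P \<in> Ob (Fib A (Cod U u)); Q \<in> Ob (Fib A (Cod U u));
          a \<in> carrier (Mor (Fib A (Cod U u)) P Q)\<rbrakk>
          \<Longrightarrow> Comp (Fib A' (Dom U u)) (Robj A' u (go (Cod U u) P)) (go (Dom U u) (Robj A u P))
                (go (Dom U u) (Robj A u Q))
                (gm (Dom U u) (Robj A u P) (Robj A u Q) (Rmor A u P Q a)) (t u P)
            = Comp (Fib A' (Dom U u)) (Robj A' u (go (Cod U u) P)) (Robj A' u (go (Cod U u) Q))
                (go (Dom U u) (Robj A u Q))
                (t u Q) (Rmor A' u (go (Cod U u) P) (go (Cod U u) Q) (gm (Cod U u) P Q a))"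
    and t_coherence: "\<lbrakk>u \<in> Arr U; v \<in> Arr U; Cod U v = Dom U u; P \<in> Ob (Fib A (Cod U u))\<rbrakk>
          \<Longrightarrow> Comp (Fib A' (Dom U v)) (Robj A' v (Robj A' u (go (Cod U u) P)))
                (Robj A' (Cmp U u v) (go (Cod U u) P)) (go (Dom U v) (Robj A (Cmp U u v) P))
                (t (Cmp U u v) P) (Tw A' u v (go (Cod U u) P))
            = Comp (Fib A' (Dom U v)) (Robj A' v (Robj A' u (go (Cod U u) P)))
                (go (Dom U v) (Robj A v (Robj A u P))) (go (Dom U v) (Robj A (Cmp U u v) P))
                (gm (Dom U v) (Robj A v (Robj A u P)) (Robj A (Cmp U u v) P) (Tw A u v P))
                (Comp (Fib A' (Dom U v)) (Robj A' v (Robj A' u (go (Cod U u) P)))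
                   (Robj A' v (go (Dom U u) (Robj A u P))) (go (Dom U v) (Robj A v (Robj A u P)))
                   (t v (Robj A u P))
                   (Rmor A' v (Robj A' u (go (Cod U u) P)) (go (Dom U u) (Robj A u P)) (t u P)))"
    and t_Ident: "\<lbrakk>X \<in> Obj U; P \<in> Ob (Fib A X)\<rbrakk> \<Longrightarrow> t (Ident U X) P = Id (Fib A' X) (go X P)"

text \<open>The composite of \<open>(g, \<tau>)\<close> from \<open>A\<close> to \<open>A'\<close> and \<open>(h, \<rho>)\<close> from \<open>A'\<close> to \<open>A''\<close> consists of the
  composite functors and of the morphisms \<open>h(\<tau>\<^bsup>u,P\<^esup>) \<rho>\<^bsup>u,gP\<^esup>\<close>. The following predicate says that this
  composite, for \<open>A'' = A\<close>, is the identity morphism of \<open>A\<close>.\<close>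

definition composite_is_identity ::
  "('o, 'u) cat \<Rightarrow> ('o, 'u, 'a, 'm, 'k) prestack_data \<Rightarrow> ('o, 'u, 'b, 'n, 'k) prestack_data \<Rightarrow>
   ('o \<Rightarrow> 'a \<Rightarrow> 'b) \<Rightarrow> ('o \<Rightarrow> 'a \<Rightarrow> 'a \<Rightarrow> 'm \<Rightarrow> 'n) \<Rightarrow> ('u \<Rightarrow> 'a \<Rightarrow> 'n) \<Rightarrow>
   ('o \<Rightarrow> 'b \<Rightarrow> 'a) \<Rightarrow> ('o \<Rightarrow> 'b \<Rightarrow> 'b \<Rightarrow> 'n \<Rightarrow> 'm) \<Rightarrow> ('u \<Rightarrow> 'b \<Rightarrow> 'm) \<Rightarrow> bool" where
  "composite_is_identity U A A' go gm t ho hm r \<longleftrightarrow>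
     (\<forall>X\<in>Obj U. \<forall>P\<in>Ob (Fib A X). ho X (go X P) = P) \<and>
     (\<forall>X\<in>Obj U. \<forall>P\<in>Ob (Fib A X). \<forall>Q\<in>Ob (Fib A X). \<forall>a\<in>carrier (Mor (Fib A X) P Q).
        hm X (go X P) (go X Q) (gm X P Q a) = a) \<and>
     (\<forall>u\<in>Arr U. \<forall>P\<in>Ob (Fib A (Cod U u)).
        Comp (Fib A (Dom U u)) (Robj A u P) (ho (Dom U u) (Robj A' u (go (Cod U u) P))) (Robj A u P)
          (hm (Dom U u) (Robj A' u (go (Cod U u) P)) (go (Dom U u) (Robj A u P)) (t u P))
          (r u (go (Cod U u) P))
        = Id (Fib A (Dom U u)) (Robj A u P))"

definition prestack_isomorphism ::
  "('k, 'z) ring_scheme \<Rightarrow> ('o, 'u) cat \<Rightarrow>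
   ('o, 'u, 'a, 'm, 'k) prestack_data \<Rightarrow> ('o, 'u, 'b, 'n, 'k) prestack_data \<Rightarrow>
   ('o \<Rightarrow> 'a \<Rightarrow> 'b) \<Rightarrow> ('o \<Rightarrow> 'a \<Rightarrow> 'a \<Rightarrow> 'm \<Rightarrow> 'n) \<Rightarrow> ('u \<Rightarrow> 'a \<Rightarrow> 'n) \<Rightarrow> bool" where
  "prestack_isomorphism K U A A' go gm t \<longleftrightarrow>
     prestack_morphism K U A A' go gm t \<and>
     (\<exists>ho hm r. prestack_morphism K U A' A ho hm r \<and>
        composite_is_identity U A A' go gm t ho hm r \<and>
        composite_is_identity U A' A ho hm r go gm t)"


section \<open>Simplices of the nerve\<close>

text \<open>The simplex \<open>(u\<^sub>1, \<dots>, u\<^sub>p)\<close> is represented by its initial vertex \<open>U\<^sub>0\<close> together with the list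
  \<open>[u\<^sub>1, \<dots>, u\<^sub>p]\<close>; the vertex is needed for \<open>p = 0\<close>.\<close>

type_synonym ('o, 'u) nsimplex = "'o \<times> 'u list"

fun composable :: "('o, 'u) cat \<Rightarrow> 'o \<Rightarrow> 'u list \<Rightarrow> bool" where
  "composable U X [] \<longleftrightarrow> X \<in> Obj U"
| "composable U X (u # us) \<longleftrightarrow> u \<in> Arr U \<and> Dom U u = X \<and> composable U (Cod U u) us"

definition nerve :: "('o, 'u) cat \<Rightarrow> nat \<Rightarrow> ('o, 'u) nsimplex set" where
  "nerve U p = {(X, us). length us = p \<and> composable U X us}"

fun end_vertex :: "('o, 'u) cat \<Rightarrow> 'o \<Rightarrow> 'u list \<Rightarrow> 'o" where
  "end_vertex U X [] = X"
| "end_vertex U X (u # us) = end_vertex U (Cod U u) us"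

fun composite :: "('o, 'u) cat \<Rightarrow> 'o \<Rightarrow> 'u list \<Rightarrow> 'u" where
  "composite U X [] = Ident U X"
| "composite U X (u # us) = Cmp U (composite U (Cod U u) us) u"

definition vertex :: "('o, 'u) cat \<Rightarrow> nat \<Rightarrow> ('o, 'u) nsimplex \<Rightarrow> 'o" where
  "vertex U k \<sigma> = end_vertex U (fst \<sigma>) (take k (snd \<sigma>))"

definition last_vertex :: "('o, 'u) cat \<Rightarrow> ('o, 'u) nsimplex \<Rightarrow> 'o" where
  "last_vertex U \<sigma> = end_vertex U (fst \<sigma>) (snd \<sigma>)"

definition total_arrow :: "('o, 'u) cat \<Rightarrow> ('o, 'u) nsimplex \<Rightarrow> 'u" where
  "total_arrow U \<sigma> = composite U (fst \<sigma>) (snd \<sigma>)"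

definition left_part :: "nat \<Rightarrow> ('o, 'u) nsimplex \<Rightarrow> ('o, 'u) nsimplex" where
  "left_part k \<sigma> = (fst \<sigma>, take k (snd \<sigma>))"

definition right_part :: "('o, 'u) cat \<Rightarrow> nat \<Rightarrow> ('o, 'u) nsimplex \<Rightarrow> ('o, 'u) nsimplex" where
  "right_part U k \<sigma> = (vertex U k \<sigma>, drop k (snd \<sigma>))"

text \<open>Arrows are numbered from \<open>1\<close> in the mathematics and from \<open>0\<close> in lists: \<open>u\<^sub>i = us ! (i - 1)\<close>.\<close>

definition face :: "('o, 'u) cat \<Rightarrow> nat \<Rightarrow> ('o, 'u) nsimplex \<Rightarrow> ('o, 'u) nsimplex" where
  "face U i \<sigma> = (let X = fst \<sigma>; us = snd \<sigma> in
     if i = 0 then (vertex U 1 \<sigma>, tl us)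
     else if i = length us then (X, butlast us)
     else (X, take (i - 1) us @ [Cmp U (us ! i) (us ! (i - 1))] @ drop (i + 1) us))"

fun star_obj :: "('o, 'u, 'a, 'm, 'k) prestack_data \<Rightarrow> 'u list \<Rightarrow> 'a \<Rightarrow> 'a" where
  "star_obj A [] P = P"
| "star_obj A (u # us) P = Robj A u (star_obj A us P)"

fun star_mor :: "('o, 'u, 'a, 'm, 'k) prestack_data \<Rightarrow> 'u list \<Rightarrow> 'a \<Rightarrow> 'a \<Rightarrow> 'm \<Rightarrow> 'm" where
  "star_mor A [] P Q a = a"
| "star_mor A (u # us) P Q a = Rmor A u (star_obj A us P) (star_obj A us Q) (star_mor A us P Q a)"

text \<open>The morphism \<open>c\<^bsup>\<sigma>,k,P\<^esup>\<close>.\<close>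

definition c_mor ::
  "('o, 'u) cat \<Rightarrow> ('o, 'u, 'a, 'm, 'k) prestack_data \<Rightarrow> ('o, 'u) nsimplex \<Rightarrow> nat \<Rightarrow> 'a \<Rightarrow> 'm" where
  "c_mor U A \<sigma> k P =
     (if k = 0 \<or> k = length (snd \<sigma>) then Id (Fib A (fst \<sigma>)) (Robj A (total_arrow U \<sigma>) P)
      else Tw A (total_arrow U (right_part U k \<sigma>)) (total_arrow U (left_part k \<sigma>)) P)"

text \<open>The morphism \<open>\<epsilon>\<^bsup>\<sigma>,k,P\<^esup>\<close> for \<open>1 \<le> k \<le> p - 1\<close>; below \<open>u = u\<^sub>k\<close>, \<open>u' = u\<^sub>k\<^sub>+\<^sub>1\<close>.\<close>

definition eps_mor ::
  "('o, 'u) cat \<Rightarrow> ('o, 'u, 'a, 'm, 'k) prestack_data \<Rightarrow> ('o, 'u) nsimplex \<Rightarrow> nat \<Rightarrow> 'a \<Rightarrow> 'm" where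
  "eps_mor U A \<sigma> k P = (let us = snd \<sigma>; u = us ! (k - 1); u' = us ! k;
       P' = star_obj A (drop (k + 1) us) P
     in star_mor A (take (k - 1) us) (Robj A u (Robj A u' P')) (Robj A (Cmp U u' u) P') (Tw A u' u P'))"


section \<open>Cochains\<close>

text \<open>A \<open>q\<close>-simplex \<open>(a\<^sub>1, \<dots>, a\<^sub>q)\<close> on objects \<open>P\<^sub>0, \<dots>, P\<^sub>q\<close> is given by the lists
  \<open>[P\<^sub>0, \<dots>, P\<^sub>q]\<close> and \<open>[a\<^sub>1, \<dots>, a\<^sub>q]\<close>; the objects are numbered along the direction of the
  arrows, the arrows against it: \<open>a\<^sub>i\<close> goes from \<open>P\<^sub>q\<^sub>-\<^sub>i\<close> to \<open>P\<^sub>q\<^sub>-\<^sub>i\<^sub>+\<^sub>1\<close>.\<close>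

definition cat_simplex :: "('a, 'm, 'k) lincat \<Rightarrow> nat \<Rightarrow> 'a list \<Rightarrow> 'm list \<Rightarrow> bool" where
  "cat_simplex C q Ps as \<longleftrightarrow> length Ps = q + 1 \<and> length as = q \<and> set Ps \<subseteq> Ob C \<and>
     (\<forall>i\<in>{1..q}. as ! (i - 1) \<in> carrier (Mor C (Ps ! (q - i)) (Ps ! (q - i + 1))))"

type_synonym ('o, 'u, 'a, 'm) cochain_arg = "('o, 'u) nsimplex \<times> 'a list \<times> 'm list"
type_synonym ('o, 'u, 'a, 'm) cochain = "('o, 'u, 'a, 'm) cochain_arg \<Rightarrow> 'm"

definition cochain_index ::
  "('o, 'u) cat \<Rightarrow> ('o, 'u, 'a, 'm, 'k) prestack_data \<Rightarrow> nat \<Rightarrow> nat \<Rightarrow>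
   ('o, 'u, 'a, 'm) cochain_arg set" where
  "cochain_index U A p q =
     {(\<sigma>, Ps, as). \<sigma> \<in> nerve U p \<and> cat_simplex (Fib A (last_vertex U \<sigma>)) q Ps as}"

definition value_module ::
  "('o, 'u) cat \<Rightarrow> ('o, 'u, 'a, 'm, 'k) prestack_data \<Rightarrow> ('o, 'u, 'a, 'm) cochain_arg \<Rightarrow>
   ('k, 'm) module" where
  "value_module U A = (\<lambda>(\<sigma>, Ps, as).
     Mor (Fib A (fst \<sigma>)) (star_obj A (snd \<sigma>) (hd Ps)) (Robj A (total_arrow U \<sigma>) (last Ps)))"

text \<open>Linear maps out of a tensor product are rendered as multilinear maps. Cochains are
  extensional functions, so that equality of cochains is equality in the product.\<close>

definition cochains ::
  "('k, 'z) ring_scheme \<Rightarrow> ('o, 'u) cat \<Rightarrow> ('o, 'u, 'a, 'm, 'k) prestack_data \<Rightarrow> nat \<Rightarrow> nat \<Rightarrow>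
   ('o, 'u, 'a, 'm) cochain set" where
  "cochains K U A p q =
     {\<phi> \<in> (\<Pi>\<^sub>E x\<in>cochain_index U A p q. carrier (value_module U A x)).
        \<forall>(\<sigma>, Ps, as)\<in>cochain_index U A p q. \<forall>i\<in>{1..q}.
          linear_map K (Mor (Fib A (last_vertex U \<sigma>)) (Ps ! (q - i)) (Ps ! (q - i + 1)))
            (value_module U A (\<sigma>, Ps, as)) (\<lambda>b. \<phi> (\<sigma>, Ps, as[i - 1 := b]))}"

definition normalized ::
  "('o, 'u) cat \<Rightarrow> ('o, 'u, 'a, 'm, 'k) prestack_data \<Rightarrow> nat \<Rightarrow> nat \<Rightarrow>
   ('o, 'u, 'a, 'm) cochain \<Rightarrow> bool" where
  "normalized U A p q \<phi> \<longleftrightarrow> (\<forall>(\<sigma>, Ps, as)\<in>cochain_index U A p q.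
     (\<exists>i\<in>{1..q}. Ps ! (q - i) = Ps ! (q - i + 1) \<and>
        as ! (i - 1) = Id (Fib A (last_vertex U \<sigma>)) (Ps ! (q - i)))
     \<longrightarrow> \<phi> (\<sigma>, Ps, as) = \<zero>\<^bsub>value_module U A (\<sigma>, Ps, as)\<^esub>)"

definition reduced ::
  "('o, 'u) cat \<Rightarrow> ('o, 'u, 'a, 'm, 'k) prestack_data \<Rightarrow> nat \<Rightarrow> nat \<Rightarrow>
   ('o, 'u, 'a, 'm) cochain \<Rightarrow> bool" where
  "reduced U A p q \<phi> \<longleftrightarrow> (\<forall>(\<sigma>, Ps, as)\<in>cochain_index U A p q.
     (\<exists>X\<in>Obj U. Ident U X \<in> set (snd \<sigma>))
     \<longrightarrow> \<phi> (\<sigma>, Ps, as) = \<zero>\<^bsub>value_module U A (\<sigma>, Ps, as)\<^esub>)"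


section \<open>Paths and shuffles\<close>

text \<open>A path of an \<open>n\<close>-simplex is recorded by the list of the \<open>l = n - 1\<close> choices of a face index,
  the first choice being the one made for the simplex itself.\<close>

fun path_choices :: "nat \<Rightarrow> nat list set" where
  "path_choices 0 = {[]}"
| "path_choices (Suc l) = {i # is |i is. i \<in> {1..Suc l} \<and> is \<in> path_choices l}"

definition path_sign :: "nat list \<Rightarrow> int" where
  "path_sign is = (-1) ^ sum_list is"

fun path_transformations ::
  "('o, 'u) cat \<Rightarrow> ('o, 'u, 'a, 'm, 'k) prestack_data \<Rightarrow> ('o, 'u) nsimplex \<Rightarrow> nat list \<Rightarrow>
   ('a \<Rightarrow> 'm) list" where
  "path_transformations U A \<sigma> [] = []"
| "path_transformations U A \<sigma> (i # is) =
     path_transformations U A (face U i \<sigma>) is @ [eps_mor U A \<sigma> i]"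

text \<open>The functors \<open>[T\<^sub>0, \<dots>, T\<^sub>l]\<close> (object part, morphism part) along the path; the last one is
  \<open>\<tau>\<^sup>\<star> = \<tau>\<^sup>*\<close> for the \<open>1\<close>-simplex \<open>\<tau>\<close> that remains.\<close>

fun path_functors ::
  "('o, 'u) cat \<Rightarrow> ('o, 'u, 'a, 'm, 'k) prestack_data \<Rightarrow> ('o, 'u) nsimplex \<Rightarrow> nat list \<Rightarrow>
   (('a \<Rightarrow> 'a) \<times> ('a \<Rightarrow> 'a \<Rightarrow> 'm \<Rightarrow> 'm)) list" where
  "path_functors U A \<sigma> [] = [(star_obj A (snd \<sigma>), star_mor A (snd \<sigma>))]"
| "path_functors U A \<sigma> (i # is) =
     (star_obj A (snd \<sigma>), star_mor A (snd \<sigma>)) # path_functors U A (face U i \<sigma>) is"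

definition shuffles_perm :: "nat \<Rightarrow> nat \<Rightarrow> (nat \<Rightarrow> nat) set" where
  "shuffles_perm m l = {\<beta>. \<beta> permutes {1..m + l} \<and>
     strict_mono_on {1..m} \<beta> \<and> strict_mono_on {m + 1..m + l} \<beta>}"

text \<open>The simplex \<open>\<beta>(a, r) = (b\<^sub>1, \<dots>, b\<^sub>m\<^sub>+\<^sub>l)\<close>. Position \<open>x\<close> holds the entry with number
  \<open>\<beta>\<^sup>-\<^sup>1(x)\<close> of \<open>(a\<^sub>1, \<dots>, a\<^sub>m, r\<^sub>1, \<dots>, r\<^sub>l)\<close>. The source of \<open>b\<^sub>x\<close> is
  \<open>T\<^sub>l\<^sub>-\<^sub>y(P\<^sub>m\<^sub>-\<^sub>z)\<close> when the positions up to and including \<open>x\<close> hold \<open>y\<close> of the \<open>r\<close>'s and \<open>z\<close> of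
  the \<open>a\<close>'s; for \<open>x = 0\<close> the same expression is the target of \<open>b\<^sub>1\<close>.\<close>

definition shuffle_arrow ::
  "(('a \<Rightarrow> 'a) \<times> ('a \<Rightarrow> 'a \<Rightarrow> 'm \<Rightarrow> 'm)) list \<Rightarrow> ('a \<Rightarrow> 'm) list \<Rightarrow> 'a list \<Rightarrow> 'm list \<Rightarrow>
   (nat \<Rightarrow> nat) \<Rightarrow> nat \<Rightarrow> 'm" where
  "shuffle_arrow Ts rs Ps as \<beta> x =
     (let m = length as; l = length rs; i = inv_into UNIV \<beta> x in
      if i \<le> m
      then snd (Ts ! (l - card {k \<in> {m + 1..m + l}. \<beta> k < x})) (Ps ! (m - i)) (Ps ! (m - i + 1)) (as ! (i - 1))
      else (rs ! (i - m - 1)) (Ps ! (m - card {k \<in> {1..m}. \<beta> k < x})))"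

definition shuffle_object ::
  "(('a \<Rightarrow> 'a) \<times> ('a \<Rightarrow> 'a \<Rightarrow> 'm \<Rightarrow> 'm)) list \<Rightarrow> ('a \<Rightarrow> 'm) list \<Rightarrow> 'a list \<Rightarrow> 'm list \<Rightarrow>
   (nat \<Rightarrow> nat) \<Rightarrow> nat \<Rightarrow> 'a" where
  "shuffle_object Ts rs Ps as \<beta> x =
     (let m = length as; l = length rs in
      fst (Ts ! (l - card {k \<in> {m + 1..m + l}. \<beta> k \<le> x})) (Ps ! (m - card {k \<in> {1..m}. \<beta> k \<le> x})))"

definition shuffle_simplex ::
  "(('a \<Rightarrow> 'a) \<times> ('a \<Rightarrow> 'a \<Rightarrow> 'm \<Rightarrow> 'm)) list \<Rightarrow> ('a \<Rightarrow> 'm) list \<Rightarrow> 'a list \<Rightarrow> 'm list \<Rightarrow>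
   (nat \<Rightarrow> nat) \<Rightarrow> 'a list \<times> 'm list" where
  "shuffle_simplex Ts rs Ps as \<beta> =
     (let N = length as + length rs in
      (map (\<lambda>j. shuffle_object Ts rs Ps as \<beta> (N - j)) [0..<N + 1],
       map (shuffle_arrow Ts rs Ps as \<beta>) [1..<N + 1]))"


section \<open>The Gerstenhaber-Schack complex\<close>

text \<open>In the following definitions \<open>\<phi>\<close> has bidegree \<open>(p, q)\<close>. The expression
  \<open>[s] \<cdot>\<^bsub>M\<^esub> x\<close> is the integer multiple of \<open>x\<close> by the sign \<open>s\<close>.\<close>

definition d_hoch ::
  "('o, 'u) cat \<Rightarrow> ('o, 'u, 'a, 'm, 'k) prestack_data \<Rightarrow> nat \<Rightarrow> nat \<Rightarrow>
   ('o, 'u, 'a, 'm) cochain \<Rightarrow> ('o, 'u, 'a, 'm) cochain" where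
  "d_hoch U A p q \<phi> = (\<lambda>(\<sigma>, Ps, as).
     let M = value_module U A (\<sigma>, Ps, as);
         C0 = Fib A (fst \<sigma>); C1 = Fib A (last_vertex U \<sigma>);
         so = star_obj A (snd \<sigma>); to = Robj A (total_arrow U \<sigma>)
     in Comp C0 (so (Ps ! 0)) (to (Ps ! q)) (to (Ps ! (q + 1)))
          (Rmor A (total_arrow U \<sigma>) (Ps ! q) (Ps ! (q + 1)) (as ! 0)) (\<phi> (\<sigma>, butlast Ps, tl as))
        \<oplus>\<^bsub>M\<^esub> (\<Oplus>\<^bsub>M\<^esub>i\<in>{1..q}. [((-1) ^ i :: int)] \<cdot>\<^bsub>M\<^esub>
          \<phi> (\<sigma>, take (q + 1 - i) Ps @ drop (q + 2 - i) Ps,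
             take (i - 1) as
               @ [Comp C1 (Ps ! (q - i)) (Ps ! (q + 1 - i)) (Ps ! (q + 2 - i)) (as ! (i - 1)) (as ! i)]
               @ drop (i + 1) as))
        \<oplus>\<^bsub>M\<^esub> [((-1) ^ (q + 1) :: int)] \<cdot>\<^bsub>M\<^esub>
          Comp C0 (so (Ps ! 0)) (so (Ps ! 1)) (to (Ps ! (q + 1)))
            (\<phi> (\<sigma>, tl Ps, butlast as)) (star_mor A (snd \<sigma>) (Ps ! 0) (Ps ! 1) (as ! q)))"

definition d_simp ::
  "('o, 'u) cat \<Rightarrow> ('o, 'u, 'a, 'm, 'k) prestack_data \<Rightarrow> nat \<Rightarrow> nat \<Rightarrow>
   ('o, 'u, 'a, 'm) cochain \<Rightarrow> ('o, 'u, 'a, 'm) cochain" where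
  "d_simp U A p q \<phi> = (\<lambda>(\<sigma>, Ps, as).
     let M = value_module U A (\<sigma>, Ps, as);
         C0 = Fib A (fst \<sigma>);
         src = star_obj A (snd \<sigma>) (Ps ! 0); tgt = Robj A (total_arrow U \<sigma>) (Ps ! q);
         u1 = hd (snd \<sigma>); up1 = last (snd \<sigma>); d0 = face U 0 \<sigma>;
         src0 = star_obj A (snd d0) (Ps ! 0); tgt0 = Robj A (total_arrow U d0) (Ps ! q)
     in Comp C0 src (Robj A u1 tgt0) tgt
          (c_mor U A \<sigma> 1 (Ps ! q)) (Rmor A u1 src0 tgt0 (\<phi> (d0, Ps, as)))
        \<oplus>\<^bsub>M\<^esub> (\<Oplus>\<^bsub>M\<^esub>i\<in>{1..p}. [((-1) ^ i :: int)] \<cdot>\<^bsub>M\<^esub>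
          Comp C0 src (star_obj A (snd (face U i \<sigma>)) (Ps ! 0)) tgt
            (\<phi> (face U i \<sigma>, Ps, as)) (eps_mor U A \<sigma> i (Ps ! 0)))
        \<oplus>\<^bsub>M\<^esub> [((-1) ^ (p + 1) :: int)] \<cdot>\<^bsub>M\<^esub>
          Comp C0 src (Robj A (total_arrow U (face U (p + 1) \<sigma>)) (Robj A up1 (Ps ! q))) tgt
            (c_mor U A \<sigma> p (Ps ! q))
            (\<phi> (face U (p + 1) \<sigma>, map (Robj A up1) Ps,
                map (\<lambda>i. Rmor A up1 (Ps ! (q - i)) (Ps ! (q - i + 1)) (as ! (i - 1))) [1..<q + 1])))"

definition d_higher ::
  "('o, 'u) cat \<Rightarrow> ('o, 'u, 'a, 'm, 'k) prestack_data \<Rightarrow> nat \<Rightarrow> nat \<Rightarrow> nat \<Rightarrow>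
   ('o, 'u, 'a, 'm) cochain \<Rightarrow> ('o, 'u, 'a, 'm) cochain" where
  "d_higher U A p q j \<phi> = (\<lambda>(\<sigma>, Ps, as).
     let M = value_module U A (\<sigma>, Ps, as); t = q + 1 - j;
         L = left_part p \<sigma>; R = right_part U p \<sigma>
     in finsum M (\<lambda>(r, \<beta>).
          [(path_sign r * sign \<beta> * (-1) ^ t)] \<cdot>\<^bsub>M\<^esub>
            Comp (Fib A (fst \<sigma>)) (star_obj A (snd \<sigma>) (Ps ! 0))
              (Robj A (total_arrow U L) (Robj A (total_arrow U R) (Ps ! t))) (Robj A (total_arrow U \<sigma>) (Ps ! t))
              (c_mor U A \<sigma> p (Ps ! t))
              (\<phi> (L, shuffle_simplex (path_functors U A R r) (path_transformations U A R r) Ps as \<beta>)))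
          (path_choices (j - 1) \<times> shuffles_perm t (j - 1)))"

text \<open>The component \<open>d\<^sub>j\<close> of the differential, from bidegree \<open>(p, q)\<close> to \<open>(p + j, q + 1 - j)\<close>.\<close>

definition d_component ::
  "('o, 'u) cat \<Rightarrow> ('o, 'u, 'a, 'm, 'k) prestack_data \<Rightarrow> nat \<Rightarrow> nat \<Rightarrow> nat \<Rightarrow>
   ('o, 'u, 'a, 'm) cochain \<Rightarrow> ('o, 'u, 'a, 'm) cochain" where
  "d_component U A p q j \<phi> = (\<lambda>x\<in>cochain_index U A (p + j) (q + 1 - j).
     if j = 0 then d_hoch U A p q \<phi> x
     else if j = 1
       then [((-1) ^ (p + q + 1) :: int)] \<cdot>\<^bsub>value_module U A x\<^esub> d_simp U A p q \<phi> x
     else d_higher U A p q j \<phi> x)"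

text \<open>An element of \<open>C\<^sup>n\<close> is the family of its components \<open>\<phi> p\<close> of bidegree \<open>(p, n - p)\<close>. The group
  operation of the record below is the addition of cochains.\<close>

definition gs_group ::
  "('k, 'z) ring_scheme \<Rightarrow> ('o, 'u) cat \<Rightarrow> ('o, 'u, 'a, 'm, 'k) prestack_data \<Rightarrow> nat \<Rightarrow>
   (nat \<Rightarrow> ('o, 'u, 'a, 'm) cochain) monoid" where
  "gs_group K U A n =
     \<lparr> carrier = (\<Pi>\<^sub>E p\<in>{..n}. cochains K U A p (n - p)),
       monoid.mult = (\<lambda>\<phi> \<psi>. \<lambda>p\<in>{..n}. \<lambda>x\<in>cochain_index U A p (n - p). \<phi> p x \<oplus>\<^bsub>value_module U A x\<^esub> \<psi> p x),
       one = (\<lambda>p\<in>{..n}. \<lambda>x\<in>cochain_index U A p (n - p). \<zero>\<^bsub>value_module U A x\<^esub>) \<rparr>"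

text \<open>The component of bidegree \<open>(p', n + 1 - p')\<close> of \<open>d \<phi>\<close> is the sum of the \<open>d\<^sub>j\<close> of the components
  of bidegree \<open>(p, n - p)\<close> with \<open>p + j = p'\<close>.\<close>

definition gs_differential ::
  "('o, 'u) cat \<Rightarrow> ('o, 'u, 'a, 'm, 'k) prestack_data \<Rightarrow> nat \<Rightarrow>
   (nat \<Rightarrow> ('o, 'u, 'a, 'm) cochain) \<Rightarrow> nat \<Rightarrow> ('o, 'u, 'a, 'm) cochain" where
  "gs_differential U A n \<phi> = (\<lambda>p'\<in>{..n + 1}. \<lambda>x\<in>cochain_index U A p' (n + 1 - p').
     \<Oplus>\<^bsub>value_module U A x\<^esub>p\<in>{..min n p'}. d_component U A p (n - p) (p' - p) (\<phi> p) x)"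

definition gs_cocycles ::
  "('k, 'z) ring_scheme \<Rightarrow> ('o, 'u) cat \<Rightarrow> ('o, 'u, 'a, 'm, 'k) prestack_data \<Rightarrow> nat \<Rightarrow>
   (nat \<Rightarrow> ('o, 'u, 'a, 'm) cochain) set" where
  "gs_cocycles K U A n = kernel (gs_group K U A n) (gs_group K U A (n + 1)) (gs_differential U A n)"

definition gs_coboundaries ::
  "('k, 'z) ring_scheme \<Rightarrow> ('o, 'u) cat \<Rightarrow> ('o, 'u, 'a, 'm, 'k) prestack_data \<Rightarrow> nat \<Rightarrow>
   (nat \<Rightarrow> ('o, 'u, 'a, 'm) cochain) set" where
  "gs_coboundaries K U A n =
     (if n = 0 then {\<one>\<^bsub>gs_group K U A n\<^esub>}
      else gs_differential U A (n - 1) ` carrier (gs_group K U A (n - 1)))"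

definition gs_cohomology ::
  "('k, 'z) ring_scheme \<Rightarrow> ('o, 'u) cat \<Rightarrow> ('o, 'u, 'a, 'm, 'k) prestack_data \<Rightarrow> nat \<Rightarrow>
   (nat \<Rightarrow> ('o, 'u, 'a, 'm) cochain) set monoid" where
  "gs_cohomology K U A n =
     (gs_group K U A n)\<lparr>carrier := gs_cocycles K U A n\<rparr> Mod gs_coboundaries K U A n"

definition gs_class ::
  "('k, 'z) ring_scheme \<Rightarrow> ('o, 'u) cat \<Rightarrow> ('o, 'u, 'a, 'm, 'k) prestack_data \<Rightarrow> nat \<Rightarrow>
   (nat \<Rightarrow> ('o, 'u, 'a, 'm) cochain) \<Rightarrow> (nat \<Rightarrow> ('o, 'u, 'a, 'm) cochain) set" where
  "gs_class K U A n \<phi> = gs_coboundaries K U A n #>\<^bsub>gs_group K U A n\<^esub> \<phi>"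

definition normalized_reduced ::
  "('o, 'u) cat \<Rightarrow> ('o, 'u, 'a, 'm, 'k) prestack_data \<Rightarrow> nat \<Rightarrow>
   (nat \<Rightarrow> ('o, 'u, 'a, 'm) cochain) \<Rightarrow> bool" where
  "normalized_reduced U A n \<phi> \<longleftrightarrow>
     (\<forall>p\<le>n. normalized U A p (n - p) (\<phi> p) \<and> reduced U A p (n - p) (\<phi> p))"


section \<open>First order deformations\<close>

text \<open>The ring \<open>k[\<epsilon>]\<close> and the module \<open>M \<otimes>\<^sub>k k[\<epsilon>] = M \<oplus> M\<epsilon>\<close>; the pair \<open>(x, x')\<close> stands
  for \<open>x + x'\<epsilon>\<close>.\<close>

definition dual_ring :: "('k, 'z) ring_scheme \<Rightarrow> ('k \<times> 'k) ring" where
  "dual_ring K =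
     \<lparr> carrier = carrier K \<times> carrier K,
       monoid.mult = (\<lambda>(x, x') (y, y'). (x \<otimes>\<^bsub>K\<^esub> y, x \<otimes>\<^bsub>K\<^esub> y' \<oplus>\<^bsub>K\<^esub> x' \<otimes>\<^bsub>K\<^esub> y)),
       one = (\<one>\<^bsub>K\<^esub>, \<zero>\<^bsub>K\<^esub>),
       zero = (\<zero>\<^bsub>K\<^esub>, \<zero>\<^bsub>K\<^esub>),
       add = (\<lambda>(x, x') (y, y'). (x \<oplus>\<^bsub>K\<^esub> y, x' \<oplus>\<^bsub>K\<^esub> y')) \<rparr>"

definition dual_module :: "('k, 'm) module \<Rightarrow> ('k \<times> 'k, 'm \<times> 'm) module" where
  "dual_module M =
     \<lparr> carrier = carrier M \<times> carrier M,
       monoid.mult = undefined,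
       one = undefined,
       zero = (\<zero>\<^bsub>M\<^esub>, \<zero>\<^bsub>M\<^esub>),
       add = (\<lambda>(x, x') (y, y'). (x \<oplus>\<^bsub>M\<^esub> y, x' \<oplus>\<^bsub>M\<^esub> y')),
       smult = (\<lambda>(s, s') (x, x'). (s \<odot>\<^bsub>M\<^esub> x, s \<odot>\<^bsub>M\<^esub> x' \<oplus>\<^bsub>M\<^esub> s' \<odot>\<^bsub>M\<^esub> x)) \<rparr>"

text \<open>The \<open>k[\<epsilon>]\<close>-linear data \<open>(A[\<epsilon>], m + m\<^sub>1\<epsilon>, f + f\<^sub>1\<epsilon>, c + c\<^sub>1\<epsilon>)\<close>, the maps \<open>m\<^sub>1\<close> and \<open>f\<^sub>1\<close> being
  extended \<open>k[\<epsilon>]\<close>-linearly. Note the order \<open>c\<^sub>1\<^bsup>(v,u)\<^esup>\<close>.\<close>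

type_synonym ('o, 'u, 'a, 'm) triple =
  "('o, 'u, 'a, 'm) cochain \<times> ('o, 'u, 'a, 'm) cochain \<times> ('o, 'u, 'a, 'm) cochain"

definition deformed ::
  "('o, 'u) cat \<Rightarrow> ('o, 'u, 'a, 'm, 'k) prestack_data \<Rightarrow> ('o, 'u, 'a, 'm) triple \<Rightarrow>
   ('o, 'u, 'a, 'm \<times> 'm, 'k \<times> 'k) prestack_data" where
  "deformed U A = (\<lambda>(m1, f1, c1).
     \<lparr> Fib = (\<lambda>X. let C = Fib A X in
         \<lparr> Ob = Ob C,
           Mor = (\<lambda>P Q. dual_module (Mor C P Q)),
           Id = (\<lambda>P. (Id C P, \<zero>\<^bsub>Mor C P P\<^esub>)),
           Comp = (\<lambda>P Q R (b, b') (a, a').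
             (Comp C P Q R b a,
              Comp C P Q R b a' \<oplus>\<^bsub>Mor C P R\<^esub> Comp C P Q R b' a
                \<oplus>\<^bsub>Mor C P R\<^esub> m1 ((X, []), [P, Q, R], [b, a]))) \<rparr>),
       Robj = Robj A,
       Rmor = (\<lambda>u P Q (a, a').
         (Rmor A u P Q a,
          Rmor A u P Q a' \<oplus>\<^bsub>Mor (Fib A (Dom U u)) (Robj A u P) (Robj A u Q)\<^esub>
            f1 ((Dom U u, [u]), [P, Q], [a]))),
       Tw = (\<lambda>u v P. (Tw A u v P, c1 ((Dom U v, [v, u]), [P], []))) \<rparr>)"

definition deformations ::
  "('k, 'z) ring_scheme \<Rightarrow> ('o, 'u) cat \<Rightarrow> ('o, 'u, 'a, 'm, 'k) prestack_data \<Rightarrow>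
   ('o, 'u, 'a, 'm) triple set" where
  "deformations K U A =
     {D \<in> cochains K U A 0 2 \<times> cochains K U A 1 1 \<times> cochains K U A 2 0.
        prestack (dual_ring K) U (deformed U A D)}"

text \<open>Isomorphisms of the form \<open>(1 + g\<^sub>1\<epsilon>, 1 + \<tau>\<^sub>1\<epsilon>)\<close> that are the identity on objects.\<close>

definition deformation_equivalence ::
  "('k, 'z) ring_scheme \<Rightarrow> ('o, 'u) cat \<Rightarrow> ('o, 'u, 'a, 'm, 'k) prestack_data \<Rightarrow>
   (('o, 'u, 'a, 'm) triple \<times> ('o, 'u, 'a, 'm) triple) set" where
  "deformation_equivalence K U A =
     {(D, D'). D \<in> deformations K U A \<and> D' \<in> deformations K U A \<and>
        (\<exists>g1\<in>cochains K U A 0 1. \<exists>t1\<in>cochains K U A 1 0.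
           prestack_isomorphism (dual_ring K) U (deformed U A D) (deformed U A D')
             (\<lambda>X P. P)
             (\<lambda>X P Q (a, a'). (a, a' \<oplus>\<^bsub>Mor (Fib A X) P Q\<^esub> g1 ((X, []), [P, Q], [a])))
             (\<lambda>u P. (Id (Fib A (Dom U u)) (Robj A u P), t1 ((Dom U u, [u]), [P], []))))}"

definition triple_of ::
  "(nat \<Rightarrow> ('o, 'u, 'a, 'm) cochain) \<Rightarrow> ('o, 'u, 'a, 'm) triple" where
  "triple_of \<phi> = (\<phi> 0, \<phi> 1, \<phi> 2)"

end

theory Submission
  imports Defs "HOL-Library.Poly_Mapping"
begin

text \<open>Write \<open>(m, f, c)\<close> for the components of a \<open>2\<close>-cochain in bidegrees \<open>(0, 2)\<close>, \<open>(1, 1)\<close>, \<open>(2, 0)\<close>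
  and \<open>(g, t)\<close> for those of a \<open>1\<close>-cochain in bidegrees \<open>(0, 1)\<close>, \<open>(1, 0)\<close>.

  Over the dual numbers, an equation between morphisms of the data deformed by \<open>(m, f, c)\<close> has a
  constant coefficient, which is the same equation in \<open>A\<close>, and a coefficient of \<open>\<epsilon>\<close>. For the four prestack
  axioms about composites (associativity, functoriality of restriction, naturality of the twists and
  their coherence) the coefficient of \<open>\<epsilon>\<close> states that a linear expression in \<open>(m, f, c)\<close>, called a
  defect below, is zero. The four defects are exactly the components of \<open>d(m, f, c)\<close> in bidegrees \<open>(0, 3)\<close>,
  \<open>(1, 2)\<close>, \<open>(2, 1)\<close>, \<open>(3, 0)\<close>; the shuffles and paths in \<open>d\<^sub>2\<close> and \<open>d\<^sub>3\<close> produce the two sides of naturality and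
  of coherence (\<open>differential_0_3\<close>, \<open>differential_1_2\<close>, \<open>differential_2_1\<close>, \<open>differential_3_0\<close>). For the axioms
  about identities, the coefficient of \<open>\<epsilon>\<close> states that \<open>(m, f, c)\<close> is normalized and reduced. Hence the first
  order deformations are the normalized reduced cocycles (\<open>triple_of_deformation_iff\<close>).

  In the same way, \<open>(1 + g\<epsilon>, 1 - t\<epsilon>)\<close> is a morphism from the deformation by \<open>(m, f, c)\<close> to the one by
  \<open>(m', f', c')\<close> if and only if \<open>(m, f, c) = (m', f', c') + d(g, t)\<close>. Its inverse is
  \<open>(1 - g\<epsilon>, 1 + t\<epsilon>)\<close>. So two deformations are equivalent exactly when their cocycles are cohomologous
  (\<open>deformation_equivalence_iff\<close>), and equivalence classes of deformations correspond to the cohomology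
  classes that contain a normalized reduced cocycle.

  Every class contains one (\<open>cocycle_normalization\<close>). Subtracting the coboundary of a suitable \<open>(g, t)\<close> makes
  the values \<open>m(1, 1)\<close> and \<open>c\<^bsup>(1,1)\<^esup>\<close> zero, and the cocycle equations evaluated on identities then force all
  other values on identities to vanish (\<open>normalized_if_units_vanish\<close>). The difference is again a cocycle,
  because adding a coboundary does not change the defects.

  All calculations take place in the abelian groups of morphisms. Bilinearity of composition, functoriality,
  naturality and coherence bring both sides of an equation into sums of the same monomials, and the
  remaining additive identity is checked in a free abelian group (\<open>combination_eqI\<close>).\<close>

section \<open>Additive identities via free abelian groups\<close>

text \<open>\<open>combination G S s\<close> says that \<open>s\<close> is the value in \<open>G\<close> of an element \<open>S\<close> of the free abelian group on the
  elements of \<open>G\<close>. The introduction rules follow the shape of the expression \<open>s\<close>, so that resolution with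
  them computes \<open>S\<close>. Since the free abelian group is a type of class \<open>ab_group_add\<close>, equations in it are within
  reach of the simplifier, in contrast to equations relative to a carrier.\<close>

inductive combination :: "('m, 'z) ring_scheme \<Rightarrow> ('m \<Rightarrow>\<^sub>0 int) \<Rightarrow> 'm \<Rightarrow> bool"
  for G :: "('m, 'z) ring_scheme" where
  combination_add: "\<lbrakk>combination G S s; combination G T t\<rbrakk> \<Longrightarrow> combination G (S + T) (s \<oplus>\<^bsub>G\<^esub> t)"
| combination_diff: "\<lbrakk>combination G S s; combination G T t\<rbrakk> \<Longrightarrow> combination G (S - T) (s \<ominus>\<^bsub>G\<^esub> t)"
| combination_uminus: "combination G S s \<Longrightarrow> combination G (- S) (\<ominus>\<^bsub>G\<^esub> s)"
| combination_zero: "combination G 0 \<zero>\<^bsub>G\<^esub>"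
| combination_atom: "x \<in> carrier G \<Longrightarrow> combination G (frag_of x) x"

definition (in abelian_group) eval_combination :: "('a \<Rightarrow>\<^sub>0 int) \<Rightarrow> 'a" where
  "eval_combination S = (\<Oplus>x\<in>Poly_Mapping.keys S. [Poly_Mapping.lookup S x] \<cdot> x)"

context abelian_group
begin

lemma zero_int_multiple: "[(0::int)] \<cdot> x = \<zero>"
  by (simp add: add_pow_def int_pow_def nat_pow_def)

lemma eval_combination_superset:
  assumes "finite B" "Poly_Mapping.keys S \<subseteq> B" "B \<subseteq> carrier G"
  shows "eval_combination S = (\<Oplus>x\<in>B. [Poly_Mapping.lookup S x] \<cdot> x)"
  unfolding eval_combination_def
  by (rule add.finprod_mono_neutral_cong_left)
     (use assms in \<open>auto simp: not_in_keys_iff_lookup_eq_zero zero_int_multiple intro: add.int_pow_closed\<close>)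

text \<open>Negation and addition are special cases of subtraction, so this suffices for all rules of
  \<open>combination\<close>.\<close>

lemma eval_combination_diff:
  assumes S: "Poly_Mapping.keys S \<subseteq> carrier G" and T: "Poly_Mapping.keys T \<subseteq> carrier G"
  shows "eval_combination (S - T) = eval_combination S \<ominus> eval_combination T"
proof -
  let ?B = "Poly_Mapping.keys S \<union> Poly_Mapping.keys T"
  have B: "finite ?B" "?B \<subseteq> carrier G" using S T by auto
  have "Poly_Mapping.keys (S - T) \<subseteq> ?B" by (metis keys_diff)
  then have *: "eval_combination (S - T) = (\<Oplus>x\<in>?B. [Poly_Mapping.lookup S x] \<cdot> x \<ominus> [Poly_Mapping.lookup T x] \<cdot> x)"
    using B by (subst eval_combination_superset[of ?B])
      (auto simp: lookup_minus add.int_pow_diff minus_eq intro!: finsum_cong' intro: add.int_pow_closed)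
  have "eval_combination (S - T) \<oplus> eval_combination T =
     (\<Oplus>x\<in>?B. ([Poly_Mapping.lookup S x] \<cdot> x \<ominus> [Poly_Mapping.lookup T x] \<cdot> x) \<oplus> [Poly_Mapping.lookup T x] \<cdot> x)"
    unfolding * using B by (subst eval_combination_superset[of ?B T])
      (auto intro!: finsum_addf[symmetric] intro: add.int_pow_closed)
  also have "\<dots> = eval_combination S"
    using B by (subst eval_combination_superset[of ?B S])
      (auto simp: minus_eq a_assoc l_neg intro!: finsum_cong' intro: add.int_pow_closed)
  finally have sum: "eval_combination (S - T) \<oplus> eval_combination T = eval_combination S" .
  have closed: "eval_combination R \<in> carrier G" if "Poly_Mapping.keys R \<subseteq> carrier G" for R
    unfolding eval_combination_def using that by (auto intro!: finsum_closed add.int_pow_closed)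
  have "eval_combination (S - T) \<in> carrier G"
    using \<open>Poly_Mapping.keys (S - T) \<subseteq> ?B\<close> B by (intro closed) auto
  then show ?thesis
    using sum closed[OF T] by (auto simp: minus_eq a_assoc r_neg simp flip: sum)
qed

lemma combination_eval:
  "combination G S s \<Longrightarrow> Poly_Mapping.keys S \<subseteq> carrier G \<and> s \<in> carrier G \<and> s = eval_combination S"
proof (induction rule: combination.induct)
  case combination_zero
  then show ?case by (simp add: eval_combination_def)
next
  case (combination_atom x)
  then show ?case by (simp add: eval_combination_def add.int_pow_1)
next
  case (combination_diff S s T t)
  then show ?case using keys_diff[of S T] by (auto simp: eval_combination_diff)
next
  case (combination_uminus S s)
  have "eval_combination (0 - S) = eval_combination 0 \<ominus> eval_combination S"
    using combination_uminus by (intro eval_combination_diff) auto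
  then show ?case using combination_uminus
    by (auto simp: minus_eq eval_combination_def)
next
  case (combination_add S s T t)
  have "eval_combination (0 - T) = eval_combination 0 \<ominus> eval_combination T"
    using combination_add by (intro eval_combination_diff) auto
  moreover have "eval_combination (S - (- T)) = eval_combination S \<ominus> eval_combination (- T)"
    using combination_add by (intro eval_combination_diff) auto
  ultimately show ?case using combination_add keys_add[of S T]
    by (auto simp: minus_eq eval_combination_def)
qed

end

lemma combination_eqI:
  assumes "combination G S s" "combination G T t" "abelian_group G" "S = T"
  shows "s = t"
proof -
  interpret abelian_group G by fact
  show ?thesis using assms combination_eval by metis
qed

text \<open>The relation \<open>e = e'\<close> is a hypothesis of the calculation, and \<open>s - t\<close> is to agree with \<open>e - e'\<close> formally.
  When it enters with the opposite sign, the relation is used in the form \<open>e' = e\<close>.\<close>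

lemma combination_eq_from:
  assumes "e = e'" "combination G E e" "combination G E' e'" "combination G S s" "combination G T t"
    and "abelian_group G" and "S - T = E - E'"
  shows "s = t"
proof -
  interpret abelian_group G by fact
  have "s \<ominus>\<^bsub>G\<^esub> t = e \<ominus>\<^bsub>G\<^esub> e'"
    using assms by (intro combination_eqI[OF combination_diff combination_diff])
  moreover have "s \<in> carrier G" "t \<in> carrier G" "e' \<in> carrier G" using assms(3-5) by (simp_all add: combination_eval)
  ultimately show ?thesis using \<open>e = e'\<close> by (simp add: minus_equality r_neg a_minus_def)
      (metis a_inv_closed add.inv_solve_right' l_zero zero_closed)
qed

lemmas combination_intros = combination_add combination_diff combination_uminus combination_zero

section \<open>Linear maps and linear categories\<close>

lemma linear_map_closed: "\<lbrakk>linear_map K M N f; x \<in> carrier M\<rbrakk> \<Longrightarrow> f x \<in> carrier N"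
  and linear_map_add: "\<lbrakk>linear_map K M N f; x \<in> carrier M; y \<in> carrier M\<rbrakk> \<Longrightarrow> f (x \<oplus>\<^bsub>M\<^esub> y) = f x \<oplus>\<^bsub>N\<^esub> f y"
  and linear_map_smult: "\<lbrakk>linear_map K M N f; s \<in> carrier K; x \<in> carrier M\<rbrakk> \<Longrightarrow> f (s \<odot>\<^bsub>M\<^esub> x) = s \<odot>\<^bsub>N\<^esub> f x"
  unfolding linear_map_def by auto

lemma linear_map_zero:
  assumes "linear_map K M N f" "module K M" "module K N"
  shows "f \<zero>\<^bsub>M\<^esub> = \<zero>\<^bsub>N\<^esub>"
proof -
  interpret M: module K M by fact
  interpret N: module K N by fact
  have "f \<zero>\<^bsub>M\<^esub> \<oplus>\<^bsub>N\<^esub> f \<zero>\<^bsub>M\<^esub> = f \<zero>\<^bsub>M\<^esub>"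
    using linear_map_add[OF assms(1), of "\<zero>\<^bsub>M\<^esub>" "\<zero>\<^bsub>M\<^esub>"] by simp
  then show ?thesis using linear_map_closed[OF assms(1), of "\<zero>\<^bsub>M\<^esub>"] by simp
qed

lemma linear_map_uminus:
  assumes "linear_map K M N f" "module K M" "module K N" and x: "x \<in> carrier M"
  shows "f (\<ominus>\<^bsub>M\<^esub> x) = \<ominus>\<^bsub>N\<^esub> f x"
proof -
  interpret M: module K M by fact
  interpret N: module K N by fact
  have "f (\<ominus>\<^bsub>M\<^esub> x) \<oplus>\<^bsub>N\<^esub> f x = \<zero>\<^bsub>N\<^esub>"
    using linear_map_add[OF assms(1), of "\<ominus>\<^bsub>M\<^esub> x" x] linear_map_zero[OF assms(1-3)] x by (simp add: M.l_neg)
  then show ?thesis using linear_map_closed[OF assms(1)] x by (metis M.a_inv_closed N.minus_equality)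
qed

lemma linear_map_diff:
  assumes "linear_map K M N f" "module K M" "module K N" "x \<in> carrier M" "y \<in> carrier M"
  shows "f (x \<ominus>\<^bsub>M\<^esub> y) = f x \<ominus>\<^bsub>N\<^esub> f y"
proof -
  interpret M: module K M by fact
  show ?thesis using assms
    by (simp add: a_minus_def linear_map_add linear_map_uminus)
qed

lemma linear_map_compose:
  "\<lbrakk>linear_map K M N f; linear_map K N L g\<rbrakk> \<Longrightarrow> linear_map K M L (\<lambda>x. g (f x))"
  unfolding linear_map_def by (auto simp: Pi_iff)

lemma linear_map_ident: "linear_map K M M (\<lambda>x. x)"
  unfolding linear_map_def by auto

lemma linear_map_cong:
  assumes "linear_map K M N f" "module K M" "\<And>x. x \<in> carrier M \<Longrightarrow> g x = f x"
  shows "linear_map K M N g"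
proof -
  interpret M: module K M by fact
  show ?thesis using assms(1,3) unfolding linear_map_def by (auto simp: Pi_iff)
qed

lemma linear_map_plus:
  assumes "linear_map K M N f" "linear_map K M N g" "module K N"
  shows "linear_map K M N (\<lambda>x. f x \<oplus>\<^bsub>N\<^esub> g x)"
proof -
  interpret N: module K N by fact
  show ?thesis using assms(1,2)
    unfolding linear_map_def
    by (auto simp: Pi_iff N.smult_r_distr N.a_ac)
qed

lemma linear_map_neg:
  assumes "linear_map K M N f" "module K N"
  shows "linear_map K M N (\<lambda>x. \<ominus>\<^bsub>N\<^esub> f x)"
proof -
  interpret N: module K N by fact
  show ?thesis using assms(1)
    unfolding linear_map_def
    by (auto simp: Pi_iff N.minus_add N.smult_r_minus)
qed

lemma linear_map_minus:
  assumes "linear_map K M N f" "linear_map K M N g" "module K N"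
  shows "linear_map K M N (\<lambda>x. f x \<ominus>\<^bsub>N\<^esub> g x)"
  using linear_map_plus[OF assms(1) linear_map_neg[OF assms(2,3)] assms(3)] by (simp add: a_minus_def)

lemma linear_map_zero_map:
  assumes "module K N" shows "linear_map K M N (\<lambda>x. \<zero>\<^bsub>N\<^esub>)"
proof -
  interpret N: module K N by fact
  show ?thesis unfolding linear_map_def by (auto simp: N.smult_r_null)
qed

context linear_category
begin

lemma Mor_abelian_group: "\<lbrakk>P \<in> Ob C; Q \<in> Ob C\<rbrakk> \<Longrightarrow> abelian_group (Mor C P Q)"
  using Mor_module by (rule module.axioms)

lemmas Mor_abelian_monoid = abelian_group.axioms(1)[OF Mor_abelian_group]
lemmas add_closed = abelian_monoid.a_closed[OF Mor_abelian_monoid]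
lemmas zero_closed = abelian_monoid.zero_closed[OF Mor_abelian_monoid]
lemmas minus_closed = abelian_group.minus_closed[OF Mor_abelian_group]
lemmas uminus_closed = abelian_group.a_inv_closed[OF Mor_abelian_group]
lemmas add_zero = abelian_monoid.r_zero[OF Mor_abelian_monoid]
lemmas zero_add = abelian_monoid.l_zero[OF Mor_abelian_monoid]

lemma uminus_zero: "\<lbrakk>P \<in> Ob C; Q \<in> Ob C\<rbrakk> \<Longrightarrow> \<ominus>\<^bsub>Mor C P Q\<^esub> \<zero>\<^bsub>Mor C P Q\<^esub> = \<zero>\<^bsub>Mor C P Q\<^esub>"
  by (metis Mor_abelian_group abelian_group.minus_equality zero_add zero_closed)

lemma Comp_closed: "\<lbrakk>P \<in> Ob C; Q \<in> Ob C; R \<in> Ob C; g \<in> carrier (Mor C Q R); f \<in> carrier (Mor C P Q)\<rbrakk>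
    \<Longrightarrow> Comp C P Q R g f \<in> carrier (Mor C P R)"
  using linear_map_closed[OF Comp_linear_right] .

lemma Comp_add_right: "\<lbrakk>P \<in> Ob C; Q \<in> Ob C; R \<in> Ob C; g \<in> carrier (Mor C Q R); f \<in> carrier (Mor C P Q); f' \<in> carrier (Mor C P Q)\<rbrakk>
    \<Longrightarrow> Comp C P Q R g (f \<oplus>\<^bsub>Mor C P Q\<^esub> f') = Comp C P Q R g f \<oplus>\<^bsub>Mor C P R\<^esub> Comp C P Q R g f'"
  using linear_map_add[OF Comp_linear_right] .

lemma Comp_diff_right: "\<lbrakk>P \<in> Ob C; Q \<in> Ob C; R \<in> Ob C; g \<in> carrier (Mor C Q R); f \<in> carrier (Mor C P Q); f' \<in> carrier (Mor C P Q)\<rbrakk>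
    \<Longrightarrow> Comp C P Q R g (f \<ominus>\<^bsub>Mor C P Q\<^esub> f') = Comp C P Q R g f \<ominus>\<^bsub>Mor C P R\<^esub> Comp C P Q R g f'"
  using linear_map_diff[OF Comp_linear_right Mor_module Mor_module] .

lemma Comp_uminus_right: "\<lbrakk>P \<in> Ob C; Q \<in> Ob C; R \<in> Ob C; g \<in> carrier (Mor C Q R); f \<in> carrier (Mor C P Q)\<rbrakk>
    \<Longrightarrow> Comp C P Q R g (\<ominus>\<^bsub>Mor C P Q\<^esub> f) = \<ominus>\<^bsub>Mor C P R\<^esub> Comp C P Q R g f"
  using linear_map_uminus[OF Comp_linear_right Mor_module Mor_module] .

lemma Comp_zero_right: "\<lbrakk>P \<in> Ob C; Q \<in> Ob C; R \<in> Ob C; g \<in> carrier (Mor C Q R)\<rbrakk>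
    \<Longrightarrow> Comp C P Q R g \<zero>\<^bsub>Mor C P Q\<^esub> = \<zero>\<^bsub>Mor C P R\<^esub>"
  using linear_map_zero[OF Comp_linear_right Mor_module Mor_module] .

lemma Comp_add_left: "\<lbrakk>P \<in> Ob C; Q \<in> Ob C; R \<in> Ob C; g \<in> carrier (Mor C Q R); g' \<in> carrier (Mor C Q R); f \<in> carrier (Mor C P Q)\<rbrakk>
    \<Longrightarrow> Comp C P Q R (g \<oplus>\<^bsub>Mor C Q R\<^esub> g') f = Comp C P Q R g f \<oplus>\<^bsub>Mor C P R\<^esub> Comp C P Q R g' f"
  using linear_map_add[OF Comp_linear_left] .

lemma Comp_diff_left: "\<lbrakk>P \<in> Ob C; Q \<in> Ob C; R \<in> Ob C; g \<in> carrier (Mor C Q R); g' \<in> carrier (Mor C Q R); f \<in> carrier (Mor C P Q)\<rbrakk>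
    \<Longrightarrow> Comp C P Q R (g \<ominus>\<^bsub>Mor C Q R\<^esub> g') f = Comp C P Q R g f \<ominus>\<^bsub>Mor C P R\<^esub> Comp C P Q R g' f"
  using linear_map_diff[OF Comp_linear_left Mor_module Mor_module] .

lemma Comp_uminus_left: "\<lbrakk>P \<in> Ob C; Q \<in> Ob C; R \<in> Ob C; g \<in> carrier (Mor C Q R); f \<in> carrier (Mor C P Q)\<rbrakk>
    \<Longrightarrow> Comp C P Q R (\<ominus>\<^bsub>Mor C Q R\<^esub> g) f = \<ominus>\<^bsub>Mor C P R\<^esub> Comp C P Q R g f"
  using linear_map_uminus[OF Comp_linear_left Mor_module Mor_module] .

lemma Comp_zero_left: "\<lbrakk>P \<in> Ob C; Q \<in> Ob C; R \<in> Ob C; f \<in> carrier (Mor C P Q)\<rbrakk>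
    \<Longrightarrow> Comp C P Q R \<zero>\<^bsub>Mor C Q R\<^esub> f = \<zero>\<^bsub>Mor C P R\<^esub>"
  using linear_map_zero[OF Comp_linear_left Mor_module Mor_module] .

text \<open>Composites are associated to the right, so a chain contains the two sides of a commutative square
  \<open>k f = h g\<close> only in the form \<open>k (f x)\<close> and \<open>h (g x)\<close>. This is the rewriting rule for that position.\<close>

lemma precompose_square:
  "\<lbrakk>Comp C P Q S k f = Comp C P R S h g; N \<in> Ob C; P \<in> Ob C; Q \<in> Ob C; R \<in> Ob C; S \<in> Ob C; f \<in> carrier (Mor C P Q);
    k \<in> carrier (Mor C Q S); g \<in> carrier (Mor C P R); h \<in> carrier (Mor C R S); x \<in> carrier (Mor C N P)\<rbrakk>
    \<Longrightarrow> Comp C N Q S k (Comp C N P Q f x) = Comp C N R S h (Comp C N P R g x)"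
  by (simp flip: Comp_assoc)

end

section \<open>Calculation rules in a prestack\<close>

locale prestack_on_category = small_category U + prestack K U A
  for K :: "('k, 'z) ring_scheme" and U :: "('o, 'u) cat" and A :: "('o, 'u, 'a, 'm, 'k) prestack_data" 
begin

lemmas category_rules = Dom_closed Cod_closed Ident_closed Dom_Ident Cod_Ident Cmp_closed Dom_Cmp Cod_Cmp

abbreviation Hom :: "'o \<Rightarrow> 'a \<Rightarrow> 'a \<Rightarrow> ('k, 'm) module" where
  "Hom X P Q \<equiv> Mor (Fib A X) P Q"

abbreviation Hom_set :: "'o \<Rightarrow> 'a \<Rightarrow> 'a \<Rightarrow> 'm set" where
  "Hom_set X P Q \<equiv> carrier (Hom X P Q)"

abbreviation Objs :: "'o \<Rightarrow> 'a set" where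
  "Objs X \<equiv> Ob (Fib A X)"

abbreviation cmp :: "'o \<Rightarrow> 'a \<Rightarrow> 'a \<Rightarrow> 'a \<Rightarrow> 'm \<Rightarrow> 'm \<Rightarrow> 'm" where
  "cmp X \<equiv> Comp (Fib A X)"

abbreviation idm :: "'o \<Rightarrow> 'a \<Rightarrow> 'm" where
  "idm X \<equiv> Id (Fib A X)"

lemmas Hom_module = linear_category.Mor_module[OF Fib_linear_category]
lemmas Hom_abelian_group = linear_category.Mor_abelian_group[OF Fib_linear_category]

lemma Hom_eqI:
  "\<lbrakk>combination (Hom X P Q) S s; combination (Hom X P Q) T t; X \<in> Obj U; P \<in> Objs X; Q \<in> Objs X; S = T\<rbrakk> \<Longrightarrow> s = t"
  by (rule combination_eqI[OF _ _ Hom_abelian_group])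

lemma Hom_eq_from:
  "\<lbrakk>e = e'; combination (Hom X P Q) E e; combination (Hom X P Q) E' e';
    combination (Hom X P Q) S s; combination (Hom X P Q) T t; X \<in> Obj U; P \<in> Objs X; Q \<in> Objs X; S - T = E - E'\<rbrakk> \<Longrightarrow> s = t"
  by (rule combination_eq_from[OF _ _ _ _ _ Hom_abelian_group])

lemmas Hom_closed =
  linear_category.add_closed[OF Fib_linear_category]
  linear_category.minus_closed[OF Fib_linear_category]
  linear_category.uminus_closed[OF Fib_linear_category]
  linear_category.zero_closed[OF Fib_linear_category]
  linear_category.Comp_closed[OF Fib_linear_category]
  linear_category.Id_closed[OF Fib_linear_category]
lemmas Hom_distrib =
  linear_category.Comp_add_left[OF Fib_linear_category]
  linear_category.Comp_add_right[OF Fib_linear_category]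
  linear_category.Comp_diff_left[OF Fib_linear_category]
  linear_category.Comp_diff_right[OF Fib_linear_category]
  linear_category.Comp_uminus_left[OF Fib_linear_category]
  linear_category.Comp_uminus_right[OF Fib_linear_category]
  linear_category.Comp_zero_left[OF Fib_linear_category]
  linear_category.Comp_zero_right[OF Fib_linear_category]
lemmas Hom_zero =
  linear_category.add_zero[OF Fib_linear_category]
  linear_category.zero_add[OF Fib_linear_category]
  linear_category.uminus_zero[OF Fib_linear_category]
lemmas Hom_Id =
  linear_category.Comp_Id_left[OF Fib_linear_category]
  linear_category.Comp_Id_right[OF Fib_linear_category]
lemmas Hom_assoc = linear_category.Comp_assoc[OF Fib_linear_category]
lemmas Hom_linear_right = linear_category.Comp_linear_right[OF Fib_linear_category]
lemmas Hom_linear_left = linear_category.Comp_linear_left[OF Fib_linear_category]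

text \<open>Where the domain or codomain of an arrow occurs in the conclusion of one of the following rules, it is
  a variable subject to \<open>Dom U u = V\<close> or \<open>Cod U u = X\<close>. In the calculations such equations are
  simplification rules, and a conclusion containing \<open>Dom U u\<close> would never match.\<close>

lemma Robj_closed: "\<lbrakk>u \<in> Arr U; Dom U u = V; P \<in> Objs (Cod U u)\<rbrakk> \<Longrightarrow> Robj A u P \<in> Objs V"
  using linear_functor.fo_closed[OF restriction_functor] by blast

context
  fixes u V X P Q
  assumes u: "u \<in> Arr U" "Dom U u = V" "Cod U u = X" "P \<in> Objs X" "Q \<in> Objs X"
begin

lemma Rmor_linear: "linear_map K (Hom X P Q) (Hom V (Robj A u P) (Robj A u Q)) (Rmor A u P Q)"
  using linear_functor.fm_linear[OF restriction_functor] u by blast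

lemma Rmor_modules: "module K (Hom X P Q)" "module K (Hom V (Robj A u P) (Robj A u Q))"
  using u by (auto intro!: Hom_module Cod_closed Dom_closed Robj_closed)

lemma Rmor_add: "\<lbrakk>a \<in> Hom_set X P Q; b \<in> Hom_set X P Q\<rbrakk>
    \<Longrightarrow> Rmor A u P Q (a \<oplus>\<^bsub>Hom X P Q\<^esub> b) = Rmor A u P Q a \<oplus>\<^bsub>Hom V (Robj A u P) (Robj A u Q)\<^esub> Rmor A u P Q b"
  using linear_map_add[OF Rmor_linear] .

lemma Rmor_diff: "\<lbrakk>a \<in> Hom_set X P Q; b \<in> Hom_set X P Q\<rbrakk>
    \<Longrightarrow> Rmor A u P Q (a \<ominus>\<^bsub>Hom X P Q\<^esub> b) = Rmor A u P Q a \<ominus>\<^bsub>Hom V (Robj A u P) (Robj A u Q)\<^esub> Rmor A u P Q b"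
  using linear_map_diff[OF Rmor_linear Rmor_modules] .

lemma Rmor_uminus: "a \<in> Hom_set X P Q
    \<Longrightarrow> Rmor A u P Q (\<ominus>\<^bsub>Hom X P Q\<^esub> a) = \<ominus>\<^bsub>Hom V (Robj A u P) (Robj A u Q)\<^esub> Rmor A u P Q a"
  using linear_map_uminus[OF Rmor_linear Rmor_modules] .

lemma Rmor_zero: "Rmor A u P Q \<zero>\<^bsub>Hom X P Q\<^esub> = \<zero>\<^bsub>Hom V (Robj A u P) (Robj A u Q)\<^esub>"
  using linear_map_zero[OF Rmor_linear Rmor_modules] .

end

lemma Rmor_closed: "\<lbrakk>u \<in> Arr U; Dom U u = V; P \<in> Objs (Cod U u); Q \<in> Objs (Cod U u); a \<in> Hom_set (Cod U u) P Q\<rbrakk>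
    \<Longrightarrow> Rmor A u P Q a \<in> Hom_set V (Robj A u P) (Robj A u Q)"
  using linear_map_closed[OF Rmor_linear] by blast

lemma Rmor_Id: "\<lbrakk>u \<in> Arr U; Dom U u = V; Cod U u = X; P \<in> Objs X\<rbrakk>
    \<Longrightarrow> Rmor A u P P (idm X P) = idm V (Robj A u P)"
  using linear_functor.fm_Id[OF restriction_functor] by blast

lemma Rmor_Comp: "\<lbrakk>u \<in> Arr U; Dom U u = V; Cod U u = X; P \<in> Objs X; Q \<in> Objs X; R \<in> Objs X;
      f \<in> Hom_set X P Q; g \<in> Hom_set X Q R\<rbrakk>
    \<Longrightarrow> Rmor A u P R (cmp X P Q R g f)
      = cmp V (Robj A u P) (Robj A u Q) (Robj A u R) (Rmor A u Q R g) (Rmor A u P Q f)"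
  using linear_functor.fm_Comp[OF restriction_functor] by blast

lemma Tw_closed: "\<lbrakk>u \<in> Arr U; v \<in> Arr U; Cod U v = Dom U u; Dom U v = W; P \<in> Objs (Cod U u)\<rbrakk>
    \<Longrightarrow> Tw A u v P \<in> Hom_set W (Robj A v (Robj A u P)) (Robj A (Cmp U u v) P)"
  using Tw_iso unfolding is_iso_def by blast

lemma restriction_Ident: "\<lbrakk>X \<in> Obj U; P \<in> Objs X\<rbrakk> \<Longrightarrow> Robj A (Ident U X) P = P"
  "\<lbrakk>X \<in> Obj U; P \<in> Objs X; Q \<in> Objs X; a \<in> Hom_set X P Q\<rbrakk> \<Longrightarrow> Rmor A (Ident U X) P Q a = a"
  by (fact Robj_Ident, fact Rmor_Ident)

lemma Tw_Ident:
  "\<lbrakk>X \<in> Obj U; v \<in> Arr U; Cod U v = X; Dom U v = W; P \<in> Objs X\<rbrakk> \<Longrightarrow> Tw A (Ident U X) v P = idm W (Robj A v P)"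
  "\<lbrakk>X \<in> Obj U; u \<in> Arr U; Dom U u = X; P \<in> Objs (Cod U u)\<rbrakk> \<Longrightarrow> Tw A u (Ident U X) P = idm X (Robj A u P)"
  using Tw_Ident_left[of v P] Tw_Ident_right[of u P] by auto

lemmas Rmor_distrib = Rmor_add Rmor_diff Rmor_uminus Rmor_zero
lemmas Rmor_functor = Rmor_Id Rmor_Comp
lemmas closure_rules = category_rules Robj_closed Hom_closed Rmor_closed Tw_closed

end

section \<open>Cochains of low degree\<close>

context prestack_on_category
begin

lemma composable_end: "composable U X us \<Longrightarrow> X \<in> Obj U \<and> end_vertex U X us \<in> Obj U"
  by (induction us arbitrary: X) (auto simp: Dom_closed)

lemma composite_arrow:
  "composable U X us \<Longrightarrow> composite U X us \<in> Arr U \<and> Dom U (composite U X us) = X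
     \<and> Cod U (composite U X us) = end_vertex U X us"
  by (induction us arbitrary: X) (auto simp: category_rules)

lemma star_obj_closed:
  "\<lbrakk>composable U X us; P \<in> Objs (end_vertex U X us)\<rbrakk> \<Longrightarrow> star_obj A us P \<in> Objs X"
  by (induction us arbitrary: X) (auto intro: Robj_closed)

lemma value_module_module:
  assumes "x \<in> cochain_index U A p q" shows "module K (value_module U A x)"
proof -
  obtain X us Ps as where x: "x = ((X, us), Ps, as)" by (metis prod.exhaust)
  have *: "composable U X us" "cat_simplex (Fib A (end_vertex U X us)) q Ps as"
    using assms by (auto simp: x cochain_index_def nerve_def last_vertex_def)
  then have "hd Ps \<in> Objs (end_vertex U X us)" "last Ps \<in> Objs (end_vertex U X us)"
    unfolding cat_simplex_def by (cases Ps; force)+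
  then show ?thesis using composable_end[OF *(1)] composite_arrow[OF *(1)] star_obj_closed[OF *(1)]
    unfolding x value_module_def by (auto simp: total_arrow_def intro!: Hom_module Robj_closed)
qed

lemma cochain_closed:
  "\<lbrakk>\<phi> \<in> cochains K U A p q; x \<in> cochain_index U A p q\<rbrakk> \<Longrightarrow> \<phi> x \<in> carrier (value_module U A x)"
  unfolding cochains_def by blast

lemma cochain_linear:
  "\<lbrakk>\<phi> \<in> cochains K U A p q; (\<sigma>, Ps, as) \<in> cochain_index U A p q; i \<in> {1..q}\<rbrakk>
    \<Longrightarrow> linear_map K (Hom (last_vertex U \<sigma>) (Ps ! (q - i)) (Ps ! (q - i + 1)))
            (value_module U A (\<sigma>, Ps, as)) (\<lambda>b. \<phi> (\<sigma>, Ps, as[i - 1 := b]))"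
  unfolding cochains_def by blast

lemma index_0:
  "((X, us), [P], []) \<in> cochain_index U A p 0 \<longleftrightarrow>
    length us = p \<and> composable U X us \<and> P \<in> Objs (end_vertex U X us)"
  by (auto simp: cochain_index_def nerve_def last_vertex_def cat_simplex_def)

lemma index_1:
  "((X, us), [P, Q], [a]) \<in> cochain_index U A p (Suc 0) \<longleftrightarrow>
    length us = p \<and> composable U X us \<and> P \<in> Objs (end_vertex U X us) \<and> Q \<in> Objs (end_vertex U X us)
      \<and> a \<in> Hom_set (end_vertex U X us) P Q"
  by (auto simp: cochain_index_def nerve_def last_vertex_def cat_simplex_def)

lemma atLeastAtMost_numerals: "{Suc 0..2} = {1, 2}" "{Suc 0..3} = {1, 2, 3::nat}"
  by auto

lemma index_2:
  "((X, us), [P, Q, R], [b, a]) \<in> cochain_index U A p 2 \<longleftrightarrow>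
    length us = p \<and> composable U X us \<and> P \<in> Objs (end_vertex U X us) \<and> Q \<in> Objs (end_vertex U X us)
      \<and> R \<in> Objs (end_vertex U X us)
      \<and> b \<in> Hom_set (end_vertex U X us) Q R \<and> a \<in> Hom_set (end_vertex U X us) P Q"
  by (auto simp: cochain_index_def nerve_def last_vertex_def cat_simplex_def atLeastAtMost_numerals)

lemma index_3:
  "((X, us), [P, Q, R, S], [h, b, a]) \<in> cochain_index U A p 3 \<longleftrightarrow>
    length us = p \<and> composable U X us \<and> P \<in> Objs (end_vertex U X us) \<and> Q \<in> Objs (end_vertex U X us)
      \<and> R \<in> Objs (end_vertex U X us) \<and> S \<in> Objs (end_vertex U X us)
      \<and> h \<in> Hom_set (end_vertex U X us) R S
      \<and> b \<in> Hom_set (end_vertex U X us) Q R \<and> a \<in> Hom_set (end_vertex U X us) P Q"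
  by (auto simp: cochain_index_def nerve_def last_vertex_def cat_simplex_def atLeastAtMost_numerals)

lemma value_module_simps:
  "\<lbrakk>X \<in> Obj U; last (P # Ps) \<in> Objs X\<rbrakk> \<Longrightarrow> value_module U A ((X, []), P # Ps, as) = Hom X P (last (P # Ps))"
  "\<lbrakk>u \<in> Arr U\<rbrakk> \<Longrightarrow> value_module U A ((V, [u]), P # Ps, as) = Hom V (Robj A u P) (Robj A u (last (P # Ps)))"
  "\<lbrakk>u \<in> Arr U; v \<in> Arr U; Cod U v = Dom U u\<rbrakk>
    \<Longrightarrow> value_module U A ((W, [v, u]), P # Ps, as) = Hom W (Robj A v (Robj A u P)) (Robj A (Cmp U u v) (last (P # Ps)))"
  "\<lbrakk>u \<in> Arr U; v \<in> Arr U; w \<in> Arr U; Cod U v = Dom U u; Cod U w = Dom U v\<rbrakk>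
    \<Longrightarrow> value_module U A ((T, [w, v, u]), P # Ps, as)
      = Hom T (Robj A w (Robj A v (Robj A u P))) (Robj A (Cmp U u (Cmp U v w)) (last (P # Ps)))"
  by (auto simp: value_module_def total_arrow_def Robj_Ident Cmp_Ident_left Cmp_assoc)

lemma multiplication_cochain:
  assumes m: "m \<in> cochains K U A 0 2"
    and X: "X \<in> Obj U" "P \<in> Objs X" "Q \<in> Objs X" "R \<in> Objs X"
  shows "\<lbrakk>b \<in> Hom_set X Q R; a \<in> Hom_set X P Q\<rbrakk> \<Longrightarrow> m ((X, []), [P, Q, R], [b, a]) \<in> Hom_set X P R"
    and "a \<in> Hom_set X P Q \<Longrightarrow> linear_map K (Hom X Q R) (Hom X P R) (\<lambda>b. m ((X, []), [P, Q, R], [b, a]))"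
    and "b \<in> Hom_set X Q R \<Longrightarrow> linear_map K (Hom X P Q) (Hom X P R) (\<lambda>a. m ((X, []), [P, Q, R], [b, a]))"
proof -
  note index = index_2[of X "[]" P Q R _ _ 0, simplified]
  show "\<lbrakk>b \<in> Hom_set X Q R; a \<in> Hom_set X P Q\<rbrakk> \<Longrightarrow> m ((X, []), [P, Q, R], [b, a]) \<in> Hom_set X P R"
    using cochain_closed[OF m, of "((X, []), [P, Q, R], [b, a])"] X by (simp add: index value_module_simps)
  show "a \<in> Hom_set X P Q \<Longrightarrow> linear_map K (Hom X Q R) (Hom X P R) (\<lambda>b. m ((X, []), [P, Q, R], [b, a]))"
    using cochain_linear[OF m, of "(X, [])" "[P, Q, R]" "[\<zero>\<^bsub>Hom X Q R\<^esub>, a]" 1] X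
    by (simp add: index value_module_simps last_vertex_def Hom_closed)
  show "b \<in> Hom_set X Q R \<Longrightarrow> linear_map K (Hom X P Q) (Hom X P R) (\<lambda>a. m ((X, []), [P, Q, R], [b, a]))"
    using cochain_linear[OF m, of "(X, [])" "[P, Q, R]" "[b, \<zero>\<^bsub>Hom X P Q\<^esub>]" 2] X
    by (simp add: index value_module_simps last_vertex_def Hom_closed)
qed

lemma restriction_cochain:
  assumes f: "f \<in> cochains K U A 1 1"
    and u: "u \<in> Arr U" "Dom U u = V" "Cod U u = X" "P \<in> Objs X" "Q \<in> Objs X"
  shows "linear_map K (Hom X P Q) (Hom V (Robj A u P) (Robj A u Q)) (\<lambda>a. f ((V, [u]), [P, Q], [a]))"
    using cochain_linear[OF f, of "(V, [u])" "[P, Q]" "[\<zero>\<^bsub>Hom X P Q\<^esub>]" 1] u Cod_closed[of u]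
    by (simp add: index_1 value_module_simps last_vertex_def Hom_closed)

lemma twist_cochain:
  assumes c: "c \<in> cochains K U A 2 0"
    and u: "u \<in> Arr U" "v \<in> Arr U" "Cod U v = Dom U u" "Dom U v = W" "P \<in> Objs (Cod U u)"
  shows "c ((W, [v, u]), [P], []) \<in> Hom_set W (Robj A v (Robj A u P)) (Robj A (Cmp U u v) P)"
  using cochain_closed[OF c, of "((W, [v, u]), [P], [])"] u
  by (simp add: index_0 value_module_simps last_vertex_def Hom_closed Cod_closed)

lemma functor_cochain:
  assumes g: "g \<in> cochains K U A 0 1"
    and X: "X \<in> Obj U" "P \<in> Objs X" "Q \<in> Objs X"
  shows "linear_map K (Hom X P Q) (Hom X P Q) (\<lambda>a. g ((X, []), [P, Q], [a]))"
    using cochain_linear[OF g, of "(X, [])" "[P, Q]" "[\<zero>\<^bsub>Hom X P Q\<^esub>]" 1] X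
    by (simp add: index_1 value_module_simps last_vertex_def Hom_closed)

lemma transformation_cochain:
  assumes t: "t \<in> cochains K U A 1 0"
    and u: "u \<in> Arr U" "Dom U u = V" "P \<in> Objs (Cod U u)"
  shows "t ((V, [u]), [P], []) \<in> Hom_set V (Robj A u P) (Robj A u P)"
  using cochain_closed[OF t, of "((V, [u]), [P], [])"] u
  by (simp add: index_0 value_module_simps last_vertex_def Hom_closed Cod_closed)

end

locale two_cochain = prestack_on_category K U A
  for K :: "('k, 'z) ring_scheme" and U :: "('o, 'u) cat" and A :: "('o, 'u, 'a, 'm, 'k) prestack_data" +
  fixes m f c :: "('o, 'u, 'a, 'm) cochain"
  assumes m: "m \<in> cochains K U A 0 2" and f: "f \<in> cochains K U A 1 1" and c: "c \<in> cochains K U A 2 0"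
begin

lemmas m_linear_left = multiplication_cochain(2)[OF m]
lemmas m_linear_right = multiplication_cochain(3)[OF m]
lemmas f_linear = restriction_cochain[OF f]

lemma f_closed: "\<lbrakk>u \<in> Arr U; Dom U u = V; P \<in> Objs (Cod U u); Q \<in> Objs (Cod U u); a \<in> Hom_set (Cod U u) P Q\<rbrakk>
    \<Longrightarrow> f ((V, [u]), [P, Q], [a]) \<in> Hom_set V (Robj A u P) (Robj A u Q)"
  using linear_map_closed[OF f_linear] by blast

lemmas two_cochain_closed = multiplication_cochain(1)[OF m] f_closed twist_cochain[OF c]
lemmas two_cochain_distrib =
  linear_map_add[OF m_linear_left] linear_map_add[OF m_linear_right] linear_map_add[OF f_linear]
  linear_map_diff[OF m_linear_left Hom_module Hom_module] linear_map_diff[OF m_linear_right Hom_module Hom_module]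
  linear_map_diff[OF f_linear Rmor_modules]
  linear_map_uminus[OF m_linear_left Hom_module Hom_module] linear_map_uminus[OF m_linear_right Hom_module Hom_module]
  linear_map_uminus[OF f_linear Rmor_modules]
  linear_map_zero[OF m_linear_left Hom_module Hom_module] linear_map_zero[OF m_linear_right Hom_module Hom_module]
  linear_map_zero[OF f_linear Rmor_modules]

text \<open>The twist of \<open>u v\<close> and \<open>w\<close> and the cochain \<open>c\<close> on these arrows have their target at the composite \<open>(u v) w\<close>,
  while the simplifier normalizes composites to \<open>u (v w)\<close>. The rules for a general pair of arrows
  therefore do not apply to them.\<close>

lemma triple_composite:
  assumes "u \<in> Arr U" "v \<in> Arr U" "w \<in> Arr U" "Cod U v = Dom U u" "Cod U w = Dom U v" "Dom U w = T" "P \<in> Objs (Cod U u)"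
  shows "Cmp U (Cmp U u v) w = Cmp U u (Cmp U v w)"
    and "Tw A (Cmp U u v) w P \<in> Hom_set T (Robj A w (Robj A (Cmp U u v) P)) (Robj A (Cmp U u (Cmp U v w)) P)"
    and "c ((T, [w, Cmp U u v]), [P], []) \<in> Hom_set T (Robj A w (Robj A (Cmp U u v) P)) (Robj A (Cmp U u (Cmp U v w)) P)"
  using assms Tw_closed[of "Cmp U u v" w T P] twist_cochain[OF c, of "Cmp U u v" w T P]
  by (simp_all add: closure_rules Cmp_assoc)

end

locale one_cochain = prestack_on_category K U A
  for K :: "('k, 'z) ring_scheme" and U :: "('o, 'u) cat" and A :: "('o, 'u, 'a, 'm, 'k) prestack_data" +
  fixes g t :: "('o, 'u, 'a, 'm) cochain"
  assumes g: "g \<in> cochains K U A 0 1" and t: "t \<in> cochains K U A 1 0"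
begin

lemmas g_linear = functor_cochain[OF g]
lemmas one_cochain_closed = linear_map_closed[OF g_linear] transformation_cochain[OF t]
lemmas one_cochain_distrib = linear_map_add[OF g_linear] linear_map_diff[OF g_linear Hom_module Hom_module]
  linear_map_uminus[OF g_linear Hom_module Hom_module] linear_map_zero[OF g_linear Hom_module Hom_module]

end

context prestack_on_category
begin

lemma Tw_natural_square:
  assumes [simp]: "u \<in> Arr U" "v \<in> Arr U" "Cod U v = Dom U u" "Dom U v = W"
    "P \<in> Objs (Cod U u)" "Q \<in> Objs (Cod U u)" "a \<in> Hom_set (Cod U u) P Q"
  shows "cmp W (Robj A v (Robj A u P)) (Robj A (Cmp U u v) P) (Robj A (Cmp U u v) Q)
         (Rmor A (Cmp U u v) P Q a) (Tw A u v P)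
     = cmp W (Robj A v (Robj A u P)) (Robj A v (Robj A u Q)) (Robj A (Cmp U u v) Q)
         (Tw A u v Q) (Rmor A v (Robj A u P) (Robj A u Q) (Rmor A u P Q a))" (is "?lhs = ?rhs")
    and "\<lbrakk>N \<in> Objs W; x \<in> Hom_set W N (Robj A v (Robj A u P))\<rbrakk>
   \<Longrightarrow> cmp W N (Robj A (Cmp U u v) P) (Robj A (Cmp U u v) Q)
         (Rmor A (Cmp U u v) P Q a) (cmp W N (Robj A v (Robj A u P)) (Robj A (Cmp U u v) P) (Tw A u v P) x)
     = cmp W N (Robj A v (Robj A u Q)) (Robj A (Cmp U u v) Q) (Tw A u v Q)
         (cmp W N (Robj A v (Robj A u P)) (Robj A v (Robj A u Q)) (Rmor A v (Robj A u P) (Robj A u Q) (Rmor A u P Q a)) x)"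
proof -
  show "?lhs = ?rhs" using Tw_natural[of u v P Q a] by simp
  moreover have "W \<in> Obj U" using Dom_closed[of v] by simp
  ultimately show "cmp W N (Robj A (Cmp U u v) P) (Robj A (Cmp U u v) Q)
         (Rmor A (Cmp U u v) P Q a) (cmp W N (Robj A v (Robj A u P)) (Robj A (Cmp U u v) P) (Tw A u v P) x)
     = cmp W N (Robj A v (Robj A u Q)) (Robj A (Cmp U u v) Q) (Tw A u v Q)
         (cmp W N (Robj A v (Robj A u P)) (Robj A v (Robj A u Q)) (Rmor A v (Robj A u P) (Robj A u Q) (Rmor A u P Q a)) x)"
    if "N \<in> Objs W" "x \<in> Hom_set W N (Robj A v (Robj A u P))" using that by (intro linear_category.precompose_square[OF Fib_linear_category]) (simp_all add: closure_rules)
qed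

lemma Tw_coherence_square:
  assumes [simp]: "u \<in> Arr U" "v \<in> Arr U" "w \<in> Arr U" "Dom U u = V" "Cod U u = X" "Dom U v = W" "Cod U v = V" "Dom U w = T" "Cod U w = W"
   "P \<in> Objs X"
  shows "cmp T (Robj A w (Robj A v (Robj A u P))) (Robj A (Cmp U v w) (Robj A u P)) (Robj A (Cmp U u (Cmp U v w)) P)
                (Tw A u (Cmp U v w) P) (Tw A v w (Robj A u P))
            = cmp T (Robj A w (Robj A v (Robj A u P))) (Robj A w (Robj A (Cmp U u v) P)) (Robj A (Cmp U u (Cmp U v w)) P)
                (Tw A (Cmp U u v) w P) (Rmor A w (Robj A v (Robj A u P)) (Robj A (Cmp U u v) P) (Tw A u v P))" (is "?lhs = ?rhs")
   and "\<lbrakk>N \<in> Objs T; x \<in> Hom_set T N (Robj A w (Robj A v (Robj A u P)))\<rbrakk>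
      \<Longrightarrow> cmp T N (Robj A (Cmp U v w) (Robj A u P)) (Robj A (Cmp U u (Cmp U v w)) P) (Tw A u (Cmp U v w) P)
              (cmp T N (Robj A w (Robj A v (Robj A u P))) (Robj A (Cmp U v w) (Robj A u P)) (Tw A v w (Robj A u P)) x)
            = cmp T N (Robj A w (Robj A (Cmp U u v) P)) (Robj A (Cmp U u (Cmp U v w)) P) (Tw A (Cmp U u v) w P)
              (cmp T N (Robj A w (Robj A v (Robj A u P))) (Robj A w (Robj A (Cmp U u v) P))
                 (Rmor A w (Robj A v (Robj A u P)) (Robj A (Cmp U u v) P) (Tw A u v P)) x)"
proof -
  show "?lhs = ?rhs" using Tw_coherence[of u v w P] by simp
  moreover have "T \<in> Obj U" using Dom_closed[of w] by simp
  moreover have "Tw A (Cmp U u v) w P \<in> Hom_set T (Robj A w (Robj A (Cmp U u v) P)) (Robj A (Cmp U u (Cmp U v w)) P)"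
    using Tw_closed[of "Cmp U u v" w T P] by (simp add: closure_rules Cmp_assoc)
  ultimately show "cmp T N (Robj A (Cmp U v w) (Robj A u P)) (Robj A (Cmp U u (Cmp U v w)) P) (Tw A u (Cmp U v w) P)
              (cmp T N (Robj A w (Robj A v (Robj A u P))) (Robj A (Cmp U v w) (Robj A u P)) (Tw A v w (Robj A u P)) x)
            = cmp T N (Robj A w (Robj A (Cmp U u v) P)) (Robj A (Cmp U u (Cmp U v w)) P) (Tw A (Cmp U u v) w P)
              (cmp T N (Robj A w (Robj A v (Robj A u P))) (Robj A w (Robj A (Cmp U u v) P))
                 (Rmor A w (Robj A v (Robj A u P)) (Robj A (Cmp U u v) P) (Tw A u v P)) x)"
    if "N \<in> Objs T" "x \<in> Hom_set T N (Robj A w (Robj A v (Robj A u P)))" using that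
    by (intro linear_category.precompose_square[OF Fib_linear_category]) (simp_all add: closure_rules)
qed

text \<open>The three components of \<open>d(g, t)\<close>, in bidegrees \<open>(0, 2)\<close>, \<open>(1, 1)\<close> and \<open>(2, 0)\<close>.\<close>

definition multiplication_coboundary where
  "multiplication_coboundary g X P Q R b a =
     cmp X P Q R b (g ((X, []), [P, Q], [a]))
     \<ominus>\<^bsub>Hom X P R\<^esub> g ((X, []), [P, R], [cmp X P Q R b a])
     \<oplus>\<^bsub>Hom X P R\<^esub> cmp X P Q R (g ((X, []), [Q, R], [b])) a"

definition restriction_coboundary where
  "restriction_coboundary g t u P Q a =
     (let V = Dom U u; M = Hom V (Robj A u P) (Robj A u Q) in
     cmp V (Robj A u P) (Robj A u P) (Robj A u Q) (Rmor A u P Q a) (t ((V, [u]), [P], []))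
     \<ominus>\<^bsub>M\<^esub> cmp V (Robj A u P) (Robj A u Q) (Robj A u Q) (t ((V, [u]), [Q], [])) (Rmor A u P Q a)
     \<oplus>\<^bsub>M\<^esub> Rmor A u P Q (g ((Cod U u, []), [P, Q], [a]))
     \<ominus>\<^bsub>M\<^esub> g ((V, []), [Robj A u P, Robj A u Q], [Rmor A u P Q a]))"

definition twist_coboundary where
  "twist_coboundary g t u v P =
     (let V = Dom U u; W = Dom U v; vuP = Robj A v (Robj A u P); uvP = Robj A (Cmp U u v) P; M = Hom W vuP uvP in
     cmp W vuP vuP uvP (Tw A u v P) (Rmor A v (Robj A u P) (Robj A u P) (t ((V, [u]), [P], [])))
     \<ominus>\<^bsub>M\<^esub> cmp W vuP uvP uvP (t ((W, [Cmp U u v]), [P], [])) (Tw A u v P)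
     \<oplus>\<^bsub>M\<^esub> cmp W vuP vuP uvP (Tw A u v P) (t ((W, [v]), [Robj A u P], []))
     \<ominus>\<^bsub>M\<^esub> g ((W, []), [vuP, uvP], [Tw A u v P]))"

text \<open>The difference of the two sides of a prestack axiom for the data deformed by \<open>(m, f, c)\<close>, evaluated
  on morphisms of \<open>A\<close>, is a multiple of \<open>\<epsilon>\<close>. The following four expressions are its coefficient, up to a sign that
  is chosen to agree with the differential.\<close>

definition associativity_defect where
  "associativity_defect m X P0 P1 P2 P3 a1 a2 a3 =
     cmp X P0 P2 P3 a1 (m ((X, []), [P0, P1, P2], [a2, a3]))
     \<ominus>\<^bsub>Hom X P0 P3\<^esub> m ((X, []), [P0, P1, P3], [cmp X P1 P2 P3 a1 a2, a3])
     \<oplus>\<^bsub>Hom X P0 P3\<^esub> m ((X, []), [P0, P2, P3], [a1, cmp X P0 P1 P2 a2 a3])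
     \<ominus>\<^bsub>Hom X P0 P3\<^esub> cmp X P0 P1 P3 (m ((X, []), [P1, P2, P3], [a1, a2])) a3"

definition functoriality_defect where
  "functoriality_defect m f u P0 P1 P2 a1 a2 =
     (let V = Dom U u; M = Hom V (Robj A u P0) (Robj A u P2) in
     cmp V (Robj A u P0) (Robj A u P1) (Robj A u P2) (Rmor A u P1 P2 a1) (f ((V, [u]), [P0, P1], [a2]))
     \<ominus>\<^bsub>M\<^esub> f ((V, [u]), [P0, P2], [cmp (Cod U u) P0 P1 P2 a1 a2])
     \<oplus>\<^bsub>M\<^esub> cmp V (Robj A u P0) (Robj A u P1) (Robj A u P2) (f ((V, [u]), [P1, P2], [a1])) (Rmor A u P0 P1 a2)
     \<ominus>\<^bsub>M\<^esub> Rmor A u P0 P2 (m ((Cod U u, []), [P0, P1, P2], [a1, a2]))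
     \<oplus>\<^bsub>M\<^esub> m ((V, []), [Robj A u P0, Robj A u P1, Robj A u P2], [Rmor A u P1 P2 a1, Rmor A u P0 P1 a2]))"

definition naturality_defect where
  "naturality_defect m f c u v P Q a =
     (let V = Dom U u; W = Dom U v; vuP = Robj A v (Robj A u P); vuQ = Robj A v (Robj A u Q);
        uvP = Robj A (Cmp U u v) P; uvQ = Robj A (Cmp U u v) Q; M = Hom W vuP uvQ in
     cmp W vuP uvP uvQ (Rmor A (Cmp U u v) P Q a) (c ((W, [v, u]), [P], []))
     \<ominus>\<^bsub>M\<^esub> cmp W vuP vuQ uvQ (c ((W, [v, u]), [Q], [])) (Rmor A v (Robj A u P) (Robj A u Q) (Rmor A u P Q a))
     \<ominus>\<^bsub>M\<^esub> cmp W vuP vuQ uvQ (Tw A u v Q) (Rmor A v (Robj A u P) (Robj A u Q) (f ((V, [u]), [P, Q], [a])))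
     \<oplus>\<^bsub>M\<^esub> cmp W vuP uvP uvQ (f ((W, [Cmp U u v]), [P, Q], [a])) (Tw A u v P)
     \<ominus>\<^bsub>M\<^esub> cmp W vuP vuQ uvQ (Tw A u v Q) (f ((W, [v]), [Robj A u P, Robj A u Q], [Rmor A u P Q a]))
     \<oplus>\<^bsub>M\<^esub> m ((W, []), [vuP, uvP, uvQ], [Rmor A (Cmp U u v) P Q a, Tw A u v P])
     \<ominus>\<^bsub>M\<^esub> m ((W, []), [vuP, vuQ, uvQ], [Tw A u v Q, Rmor A v (Robj A u P) (Robj A u Q) (Rmor A u P Q a)]))"

definition coherence_defect where
  "coherence_defect m f c u v w P =
     (let V = Dom U u; W = Dom U v; T = Dom U w; uP = Robj A u P; uvP = Robj A (Cmp U u v) P;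
        src = Robj A w (Robj A v uP); tgt = Robj A (Cmp U u (Cmp U v w)) P; M = Hom T src tgt in
     cmp T src (Robj A (Cmp U v w) uP) tgt (c ((T, [Cmp U v w, u]), [P], [])) (Tw A v w uP)
     \<oplus>\<^bsub>M\<^esub> cmp T src (Robj A (Cmp U v w) uP) tgt (Tw A u (Cmp U v w) P) (c ((T, [w, v]), [uP], []))
     \<ominus>\<^bsub>M\<^esub> cmp T src (Robj A w uvP) tgt (c ((T, [w, Cmp U u v]), [P], [])) (Rmor A w (Robj A v uP) uvP (Tw A u v P))
     \<ominus>\<^bsub>M\<^esub> cmp T src (Robj A w uvP) tgt (Tw A (Cmp U u v) w P) (Rmor A w (Robj A v uP) uvP (c ((W, [v, u]), [P], [])))
     \<ominus>\<^bsub>M\<^esub> cmp T src (Robj A w uvP) tgt (Tw A (Cmp U u v) w P) (f ((T, [w]), [Robj A v uP, uvP], [Tw A u v P]))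
     \<oplus>\<^bsub>M\<^esub> m ((T, []), [src, Robj A (Cmp U v w) uP, tgt], [Tw A u (Cmp U v w) P, Tw A v w uP])
     \<ominus>\<^bsub>M\<^esub> m ((T, []), [src, Robj A w uvP, tgt], [Tw A (Cmp U u v) w P, Rmor A w (Robj A v uP) uvP (Tw A u v P)]))"

end

text \<open>The relation \<open>(m', f', c') = (m, f, c) + d(g, t)\<close>, on all arguments.\<close>

locale cohomologous = two_cochain K U A m f c + one_cochain K U A g t
  for K :: "('k, 'z) ring_scheme" and U :: "('o, 'u) cat" and A :: "('o, 'u, 'a, 'm, 'k) prestack_data" and m f c g t +
  fixes m' f' c' :: "('o, 'u, 'a, 'm) cochain"
  assumes m'_cohomologous: "\<lbrakk>X \<in> Obj U; P \<in> Objs X; Q \<in> Objs X; R \<in> Objs X;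
      b \<in> Hom_set X Q R; a \<in> Hom_set X P Q\<rbrakk>
    \<Longrightarrow> m' ((X, []), [P, Q, R], [b, a])
      = m ((X, []), [P, Q, R], [b, a]) \<oplus>\<^bsub>Hom X P R\<^esub> multiplication_coboundary g X P Q R b a"
  and f'_cohomologous: "\<lbrakk>u \<in> Arr U; Dom U u = V; Cod U u = X; P \<in> Objs X; Q \<in> Objs X;
      a \<in> Hom_set X P Q\<rbrakk>
    \<Longrightarrow> f' ((V, [u]), [P, Q], [a])
      = f ((V, [u]), [P, Q], [a]) \<oplus>\<^bsub>Hom V (Robj A u P) (Robj A u Q)\<^esub> restriction_coboundary g t u P Q a"
  and c'_cohomologous: "\<lbrakk>u \<in> Arr U; v \<in> Arr U; Cod U v = Dom U u; Dom U v = W; P \<in> Objs (Cod U u)\<rbrakk>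
    \<Longrightarrow> c' ((W, [v, u]), [P], [])
      = c ((W, [v, u]), [P], []) \<oplus>\<^bsub>Hom W (Robj A v (Robj A u P)) (Robj A (Cmp U u v) P)\<^esub> twist_coboundary g t u v P"
begin

lemmas m'_eq = m'_cohomologous[unfolded multiplication_coboundary_def]
lemmas f'_eq = f'_cohomologous[unfolded restriction_coboundary_def Let_def]
lemmas c'_eq = c'_cohomologous[unfolded twist_coboundary_def Let_def]

lemmas calculation_closed = closure_rules one_cochain_closed two_cochain_closed
lemmas calculation_distrib = Hom_distrib Rmor_distrib Rmor_functor one_cochain_distrib two_cochain_distrib Hom_assoc

text \<open>The four lemmas of this context contain the identity \<open>d d = 0\<close> on \<open>1\<close>-cochains: the terms with \<open>g\<close> and \<open>t\<close> cancel
  in each defect. For the naturality defect this uses naturality of the twists, for the coherence defect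
  in addition their coherence.\<close>

lemma associativity_defect_invariant:
  assumes [simp]: "X \<in> Obj U" "P0 \<in> Objs X" "P1 \<in> Objs X" "P2 \<in> Objs X" "P3 \<in> Objs X"
    "a1 \<in> Hom_set X P2 P3" "a2 \<in> Hom_set X P1 P2" "a3 \<in> Hom_set X P0 P1"
  shows "associativity_defect m' X P0 P1 P2 P3 a1 a2 a3 = associativity_defect m X P0 P1 P2 P3 a1 a2 a3"
  unfolding associativity_defect_def
  apply (simp add: m'_eq calculation_closed calculation_distrib)
  by (rule Hom_eqI, (rule combination_intros | rule combination_atom, simp add: calculation_closed; fail)+,
      (simp add: calculation_closed algebra_simps)+)

lemma functoriality_defect_invariant:
  assumes [simp]: "u \<in> Arr U" "Dom U u = V" "Cod U u = X" "P0 \<in> Objs X" "P1 \<in> Objs X" "P2 \<in> Objs X"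
    "a1 \<in> Hom_set X P1 P2" "a2 \<in> Hom_set X P0 P1"
  shows "functoriality_defect m' f' u P0 P1 P2 a1 a2 = functoriality_defect m f u P0 P1 P2 a1 a2"
proof -
  have [simp]: "V \<in> Obj U" "X \<in> Obj U" using Dom_closed[of u] Cod_closed[of u] by simp_all
  show ?thesis
  unfolding functoriality_defect_def Let_def
  apply (simp add: m'_eq f'_eq calculation_closed calculation_distrib)
  by (rule Hom_eqI, (rule combination_intros | rule combination_atom, simp add: calculation_closed; fail)+,
      (simp add: calculation_closed algebra_simps)+)
qed

lemma naturality_defect_invariant:
  assumes [simp]: "u \<in> Arr U" "v \<in> Arr U" "Dom U u = V" "Cod U u = X" "Cod U v = V" "Dom U v = W" "P \<in> Objs X" "Q \<in> Objs X"
    "a \<in> Hom_set X P Q"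
  shows "naturality_defect m' f' c' u v P Q a = naturality_defect m f c u v P Q a"
proof -
  have [simp]: "W \<in> Obj U" "V \<in> Obj U" "X \<in> Obj U" using Dom_closed[of u] Dom_closed[of v] Cod_closed[of u] by simp_all
  show ?thesis
  unfolding naturality_defect_def Let_def
  apply (simp add: m'_eq f'_eq c'_eq calculation_closed calculation_distrib Tw_natural_square)
  by (rule Hom_eqI, (rule combination_intros | rule combination_atom, simp add: calculation_closed; fail)+,
      (simp add: calculation_closed algebra_simps)+)
qed

lemma coherence_defect_invariant:
  assumes [simp]: "u \<in> Arr U" "v \<in> Arr U" "w \<in> Arr U" "Dom U u = V" "Cod U u = X" "Dom U v = W" "Cod U v = V" "Dom U w = T" "Cod U w = W"
   "P \<in> Objs X"
  shows "coherence_defect m' f' c' u v w P = coherence_defect m f c u v w P"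
proof -
  have [simp]: "W \<in> Obj U" "V \<in> Obj U" "X \<in> Obj U" "T \<in> Obj U" using Dom_closed[of u] Dom_closed[of v] Dom_closed[of w] Cod_closed[of u] by simp_all
  note [simp] = triple_composite[of u v w T P, simplified]
  show ?thesis
  unfolding coherence_defect_def Let_def
  apply (simp add: m'_eq f'_eq c'_eq calculation_closed calculation_distrib Tw_natural_square Tw_coherence_square)
  by (rule Hom_eqI, (rule combination_intros | rule combination_atom, simp add: calculation_closed; fail)+,
      (simp add: calculation_closed algebra_simps)+)
qed

end

section \<open>The differential in degrees one and two\<close>

lemma path_choices_low: "path_choices (Suc 0) = {[1]}" "path_choices 2 = {[1, 1], [2, 1]}"
proof -
  have "{1..Suc 0} = {1}" by auto
  then show *: "path_choices (Suc 0) = {[1]}" by simp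
  have "{1..Suc (Suc 0)} = {1, 2}" by auto
  then show "path_choices 2 = {[1, 1], [2, 1]}"
    using * unfolding numeral_2_eq_2 path_choices.simps(2)[of "Suc 0"] by auto
qed

lemma strict_mono_on_permutation_id:
  fixes \<beta> :: "nat \<Rightarrow> nat"
  assumes "\<beta> permutes {1..l}" "strict_mono_on {1..l} \<beta>"
  shows "\<beta> = id"
proof -
  have ge: "k \<le> \<beta> k" if "k \<in> {1..l}" for k
    using that
  proof (induction k)
    case (Suc k)
    show ?case
    proof (cases "k = 0")
      case True
      then show ?thesis using permutes_in_image[OF assms(1), of 1] Suc by auto
    next
      case False
      then have "k \<le> \<beta> k" "\<beta> k < \<beta> (Suc k)"
        using Suc assms(2) by (auto simp: strict_mono_on_def)
      then show ?thesis by simp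
    qed
  qed simp
  then have "\<And>k. k \<in> {1..l} \<Longrightarrow> k \<le> \<beta> k" by blast
  then have "\<beta> k = k" for k
    using assms(1) permutes_natset_ge[of \<beta> "{1..l}"] by (metis id_apply)
  then show ?thesis by auto
qed

lemma shuffles_perm_0: "shuffles_perm 0 l = {id}"
proof -
  have "shuffles_perm 0 l = {\<beta>. \<beta> permutes {1..l} \<and> strict_mono_on {1..l} \<beta>}"
    by (simp add: shuffles_perm_def strict_mono_on_def)
  also have "\<dots> = {id}"
    using strict_mono_on_permutation_id[of _ l] permutes_id[of "{1..l}"] by (fastforce simp: strict_mono_on_def)
  finally show ?thesis .
qed

lemma shuffles_perm_1_1: "shuffles_perm (Suc 0) (Suc 0) = {id, transpose (Suc 0) 2}"
proof -
  have "{1..2} = {1, 2::nat}" by auto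
  then have "{\<beta>. \<beta> permutes {1..2::nat}} = {id, transpose 1 2}"
    by (auto simp: permutes_doubleton_iff)
  then show ?thesis by (auto simp: shuffles_perm_def strict_mono_on_def numeral_2_eq_2)
qed

lemma id_neq_transpose: "id \<noteq> transpose (Suc 0) 2"
  by (metis One_nat_def id_apply n_not_Suc_n numeral_2_eq_2 transpose_apply_first)

text \<open>The rows with one morphism \<open>a\<close> are the two ways around the naturality square of the transformation \<open>r\<close>
  at \<open>a\<close>.\<close>

lemma shuffle_simplex_low:
  "shuffle_simplex [T0, T1] [r] [P] [] id = ([fst T0 P, fst T1 P], [r P])"
  "shuffle_simplex [T0, T1, T2] [r1, r2] [P] [] id = ([fst T0 P, fst T1 P, fst T2 P], [r1 P, r2 P])"
  "shuffle_simplex [T0, T1] [r] [P, Q] [a] id = ([fst T0 P, fst T1 P, fst T1 Q], [snd T1 P Q a, r P])"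
  "shuffle_simplex [T0, T1] [r] [P, Q] [a] (transpose (Suc 0) 2) = ([fst T0 P, fst T0 Q, fst T1 Q], [r Q, snd T0 P Q a])"
proof -
  have filter: "{k \<in> insert a B. Q k} = (if Q a then insert a {k \<in> B. Q k} else {k \<in> B. Q k})" "{k \<in> {}. Q k} = {}"
    for a :: nat and B Q by auto
  have intervals: "{Suc 0..0} = {}" "{Suc 0..Suc (Suc 0)} = {Suc 0, Suc (Suc 0)}"
    "card {Suc 0, Suc (Suc 0)} = Suc (Suc 0)" by auto
  have upt: "[0..<Suc (Suc 0)] = [0, 1]" "[0..<Suc (Suc (Suc 0))] = [0, 1, 2]" "[1..<Suc (Suc 0)] = [1]" "[1..<Suc (Suc (Suc 0))] = [1, 2]"
    by (simp_all add: numeral_2_eq_2)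
  have inv: "inv_into UNIV (transpose a b) = transpose a b" for a b :: nat by simp
  note simps = shuffle_simplex_def shuffle_object_def shuffle_arrow_def Let_def filter intervals numeral_2_eq_2 upt
  show "shuffle_simplex [T0, T1] [r] [P] [] id = ([fst T0 P, fst T1 P], [r P])"
    by (simp add: simps del: insert_iff singleton_iff atLeastAtMost_iff)
  show "shuffle_simplex [T0, T1, T2] [r1, r2] [P] [] id = ([fst T0 P, fst T1 P, fst T2 P], [r1 P, r2 P])"
    by (simp add: simps del: insert_iff singleton_iff atLeastAtMost_iff)
  show "shuffle_simplex [T0, T1] [r] [P, Q] [a] id = ([fst T0 P, fst T1 P, fst T1 Q], [snd T1 P Q a, r P])"
    by (simp add: simps del: insert_iff singleton_iff atLeastAtMost_iff)
  show "shuffle_simplex [T0, T1] [r] [P, Q] [a] (transpose (Suc 0) 2) = ([fst T0 P, fst T0 Q, fst T1 Q], [r Q, snd T0 P Q a])"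
    by (simp add: simps inv transpose_def del: insert_iff singleton_iff atLeastAtMost_iff)
qed

context abelian_group
begin

lemma integer_sign:
  "x \<in> carrier G \<Longrightarrow> [(1::int)] \<cdot> x = x"
  "x \<in> carrier G \<Longrightarrow> [(-1::int)] \<cdot> x = \<ominus> x"
  by (auto simp: add.int_pow_1 add.int_pow_neg)

lemma finsum_low:
  "finsum G h {} = \<zero>"
  "h i \<in> carrier G \<Longrightarrow> finsum G h {i} = h i"
  "\<lbrakk>i \<noteq> j; h i \<in> carrier G; h j \<in> carrier G\<rbrakk> \<Longrightarrow> finsum G h {i, j} = h i \<oplus> h j"
  "\<lbrakk>i \<noteq> j; i \<noteq> k; j \<noteq> k; h i \<in> carrier G; h j \<in> carrier G; h k \<in> carrier G\<rbrakk>
    \<Longrightarrow> finsum G h {i, j, k} = h i \<oplus> (h j \<oplus> h k)"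
  by (auto simp: Pi_iff)

end

lemma Times_low: "{a} \<times> {b} = {(a, b)}" "{a} \<times> {b, c} = {(a, b), (a, c)}" "{a, b} \<times> {c} = {(a, c), (b, c)}"
  by auto

lemma atMost_low: "{..0} = {0::nat}" "{..Suc 0} = {0, 1}" "{..2} = {0, 1, 2::nat}"
  by auto

context prestack_on_category
begin

lemmas Hom_finsum = abelian_group.finsum_low[OF Hom_abelian_group]
lemmas Hom_integer_sign = abelian_group.integer_sign[OF Hom_abelian_group]

lemma upt_low: "[Suc 0..<Suc (Suc 0)] = [1]" "[Suc 0..<2] = [1]" "[Suc 0..<3] = [1, 2]"
  by (simp_all add: upt_rec_numeral numeral_2_eq_2 numeral_3_eq_3)

lemma composite_single: "\<lbrakk>u \<in> Arr U; Cod U u = X\<rbrakk> \<Longrightarrow> Cmp U (Ident U X) u = u"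
  using Cmp_Ident_left by blast

lemmas index_simps = index_0 index_1 index_2 index_3 index_2[unfolded numeral_2_eq_2] index_3[unfolded numeral_3_eq_3]
  last_vertex_def total_arrow_def left_part_def right_part_def vertex_def face_def c_mor_def eps_mor_def

lemmas eval_simps = gs_differential_def d_component_def d_hoch_def d_simp_def d_higher_def Let_def index_simps
  atLeastAtMost_numerals atMost_low Times_low upt_low id_neq_transpose
  value_module_simps Hom_finsum Hom_integer_sign restriction_Ident composite_single Cmp_assoc Hom_Id
  path_choices_low shuffles_perm_0 shuffles_perm_1_1 path_sign_def shuffle_simplex_low sign_swap_id

end

context two_cochain
begin

lemmas two_cochain_rules = closure_rules two_cochain_closed

context
  fixes \<phi> :: "nat \<Rightarrow> ('o, 'u, 'a, 'm) cochain"
  assumes \<phi> [simp]: "\<phi> 0 = m" "\<phi> (Suc 0) = f" "\<phi> 2 = c"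
begin

lemma differential_0_3:
  assumes [simp]: "X \<in> Obj U" "P0 \<in> Objs X" "P1 \<in> Objs X" "P2 \<in> Objs X" "P3 \<in> Objs X"
    "a1 \<in> Hom_set X P2 P3" "a2 \<in> Hom_set X P1 P2" "a3 \<in> Hom_set X P0 P1"
  shows "gs_differential U A 2 \<phi> 0 ((X, []), [P0, P1, P2, P3], [a1, a2, a3]) = associativity_defect m X P0 P1 P2 P3 a1 a2 a3"
  apply (simp add: eval_simps two_cochain_rules associativity_defect_def)
  by (rule Hom_eqI, (rule combination_intros | rule combination_atom, simp add: two_cochain_rules; fail)+,
      (simp add: two_cochain_rules algebra_simps)+)

lemma differential_1_2:
  assumes [simp]: "u \<in> Arr U" "Dom U u = V" "Cod U u = X" "P0 \<in> Objs X" "P1 \<in> Objs X" "P2 \<in> Objs X"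
    "a1 \<in> Hom_set X P1 P2" "a2 \<in> Hom_set X P0 P1"
  shows "gs_differential U A 2 \<phi> 1 ((V, [u]), [P0, P1, P2], [a1, a2]) = functoriality_defect m f u P0 P1 P2 a1 a2"
proof -
  have [simp]: "V \<in> Obj U" "X \<in> Obj U" using Dom_closed[of u] Cod_closed[of u] by simp_all
  show ?thesis
  apply (simp add: eval_simps two_cochain_rules functoriality_defect_def)
  by (rule Hom_eqI, (rule combination_intros | rule combination_atom, simp add: two_cochain_rules; fail)+,
      (simp add: two_cochain_rules algebra_simps)+)
qed

text \<open>The terms with \<open>m\<close> come from \<open>d\<^sub>2\<close>. The only path of \<open>(v, u)\<close> is its twist, with sign \<open>-1\<close>, and \<open>(-1)\<^sup>t = -1\<close> for
  \<open>t = 1\<close>. Hence the identity shuffle contributes \<open>m((u v)\<^sup>* a, c)\<close> and the transposition \<open>- m(c, v\<^sup>* u\<^sup>* a)\<close>.\<close>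

lemma differential_2_1:
  assumes [simp]: "u \<in> Arr U" "v \<in> Arr U" "Dom U u = V" "Cod U u = X" "Cod U v = V" "Dom U v = W" "P \<in> Objs X" "Q \<in> Objs X"
    "a \<in> Hom_set X P Q"
  shows "gs_differential U A 2 \<phi> 2 ((W, [v, u]), [P, Q], [a]) = naturality_defect m f c u v P Q a"
proof -
  have [simp]: "W \<in> Obj U" "V \<in> Obj U" "X \<in> Obj U" using Dom_closed[of u] Dom_closed[of v] Cod_closed[of u] by simp_all
  show ?thesis
  apply (simp add: eval_simps two_cochain_rules naturality_defect_def)
  by (rule Hom_eqI, (rule combination_intros | rule combination_atom, simp add: two_cochain_rules; fail)+,
      (simp add: two_cochain_rules algebra_simps)+)
qed

text \<open>The two paths of \<open>(w, v, u)\<close> compose the twists in the two ways compared by the coherence axiom. Their signs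
  are \<open>1\<close> and \<open>-1\<close>, and each contributes one of the terms with \<open>m\<close>.\<close>

lemma differential_3_0:
  assumes [simp]: "u \<in> Arr U" "v \<in> Arr U" "w \<in> Arr U" "Dom U u = V" "Cod U u = X" "Dom U v = W" "Cod U v = V" "Dom U w = T" "Cod U w = W"
   "P \<in> Objs X"
  shows "gs_differential U A 2 \<phi> 3 ((T, [w, v, u]), [P], []) = coherence_defect m f c u v w P"
proof -
  have [simp]: "W \<in> Obj U" "V \<in> Obj U" "X \<in> Obj U" "T \<in> Obj U" using Dom_closed[of u] Dom_closed[of v] Dom_closed[of w] Cod_closed[of u] by simp_all
  note [simp] = triple_composite[of u v w T P, simplified]
  show ?thesis
  apply (simp add: eval_simps two_cochain_rules coherence_defect_def)
  by (rule Hom_eqI, (rule combination_intros | rule combination_atom, simp add: two_cochain_rules; fail)+,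
      (simp add: two_cochain_rules algebra_simps)+)
qed

end

end

context one_cochain
begin

lemmas one_cochain_rules = closure_rules one_cochain_closed

context
  fixes \<psi> :: "nat \<Rightarrow> ('o, 'u, 'a, 'm) cochain"
  assumes \<psi> [simp]: "\<psi> 0 = g" "\<psi> (Suc 0) = t"
begin

lemma differential_0_2:
  assumes [simp]: "X \<in> Obj U" "P \<in> Objs X" "Q \<in> Objs X" "R \<in> Objs X"
    "b \<in> Hom_set X Q R" "a \<in> Hom_set X P Q"
  shows "gs_differential U A (Suc 0) \<psi> 0 ((X, []), [P, Q, R], [b, a]) = multiplication_coboundary g X P Q R b a"
  apply (simp add: eval_simps one_cochain_rules multiplication_coboundary_def)
  by (rule Hom_eqI, (rule combination_intros | rule combination_atom, simp add: one_cochain_rules; fail)+,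
      (simp add: one_cochain_rules algebra_simps)+)

lemma differential_1_1:
  assumes [simp]: "u \<in> Arr U" "Dom U u = V" "Cod U u = X" "P \<in> Objs X" "Q \<in> Objs X" "a \<in> Hom_set X P Q"
  shows "gs_differential U A (Suc 0) \<psi> 1 ((V, [u]), [P, Q], [a]) = restriction_coboundary g t u P Q a"
proof -
  have [simp]: "V \<in> Obj U" "X \<in> Obj U" using Dom_closed[of u] Cod_closed[of u] by simp_all
  show ?thesis
  apply (simp add: eval_simps one_cochain_rules restriction_coboundary_def)
  by (rule Hom_eqI, (rule combination_intros | rule combination_atom, simp add: one_cochain_rules; fail)+,
      (simp add: one_cochain_rules algebra_simps)+)
qed

lemma differential_2_0:
  assumes [simp]: "u \<in> Arr U" "v \<in> Arr U" "Dom U u = V" "Cod U u = X" "Cod U v = V" "Dom U v = W" "P \<in> Objs X"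
  shows "gs_differential U A (Suc 0) \<psi> 2 ((W, [v, u]), [P], []) = twist_coboundary g t u v P"
proof -
  have [simp]: "W \<in> Obj U" "V \<in> Obj U" "X \<in> Obj U" using Dom_closed[of u] Dom_closed[of v] Cod_closed[of u] by simp_all
  show ?thesis
  apply (simp add: eval_simps one_cochain_rules twist_coboundary_def)
  by (rule Hom_eqI, (rule combination_intros | rule combination_atom, simp add: one_cochain_rules; fail)+,
      (simp add: one_cochain_rules algebra_simps)+)
qed

end

end

section \<open>The group of cochains\<close>

lemma value_module_arrows: "value_module U A (\<sigma>, Ps, as) = value_module U A (\<sigma>, Ps, as')"
  by (simp add: value_module_def)

context prestack_on_category
begin

lemma index_source_module:
  assumes "(\<sigma>, Ps, as) \<in> cochain_index U A p q" "i \<in> {1..q}"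
  shows "module K (Hom (last_vertex U \<sigma>) (Ps ! (q - i)) (Ps ! (q - i + 1)))"
proof -
  have "last_vertex U \<sigma> \<in> Obj U" "cat_simplex (Fib A (last_vertex U \<sigma>)) q Ps as"
    using assms composable_end by (auto simp: cochain_index_def nerve_def last_vertex_def)
  then show ?thesis using assms(2) by (auto simp: cat_simplex_def subset_iff intro!: Hom_module)
qed

lemma index_update:
  assumes "(\<sigma>, Ps, as) \<in> cochain_index U A p q" "i \<in> {1..q}"
    and "b \<in> carrier (Hom (last_vertex U \<sigma>) (Ps ! (q - i)) (Ps ! (q - i + 1)))"
  shows "(\<sigma>, Ps, as[i - 1 := b]) \<in> cochain_index U A p q"
proof -
  have "length as = q" using assms by (auto simp: cochain_index_def cat_simplex_def)
  then have "as[i - 1 := b] ! (k - 1) = (if k = i then b else as ! (k - 1))" if "k \<in> {1..q}" for k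
    using assms that by (auto simp: nth_list_update)
  then show ?thesis using assms by (auto simp: cochain_index_def cat_simplex_def)
qed

lemma cochainI:
  assumes ext: "\<phi> \<in> extensional (cochain_index U A p q)"
    and closed: "\<And>x. x \<in> cochain_index U A p q \<Longrightarrow> \<phi> x \<in> carrier (value_module U A x)"
    and linear: "\<And>\<sigma> Ps as i. \<lbrakk>(\<sigma>, Ps, as) \<in> cochain_index U A p q; i \<in> {1..q}\<rbrakk> \<Longrightarrow>
      linear_map K (Hom (last_vertex U \<sigma>) (Ps ! (q - i)) (Ps ! (q - i + 1)))
            (value_module U A (\<sigma>, Ps, as)) (\<lambda>b. \<phi> (\<sigma>, Ps, as[i - 1 := b]))"
  shows "\<phi> \<in> cochains K U A p q"
  unfolding cochains_def using ext closed linear by (auto simp: PiE_iff)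

text \<open>The values of a cochain on arguments that differ only in their morphisms lie in the same module, so
  linearity can be checked before restricting to the index set.\<close>

lemma pointwise_cochain:
  assumes closed: "\<And>x. x \<in> cochain_index U A p q \<Longrightarrow> F x \<in> carrier (value_module U A x)"
    and linear: "\<And>\<sigma> Ps as i. \<lbrakk>(\<sigma>, Ps, as) \<in> cochain_index U A p q; i \<in> {1..q}\<rbrakk> \<Longrightarrow>
      linear_map K (Mor (Fib A (last_vertex U \<sigma>)) (Ps ! (q - i)) (Ps ! (q - i + 1)))
            (value_module U A (\<sigma>, Ps, as)) (\<lambda>b. F (\<sigma>, Ps, as[i - 1 := b]))"
  shows "(\<lambda>x\<in>cochain_index U A p q. F x) \<in> cochains K U A p q"
proof (rule cochainI)
  fix \<sigma> Ps as i assume x: "(\<sigma>, Ps, as) \<in> cochain_index U A p q" "i \<in> {1..q}"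
  show "linear_map K (Mor (Fib A (last_vertex U \<sigma>)) (Ps ! (q - i)) (Ps ! (q - i + 1))) (value_module U A (\<sigma>, Ps, as))
      (\<lambda>b. (\<lambda>x\<in>cochain_index U A p q. F x) (\<sigma>, Ps, as[i - 1 := b]))"
    using index_update[OF x] by (intro linear_map_cong[OF linear[OF x]]) (auto simp: index_source_module[OF x] simp del: One_nat_def)
qed (use closed in auto)

lemma cochain_add:
  assumes "\<phi> \<in> cochains K U A p q" "\<psi> \<in> cochains K U A p q"
  shows "(\<lambda>x\<in>cochain_index U A p q. \<phi> x \<oplus>\<^bsub>value_module U A x\<^esub> \<psi> x) \<in> cochains K U A p q"
proof (rule pointwise_cochain, goal_cases)
  case (1 x)
  interpret module K "value_module U A x" using value_module_module[OF 1] .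
  show ?case using cochain_closed[OF assms(1) 1] cochain_closed[OF assms(2) 1] by simp
next
  case (2 \<sigma> Ps as i)
  show ?case unfolding value_module_arrows[of U A \<sigma> Ps "as[i - 1 := _]" as]
    by (intro linear_map_plus cochain_linear[OF assms(1) 2] cochain_linear[OF assms(2) 2] value_module_module[OF 2(1)])
qed

lemma cochain_uminus:
  assumes "\<phi> \<in> cochains K U A p q"
  shows "(\<lambda>x\<in>cochain_index U A p q. \<ominus>\<^bsub>value_module U A x\<^esub> \<phi> x) \<in> cochains K U A p q"
proof (rule pointwise_cochain, goal_cases)
  case (1 x)
  interpret module K "value_module U A x" using value_module_module[OF 1] .
  show ?case using cochain_closed[OF assms 1] by simp
next
  case (2 \<sigma> Ps as i)
  show ?case unfolding value_module_arrows[of U A \<sigma> Ps "as[i - 1 := _]" as]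
    by (intro linear_map_neg cochain_linear[OF assms 2] value_module_module[OF 2(1)])
qed

lemma cochain_zero: "(\<lambda>x\<in>cochain_index U A p q. \<zero>\<^bsub>value_module U A x\<^esub>) \<in> cochains K U A p q"
proof (rule pointwise_cochain, goal_cases)
  case (1 x)
  interpret module K "value_module U A x" using value_module_module[OF 1] .
  show ?case by simp
next
  case (2 \<sigma> Ps as i)
  show ?case unfolding value_module_arrows[of U A \<sigma> Ps "as[i - 1 := _]" as]
    by (intro linear_map_zero_map value_module_module[OF 2(1)])
qed

lemma cochain_extensional: "\<phi> \<in> cochains K U A p q \<Longrightarrow> \<phi> \<in> extensional (cochain_index U A p q)"
  by (simp add: cochains_def PiE_def)

lemma gs_group_carrier: "carrier (gs_group K U A n) = (\<Pi>\<^sub>E p\<in>{..n}. cochains K U A p (n - p))"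
  by (simp add: gs_group_def)

lemma gs_group_component: "\<lbrakk>\<phi> \<in> carrier (gs_group K U A n); p \<le> n\<rbrakk> \<Longrightarrow> \<phi> p \<in> cochains K U A p (n - p)"
  by (auto simp: gs_group_carrier PiE_iff)

lemma gs_group_mult:
  "\<lbrakk>p \<le> n; x \<in> cochain_index U A p (n - p)\<rbrakk>
    \<Longrightarrow> (\<phi> \<otimes>\<^bsub>gs_group K U A n\<^esub> \<psi>) p x = \<phi> p x \<oplus>\<^bsub>value_module U A x\<^esub> \<psi> p x"
  by (simp add: gs_group_def)

lemma gs_group_one:
  "\<lbrakk>p \<le> n; x \<in> cochain_index U A p (n - p)\<rbrakk> \<Longrightarrow> \<one>\<^bsub>gs_group K U A n\<^esub> p x = \<zero>\<^bsub>value_module U A x\<^esub>"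
  by (simp add: gs_group_def)

lemma gs_group_eqI:
  assumes \<phi>: "\<phi> \<in> (\<Pi>\<^sub>E p\<in>{..n}. extensional (cochain_index U A p (n - p)))"
    and \<psi>: "\<psi> \<in> (\<Pi>\<^sub>E p\<in>{..n}. extensional (cochain_index U A p (n - p)))"
    and eq: "\<And>p x. \<lbrakk>p \<le> n; x \<in> cochain_index U A p (n - p)\<rbrakk> \<Longrightarrow> \<phi> p x = \<psi> p x"
  shows "\<phi> = \<psi>"
proof
  fix p show "\<phi> p = \<psi> p"
  proof (cases "p \<le> n")
    case True
    then have "\<phi> p \<in> extensional (cochain_index U A p (n - p))" "\<psi> p \<in> extensional (cochain_index U A p (n - p))"
      using \<phi> \<psi> by (auto simp: PiE_iff)
    then show ?thesis using eq[OF True] by (rule extensionalityI)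
  next
    case False then show ?thesis using \<phi> \<psi> by (auto simp: PiE_iff extensional_def)
  qed
qed

lemma gs_group_extensional:
  "\<phi> \<in> carrier (gs_group K U A n) \<Longrightarrow> \<phi> \<in> (\<Pi>\<^sub>E p\<in>{..n}. extensional (cochain_index U A p (n - p)))"
  "\<phi> \<otimes>\<^bsub>gs_group K U A n\<^esub> \<psi> \<in> (\<Pi>\<^sub>E p\<in>{..n}. extensional (cochain_index U A p (n - p)))"
  "\<one>\<^bsub>gs_group K U A n\<^esub> \<in> (\<Pi>\<^sub>E p\<in>{..n}. extensional (cochain_index U A p (n - p)))"
  using cochain_extensional by (auto simp: gs_group_def intro!: PiE_I dest: PiE_mem)

lemma gs_group_mult_closed:
  "\<lbrakk>\<phi> \<in> carrier (gs_group K U A n); \<psi> \<in> carrier (gs_group K U A n)\<rbrakk>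
    \<Longrightarrow> \<phi> \<otimes>\<^bsub>gs_group K U A n\<^esub> \<psi> \<in> carrier (gs_group K U A n)"
  using cochain_add by (fastforce simp: gs_group_def PiE_iff)

lemma gs_group_comm_group: "comm_group (gs_group K U A n)"
proof (rule comm_groupI)
  let ?G = "gs_group K U A n"
  note ext = gs_group_extensional
  have val: "\<And>\<phi> p x. \<lbrakk>\<phi> \<in> carrier ?G; p \<le> n; x \<in> cochain_index U A p (n - p)\<rbrakk> \<Longrightarrow> \<phi> p x \<in> carrier (value_module U A x)"
    using gs_group_component cochain_closed by blast
  have ag: "abelian_group (value_module U A x)" if "x \<in> cochain_index U A p (n - p)" for x p
    using value_module_module[OF that] by (rule module.axioms)
  show one: "\<one>\<^bsub>?G\<^esub> \<in> carrier ?G" using cochain_zero by (auto simp: gs_group_def)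
  show closed: "\<phi> \<otimes>\<^bsub>?G\<^esub> \<psi> \<in> carrier ?G" if "\<phi> \<in> carrier ?G" "\<psi> \<in> carrier ?G" for \<phi> \<psi>
    using gs_group_mult_closed that .
  show "\<phi> \<otimes>\<^bsub>?G\<^esub> \<psi> \<otimes>\<^bsub>?G\<^esub> \<chi> = \<phi> \<otimes>\<^bsub>?G\<^esub> (\<psi> \<otimes>\<^bsub>?G\<^esub> \<chi>)"
    if "\<phi> \<in> carrier ?G" "\<psi> \<in> carrier ?G" "\<chi> \<in> carrier ?G" for \<phi> \<psi> \<chi>
  proof (rule gs_group_eqI[OF ext(2) ext(2)])
    fix p x assume x: "p \<le> n" "x \<in> cochain_index U A p (n - p)"
    interpret abelian_group "value_module U A x" using ag[OF x(2)] .
    show "(\<phi> \<otimes>\<^bsub>?G\<^esub> \<psi> \<otimes>\<^bsub>?G\<^esub> \<chi>) p x = (\<phi> \<otimes>\<^bsub>?G\<^esub> (\<psi> \<otimes>\<^bsub>?G\<^esub> \<chi>)) p x"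
      using val[OF that(1) x] val[OF that(2) x] val[OF that(3) x] by (simp add: gs_group_mult x a_assoc)
  qed
  show "\<phi> \<otimes>\<^bsub>?G\<^esub> \<psi> = \<psi> \<otimes>\<^bsub>?G\<^esub> \<phi>" if "\<phi> \<in> carrier ?G" "\<psi> \<in> carrier ?G" for \<phi> \<psi>
  proof (rule gs_group_eqI[OF ext(2) ext(2)])
    fix p x assume x: "p \<le> n" "x \<in> cochain_index U A p (n - p)"
    interpret abelian_group "value_module U A x" using ag[OF x(2)] .
    show "(\<phi> \<otimes>\<^bsub>?G\<^esub> \<psi>) p x = (\<psi> \<otimes>\<^bsub>?G\<^esub> \<phi>) p x"
      using val[OF that(1) x] val[OF that(2) x] by (simp add: gs_group_mult x a_comm)
  qed
  show "\<one>\<^bsub>?G\<^esub> \<otimes>\<^bsub>?G\<^esub> \<phi> = \<phi>" if "\<phi> \<in> carrier ?G" for \<phi>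
  proof (rule gs_group_eqI[OF ext(2) ext(1)[OF that]])
    fix p x assume x: "p \<le> n" "x \<in> cochain_index U A p (n - p)"
    interpret abelian_group "value_module U A x" using ag[OF x(2)] .
    show "(\<one>\<^bsub>?G\<^esub> \<otimes>\<^bsub>?G\<^esub> \<phi>) p x = \<phi> p x"
      using val[OF that(1) x] by (simp add: gs_group_mult gs_group_one x)
  qed
  show "\<exists>\<psi>\<in>carrier ?G. \<psi> \<otimes>\<^bsub>?G\<^esub> \<phi> = \<one>\<^bsub>?G\<^esub>" if "\<phi> \<in> carrier ?G" for \<phi>
  proof
    let ?\<psi> = "\<lambda>p\<in>{..n}. \<lambda>x\<in>cochain_index U A p (n - p). \<ominus>\<^bsub>value_module U A x\<^esub> \<phi> p x"
    show "?\<psi> \<in> carrier ?G" using cochain_uminus gs_group_component[OF that] by (auto simp: gs_group_def)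
    show "?\<psi> \<otimes>\<^bsub>?G\<^esub> \<phi> = \<one>\<^bsub>?G\<^esub>"
    proof (rule gs_group_eqI[OF ext(2) ext(3)])
      fix p x assume x: "p \<le> n" "x \<in> cochain_index U A p (n - p)"
      interpret abelian_group "value_module U A x" using ag[OF x(2)] .
      show "(?\<psi> \<otimes>\<^bsub>?G\<^esub> \<phi>) p x = \<one>\<^bsub>?G\<^esub> p x"
        using val[OF that(1) x] x by (simp add: gs_group_mult gs_group_one l_neg)
    qed
  qed
qed

section \<open>Coboundaries and cohomology classes\<close>

lemma index_0_cases:
  assumes "x \<in> cochain_index U A p 0"
  obtains X us P where "x = ((X, us), [P], [])" "((X, us), [P], []) \<in> cochain_index U A p 0"
proof -
  obtain \<sigma> Ps as where x: "x = (\<sigma>, Ps, as)" by (metis prod.exhaust)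
  then have "length Ps = Suc 0" "as = []"
    using assms by (auto simp: cochain_index_def cat_simplex_def)
  then obtain P where "Ps = [P]" "as = []"
    by (auto simp: length_Suc_conv)
  then show thesis using that assms x by (metis prod.exhaust)
qed

lemma index_1_cases:
  assumes "x \<in> cochain_index U A p (Suc 0)"
  obtains X us P Q a where "x = ((X, us), [P, Q], [a])" "((X, us), [P, Q], [a]) \<in> cochain_index U A p (Suc 0)"
proof -
  obtain \<sigma> Ps as where x: "x = (\<sigma>, Ps, as)" by (metis prod.exhaust)
  then have "length Ps = Suc (Suc 0)" "length as = Suc 0"
    using assms by (auto simp: cochain_index_def cat_simplex_def)
  then obtain P Q a where "Ps = [P, Q]" "as = [a]"
    by (auto simp: length_Suc_conv)
  then show thesis using that assms x by (metis prod.exhaust)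
qed

lemma index_2_cases:
  assumes "x \<in> cochain_index U A p 2"
  obtains X us P Q R b a where "x = ((X, us), [P, Q, R], [b, a])" "((X, us), [P, Q, R], [b, a]) \<in> cochain_index U A p 2"
proof -
  obtain \<sigma> Ps as where x: "x = (\<sigma>, Ps, as)" by (metis prod.exhaust)
  then have "length Ps = Suc (Suc (Suc 0))" "length as = Suc (Suc 0)"
    using assms by (auto simp: cochain_index_def cat_simplex_def)
  then obtain P Q R b a where "Ps = [P, Q, R]" "as = [b, a]"
    by (auto simp: length_Suc_conv)
  then show thesis using that assms x by (metis prod.exhaust)
qed

lemma index_3_cases:
  assumes "x \<in> cochain_index U A p 3"
  obtains X us P Q R S h b a where "x = ((X, us), [P, Q, R, S], [h, b, a])" "((X, us), [P, Q, R, S], [h, b, a]) \<in> cochain_index U A p 3"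
proof -
  obtain \<sigma> Ps as where x: "x = (\<sigma>, Ps, as)" by (metis prod.exhaust)
  then have "length Ps = Suc (Suc (Suc (Suc 0)))" "length as = Suc (Suc (Suc 0))"
    using assms by (auto simp: cochain_index_def cat_simplex_def)
  then obtain P Q R S h b a where "Ps = [P, Q, R, S]" "as = [h, b, a]"
    by (auto simp: length_Suc_conv)
  then show thesis using that assms x by (metis prod.exhaust)
qed

lemma index_0_2_cases:
  assumes "x \<in> cochain_index U A 0 2"
  obtains X P Q R b a where "x = ((X, []), [P, Q, R], [b, a])" "X \<in> Obj U" "P \<in> Objs X" "Q \<in> Objs X"
    "R \<in> Objs X" "b \<in> Hom_set X Q R" "a \<in> Hom_set X P Q"
  using assms by (rule index_2_cases) (auto simp: index_2)

lemma index_0_1_cases: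
  assumes "x \<in> cochain_index U A 0 1"
  obtains X P Q a where "x = ((X, []), [P, Q], [a])" "X \<in> Obj U" "P \<in> Objs X" "Q \<in> Objs X" "a \<in> Hom_set X P Q"
  using assms unfolding One_nat_def by (rule index_1_cases) (auto simp: index_1)

lemma index_1_0_cases:
  assumes "x \<in> cochain_index U A 1 0"
  obtains u P where "x = ((Dom U u, [u]), [P], [])" "u \<in> Arr U" "P \<in> Objs (Cod U u)"
proof -
  obtain X us P where x: "x = ((X, us), [P], [])" "((X, us), [P], []) \<in> cochain_index U A (Suc 0) 0"
    using assms by (auto elim: index_0_cases)
  then show thesis using that by (auto simp: index_0 length_Suc_conv)
qed

lemma index_1_1_cases:
  assumes "x \<in> cochain_index U A 1 1"
  obtains u P Q a where "x = ((Dom U u, [u]), [P, Q], [a])" "u \<in> Arr U" "P \<in> Objs (Cod U u)" "Q \<in> Objs (Cod U u)"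
    "a \<in> Hom_set (Cod U u) P Q"
proof -
  obtain X us P Q a where x: "x = ((X, us), [P, Q], [a])" "((X, us), [P, Q], [a]) \<in> cochain_index U A 1 (Suc 0)"
    using assms by (auto elim: index_1_cases)
  then show thesis using that by (auto simp: index_1 length_Suc_conv)
qed

lemma index_2_0_cases:
  assumes "x \<in> cochain_index U A 2 0"
  obtains u v P where "x = ((Dom U v, [v, u]), [P], [])" "u \<in> Arr U" "v \<in> Arr U" "Cod U v = Dom U u" "P \<in> Objs (Cod U u)"
proof -
  obtain X us P where x: "x = ((X, us), [P], [])" "((X, us), [P], []) \<in> cochain_index U A (Suc (Suc 0)) 0"
    using assms by (auto elim: index_0_cases simp: numeral_2_eq_2)
  then show thesis using that by (auto simp: index_0 length_Suc_conv)
qed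

lemma multiplication_cochainI:
  assumes "\<phi> \<in> extensional (cochain_index U A 0 2)"
    and "\<And>X P Q R a. \<lbrakk>X \<in> Obj U; P \<in> Objs X; Q \<in> Objs X; R \<in> Objs X; a \<in> Hom_set X P Q\<rbrakk>
      \<Longrightarrow> linear_map K (Hom X Q R) (Hom X P R) (\<lambda>b. \<phi> ((X, []), [P, Q, R], [b, a]))"
    and "\<And>X P Q R b. \<lbrakk>X \<in> Obj U; P \<in> Objs X; Q \<in> Objs X; R \<in> Objs X; b \<in> Hom_set X Q R\<rbrakk>
      \<Longrightarrow> linear_map K (Hom X P Q) (Hom X P R) (\<lambda>a. \<phi> ((X, []), [P, Q, R], [b, a]))"
  shows "\<phi> \<in> cochains K U A 0 2"
proof (rule cochainI[OF assms(1)])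
  fix x assume "x \<in> cochain_index U A 0 2"
  then show "\<phi> x \<in> carrier (value_module U A x)"
    by (rule index_0_2_cases) (auto simp: value_module_simps intro: linear_map_closed[OF assms(2)])
next
  fix \<sigma> Ps as and i :: nat assume x: "(\<sigma>, Ps, as) \<in> cochain_index U A 0 2" and i: "i \<in> {1..2}"
  have "i = 1 \<or> i = 2" using i by auto
  then show "linear_map K (Hom (last_vertex U \<sigma>) (Ps ! (2 - i)) (Ps ! (2 - i + 1)))
            (value_module U A (\<sigma>, Ps, as)) (\<lambda>b. \<phi> (\<sigma>, Ps, as[i - 1 := b]))"
    using x by (elim index_0_2_cases disjE) (auto simp: value_module_simps last_vertex_def intro: assms(2,3))
qed

lemma restriction_cochainI:
  assumes "\<phi> \<in> extensional (cochain_index U A 1 1)"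
    and "\<And>u P Q. \<lbrakk>u \<in> Arr U; P \<in> Objs (Cod U u); Q \<in> Objs (Cod U u)\<rbrakk>
      \<Longrightarrow> linear_map K (Hom (Cod U u) P Q) (Hom (Dom U u) (Robj A u P) (Robj A u Q)) (\<lambda>a. \<phi> ((Dom U u, [u]), [P, Q], [a]))"
  shows "\<phi> \<in> cochains K U A 1 1"
proof (rule cochainI[OF assms(1)])
  fix x assume "x \<in> cochain_index U A 1 1"
  then show "\<phi> x \<in> carrier (value_module U A x)"
    by (rule index_1_1_cases) (auto simp: value_module_simps intro: linear_map_closed[OF assms(2)])
next
  fix \<sigma> Ps as and i :: nat assume x: "(\<sigma>, Ps, as) \<in> cochain_index U A 1 1" and i: "i \<in> {1..1}"
  have "i = 1" using i by auto
  then show "linear_map K (Hom (last_vertex U \<sigma>) (Ps ! (1 - i)) (Ps ! (1 - i + 1)))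
            (value_module U A (\<sigma>, Ps, as)) (\<lambda>b. \<phi> (\<sigma>, Ps, as[i - 1 := b]))"
    using x by (elim index_1_1_cases) (auto simp: value_module_simps last_vertex_def intro: assms(2))
qed

lemma functor_cochainI:
  assumes "\<phi> \<in> extensional (cochain_index U A 0 1)"
    and "\<And>X P Q. \<lbrakk>X \<in> Obj U; P \<in> Objs X; Q \<in> Objs X\<rbrakk>
      \<Longrightarrow> linear_map K (Hom X P Q) (Hom X P Q) (\<lambda>a. \<phi> ((X, []), [P, Q], [a]))"
  shows "\<phi> \<in> cochains K U A 0 1"
proof (rule cochainI[OF assms(1)])
  fix x assume "x \<in> cochain_index U A 0 1"
  then show "\<phi> x \<in> carrier (value_module U A x)"
    by (rule index_0_1_cases) (auto simp: value_module_simps intro: linear_map_closed[OF assms(2)])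
next
  fix \<sigma> Ps as and i :: nat assume x: "(\<sigma>, Ps, as) \<in> cochain_index U A 0 1" and i: "i \<in> {1..1}"
  have "i = 1" using i by auto
  then show "linear_map K (Hom (last_vertex U \<sigma>) (Ps ! (1 - i)) (Ps ! (1 - i + 1)))
            (value_module U A (\<sigma>, Ps, as)) (\<lambda>b. \<phi> (\<sigma>, Ps, as[i - 1 := b]))"
    using x by (elim index_0_1_cases) (auto simp: value_module_simps last_vertex_def intro: assms(2))
qed

lemma twist_cochainI:
  assumes "\<phi> \<in> extensional (cochain_index U A 2 0)"
    and "\<And>u v P. \<lbrakk>u \<in> Arr U; v \<in> Arr U; Cod U v = Dom U u; P \<in> Objs (Cod U u)\<rbrakk>
      \<Longrightarrow> \<phi> ((Dom U v, [v, u]), [P], []) \<in> Hom_set (Dom U v) (Robj A v (Robj A u P)) (Robj A (Cmp U u v) P)"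
  shows "\<phi> \<in> cochains K U A 2 0"
proof (rule cochainI[OF assms(1)])
  fix x assume "x \<in> cochain_index U A 2 0"
  then show "\<phi> x \<in> carrier (value_module U A x)"
    by (rule index_2_0_cases) (auto simp: value_module_simps intro: assms(2))
qed auto

lemma transformation_cochainI:
  assumes "\<phi> \<in> extensional (cochain_index U A 1 0)"
    and "\<And>u P. \<lbrakk>u \<in> Arr U; P \<in> Objs (Cod U u)\<rbrakk>
      \<Longrightarrow> \<phi> ((Dom U u, [u]), [P], []) \<in> Hom_set (Dom U u) (Robj A u P) (Robj A u P)"
  shows "\<phi> \<in> cochains K U A 1 0"
proof (rule cochainI[OF assms(1)])
  fix x assume "x \<in> cochain_index U A 1 0"
  then show "\<phi> x \<in> carrier (value_module U A x)"
    by (rule index_1_0_cases) (auto simp: value_module_simps intro!: assms(2))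
qed auto

end

context one_cochain
begin

lemma multiplication_coboundary_linear:
  assumes [simp]: "X \<in> Obj U" "P \<in> Objs X" "Q \<in> Objs X" "R \<in> Objs X"
  shows "a \<in> Hom_set X P Q \<Longrightarrow> linear_map K (Hom X Q R) (Hom X P R) (\<lambda>b. multiplication_coboundary g X P Q R b a)"
    and "b \<in> Hom_set X Q R \<Longrightarrow> linear_map K (Hom X P Q) (Hom X P R) (\<lambda>a. multiplication_coboundary g X P Q R b a)"
  unfolding multiplication_coboundary_def
  by (intro linear_map_plus linear_map_minus linear_map_compose[OF Hom_linear_left g_linear] linear_map_compose[OF g_linear Hom_linear_left]
      linear_map_compose[OF Hom_linear_right g_linear] linear_map_compose[OF g_linear Hom_linear_right] Hom_linear_left Hom_linear_right Hom_module;
      simp add: one_cochain_rules)+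

lemma restriction_coboundary_linear:
  assumes [simp]: "u \<in> Arr U" "P \<in> Objs (Cod U u)" "Q \<in> Objs (Cod U u)"
  shows "linear_map K (Hom (Cod U u) P Q) (Hom (Dom U u) (Robj A u P) (Robj A u Q)) (\<lambda>a. restriction_coboundary g t u P Q a)"
  unfolding restriction_coboundary_def Let_def
  by (intro linear_map_plus linear_map_minus linear_map_compose[OF Rmor_linear Hom_linear_left] linear_map_compose[OF Rmor_linear Hom_linear_right]
      linear_map_compose[OF Rmor_linear g_linear] linear_map_compose[OF g_linear Rmor_linear] Hom_module;
      simp add: one_cochain_rules)

lemma twist_coboundary_closed:
  assumes [simp]: "u \<in> Arr U" "v \<in> Arr U" "Cod U v = Dom U u" "P \<in> Objs (Cod U u)"
  shows "twist_coboundary g t u v P \<in> Hom_set (Dom U v) (Robj A v (Robj A u P)) (Robj A (Cmp U u v) P)"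
  unfolding twist_coboundary_def Let_def by (simp add: one_cochain_rules)

end

context prestack_on_category
begin

lemma gs_group_1_one_cochain:
  assumes "\<psi> \<in> carrier (gs_group K U A (Suc 0))" shows "one_cochain K U A (\<psi> 0) (\<psi> (Suc 0))"
  using gs_group_component[OF assms, of 0] gs_group_component[OF assms, of "Suc 0"] by unfold_locales simp_all

lemma gs_group_2_two_cochain:
  assumes "\<phi> \<in> carrier (gs_group K U A 2)" shows "two_cochain K U A (\<phi> 0) (\<phi> (Suc 0)) (\<phi> 2)"
  using gs_group_component[OF assms, of 0] gs_group_component[OF assms, of "Suc 0"] gs_group_component[OF assms, of 2]
  by unfold_locales simp_all

lemma gs_group_2_carrier:
  "\<lbrakk>\<phi> \<in> extensional {..2}; \<phi> 0 \<in> cochains K U A 0 2; \<phi> (Suc 0) \<in> cochains K U A 1 1; \<phi> 2 \<in> cochains K U A 2 0\<rbrakk>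
    \<Longrightarrow> \<phi> \<in> carrier (gs_group K U A 2)"
  unfolding gs_group_carrier by (auto simp: PiE_iff atMost_low)

lemma gs_group_2_eqI:
  assumes \<phi>: "\<phi> \<in> (\<Pi>\<^sub>E p\<in>{..2}. extensional (cochain_index U A p (2 - p)))"
    and \<psi>: "\<psi> \<in> (\<Pi>\<^sub>E p\<in>{..2}. extensional (cochain_index U A p (2 - p)))"
    and "\<And>X P Q R b a. \<lbrakk>X \<in> Obj U; P \<in> Objs X; Q \<in> Objs X; R \<in> Objs X; b \<in> Hom_set X Q R; a \<in> Hom_set X P Q\<rbrakk>
      \<Longrightarrow> \<phi> 0 ((X, []), [P, Q, R], [b, a]) = \<psi> 0 ((X, []), [P, Q, R], [b, a])"
    and "\<And>u P Q a. \<lbrakk>u \<in> Arr U; P \<in> Objs (Cod U u); Q \<in> Objs (Cod U u); a \<in> Hom_set (Cod U u) P Q\<rbrakk>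
      \<Longrightarrow> \<phi> (Suc 0) ((Dom U u, [u]), [P, Q], [a]) = \<psi> (Suc 0) ((Dom U u, [u]), [P, Q], [a])"
    and "\<And>u v P. \<lbrakk>u \<in> Arr U; v \<in> Arr U; Cod U v = Dom U u; P \<in> Objs (Cod U u)\<rbrakk>
      \<Longrightarrow> \<phi> 2 ((Dom U v, [v, u]), [P], []) = \<psi> 2 ((Dom U v, [v, u]), [P], [])"
  shows "\<phi> = \<psi>"
proof (rule gs_group_eqI[OF \<phi> \<psi>])
  fix p :: nat and x assume p: "p \<le> 2" and x: "x \<in> cochain_index U A p (2 - p)"
  consider "p = 0" | "p = 1" | "p = 2" using p by linarith
  then show "\<phi> p x = \<psi> p x"
  proof cases
    case 1 then show ?thesis using x assms(3) by (auto elim!: index_0_2_cases)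
  next
    case 2
    then have "x \<in> cochain_index U A 1 1" using x by simp
    then show ?thesis by (rule index_1_1_cases) (simp add: assms(4) 2)
  next
    case 3 then show ?thesis using x assms(5) by (auto elim!: index_2_0_cases)
  qed
qed

lemma gs_group_2_mult:
  "\<lbrakk>X \<in> Obj U; P \<in> Objs X; Q \<in> Objs X; R \<in> Objs X; b \<in> Hom_set X Q R; a \<in> Hom_set X P Q\<rbrakk>
      \<Longrightarrow> (\<phi> \<otimes>\<^bsub>gs_group K U A 2\<^esub> \<psi>) 0 ((X, []), [P, Q, R], [b, a])
        = \<phi> 0 ((X, []), [P, Q, R], [b, a]) \<oplus>\<^bsub>Hom X P R\<^esub> \<psi> 0 ((X, []), [P, Q, R], [b, a])"
  "\<lbrakk>u \<in> Arr U; Dom U u = V; Cod U u = X; P \<in> Objs X; Q \<in> Objs X; a \<in> Hom_set X P Q\<rbrakk>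
      \<Longrightarrow> (\<phi> \<otimes>\<^bsub>gs_group K U A 2\<^esub> \<psi>) (Suc 0) ((V, [u]), [P, Q], [a])
        = \<phi> (Suc 0) ((V, [u]), [P, Q], [a]) \<oplus>\<^bsub>Hom V (Robj A u P) (Robj A u Q)\<^esub> \<psi> (Suc 0) ((V, [u]), [P, Q], [a])"
  "\<lbrakk>u \<in> Arr U; v \<in> Arr U; Cod U v = Dom U u; Dom U v = W; P \<in> Objs (Cod U u)\<rbrakk>
      \<Longrightarrow> (\<phi> \<otimes>\<^bsub>gs_group K U A 2\<^esub> \<psi>) 2 ((W, [v, u]), [P], [])
        = \<phi> 2 ((W, [v, u]), [P], []) \<oplus>\<^bsub>Hom W (Robj A v (Robj A u P)) (Robj A (Cmp U u v) P)\<^esub> \<psi> 2 ((W, [v, u]), [P], [])"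
  by (subst gs_group_mult; force simp: index_0 index_1 index_2 value_module_simps Cod_closed)+

lemma gs_group_1_mult:
  "\<lbrakk>X \<in> Obj U; P \<in> Objs X; Q \<in> Objs X; a \<in> Hom_set X P Q\<rbrakk>
      \<Longrightarrow> (\<phi> \<otimes>\<^bsub>gs_group K U A (Suc 0)\<^esub> \<psi>) 0 ((X, []), [P, Q], [a])
        = \<phi> 0 ((X, []), [P, Q], [a]) \<oplus>\<^bsub>Hom X P Q\<^esub> \<psi> 0 ((X, []), [P, Q], [a])"
  "\<lbrakk>u \<in> Arr U; Dom U u = V; P \<in> Objs (Cod U u)\<rbrakk>
      \<Longrightarrow> (\<phi> \<otimes>\<^bsub>gs_group K U A (Suc 0)\<^esub> \<psi>) (Suc 0) ((V, [u]), [P], [])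
        = \<phi> (Suc 0) ((V, [u]), [P], []) \<oplus>\<^bsub>Hom V (Robj A u P) (Robj A u P)\<^esub> \<psi> (Suc 0) ((V, [u]), [P], [])"
  by (subst gs_group_mult; force simp: index_0 index_1 value_module_simps Cod_closed)+

lemma differential_extensional:
  "gs_differential U A n \<phi> \<in> (\<Pi>\<^sub>E p\<in>{..Suc n}. extensional (cochain_index U A p (Suc n - p)))"
  by (auto simp: gs_differential_def)

lemma differential_1_closed:
  assumes \<psi>: "\<psi> \<in> carrier (gs_group K U A (Suc 0))"
  shows "gs_differential U A (Suc 0) \<psi> \<in> carrier (gs_group K U A 2)"
proof -
  interpret one_cochain K U A "\<psi> 0" "\<psi> (Suc 0)" using gs_group_1_one_cochain[OF \<psi>] .
  note ext = differential_extensional[of "Suc 0" \<psi>, folded numeral_2_eq_2]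
  note d = differential_0_2[of \<psi>, OF refl refl] differential_1_1[of \<psi>, OF refl refl] differential_2_0[of \<psi>, OF refl refl]
  show ?thesis
  proof (rule gs_group_2_carrier)
    show "gs_differential U A (Suc 0) \<psi> \<in> extensional {..2}" using ext by (auto simp: PiE_iff)
    show "gs_differential U A (Suc 0) \<psi> 0 \<in> cochains K U A 0 2"
    proof (rule multiplication_cochainI)
      show "gs_differential U A (Suc 0) \<psi> 0 \<in> extensional (cochain_index U A 0 2)" using PiE_mem[OF ext, of 0] by simp
    qed (rule linear_map_cong[OF multiplication_coboundary_linear(1)] linear_map_cong[OF multiplication_coboundary_linear(2)];
        simp add: d Hom_module)+
    show "gs_differential U A (Suc 0) \<psi> (Suc 0) \<in> cochains K U A 1 1"
    proof (rule restriction_cochainI)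
      show "gs_differential U A (Suc 0) \<psi> (Suc 0) \<in> extensional (cochain_index U A 1 1)" using PiE_mem[OF ext, of 1] by simp
    qed (rule linear_map_cong[OF restriction_coboundary_linear]; simp add: d[simplified] Hom_module Cod_closed)
    show "gs_differential U A (Suc 0) \<psi> 2 \<in> cochains K U A 2 0"
    proof (rule twist_cochainI)
      show "gs_differential U A (Suc 0) \<psi> 2 \<in> extensional (cochain_index U A 2 0)" using PiE_mem[OF ext, of 2] by simp
    qed (simp add: d twist_coboundary_closed)
  qed
qed

lemma differential_1_additive:
  assumes \<psi>: "\<psi> \<in> carrier (gs_group K U A (Suc 0))" and \<psi>': "\<psi>' \<in> carrier (gs_group K U A (Suc 0))"
  shows "gs_differential U A (Suc 0) (\<psi> \<otimes>\<^bsub>gs_group K U A (Suc 0)\<^esub> \<psi>')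
    = gs_differential U A (Suc 0) \<psi> \<otimes>\<^bsub>gs_group K U A 2\<^esub> gs_differential U A (Suc 0) \<psi>'"
proof -
  let ?\<chi> = "\<psi> \<otimes>\<^bsub>gs_group K U A (Suc 0)\<^esub> \<psi>'"
  have \<chi>: "?\<chi> \<in> carrier (gs_group K U A (Suc 0))" using \<psi> \<psi>' by (rule gs_group_mult_closed)
  interpret one_cochain K U A "\<psi> 0" "\<psi> (Suc 0)" using gs_group_1_one_cochain[OF \<psi>] .
  interpret second: one_cochain K U A "\<psi>' 0" "\<psi>' (Suc 0)" using gs_group_1_one_cochain[OF \<psi>'] .
  interpret sum: one_cochain K U A "?\<chi> 0" "?\<chi> (Suc 0)" using gs_group_1_one_cochain[OF \<chi>] .
  note ext = differential_extensional[of "Suc 0", folded numeral_2_eq_2]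
  note d = differential_0_2[of \<psi>, OF refl refl] differential_1_1[of \<psi>, OF refl refl] differential_2_0[of \<psi>, OF refl refl]
    second.differential_0_2[of \<psi>', OF refl refl] second.differential_1_1[of \<psi>', OF refl refl] second.differential_2_0[of \<psi>', OF refl refl]
    sum.differential_0_2[of ?\<chi>, OF refl refl] sum.differential_1_1[of ?\<chi>, OF refl refl] sum.differential_2_0[of ?\<chi>, OF refl refl]
  note rules = closure_rules one_cochain_closed second.one_cochain_closed
    Hom_distrib Rmor_distrib
  show ?thesis
  proof (rule gs_group_2_eqI[OF ext gs_group_extensional(2)], goal_cases)
    case [simp]: (1 X P Q R b a)
    show ?case
      apply (simp add: d gs_group_2_mult gs_group_1_mult multiplication_coboundary_def rules)
      by (rule Hom_eqI, (rule combination_intros | rule combination_atom, simp add: rules; fail)+,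
      (simp add: rules algebra_simps)+)
  next
    case [simp]: (2 u P Q a)
    show ?case
      apply (simp add: d[simplified] gs_group_2_mult gs_group_1_mult restriction_coboundary_def Let_def rules)
      by (rule Hom_eqI, (rule combination_intros | rule combination_atom, simp add: rules; fail)+,
      (simp add: rules algebra_simps)+)
  next
    case [simp]: (3 u v P)
    show ?case
      apply (simp add: d gs_group_2_mult gs_group_1_mult twist_coboundary_def Let_def rules)
      by (rule Hom_eqI, (rule combination_intros | rule combination_atom, simp add: rules; fail)+,
      (simp add: rules algebra_simps)+)
  qed
qed

lemma coboundaries_subgroup: "subgroup (gs_coboundaries K U A 2) (gs_group K U A 2)"
proof -
  interpret C1: comm_group "gs_group K U A (Suc 0)" by (rule gs_group_comm_group)
  interpret C2: comm_group "gs_group K U A 2" by (rule gs_group_comm_group)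
  have "group_hom (gs_group K U A (Suc 0)) (gs_group K U A 2) (gs_differential U A (Suc 0))"
    by unfold_locales (auto simp: hom_def differential_1_closed differential_1_additive)
  then show ?thesis by (simp add: gs_coboundaries_def group_hom.img_is_subgroup)
qed

lemma gs_class_eq_iff:
  assumes \<phi>: "\<phi> \<in> carrier (gs_group K U A 2)" and \<phi>': "\<phi>' \<in> carrier (gs_group K U A 2)"
  shows "gs_class K U A 2 \<phi> = gs_class K U A 2 \<phi>' \<longleftrightarrow>
    (\<exists>\<psi>\<in>carrier (gs_group K U A (Suc 0)). \<phi>' = \<phi> \<otimes>\<^bsub>gs_group K U A 2\<^esub> gs_differential U A (Suc 0) \<psi>)"
proof -
  interpret C2: comm_group "gs_group K U A 2" by (rule gs_group_comm_group)
  have "gs_class K U A 2 \<phi> = gs_class K U A 2 \<phi>' \<longleftrightarrow> \<phi>' \<in> gs_coboundaries K U A 2 #>\<^bsub>gs_group K U A 2\<^esub> \<phi>"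
    unfolding gs_class_def
    using C2.rcos_self[OF \<phi>' coboundaries_subgroup] C2.repr_independence[OF _ \<phi> coboundaries_subgroup] by metis
  also have "\<dots> \<longleftrightarrow> (\<exists>\<psi>\<in>carrier (gs_group K U A (Suc 0)). \<phi>' = \<phi> \<otimes>\<^bsub>gs_group K U A 2\<^esub> gs_differential U A (Suc 0) \<psi>)"
    using C2.m_comm[OF \<phi>] differential_1_closed by (auto simp: r_coset_def gs_coboundaries_def)
  finally show ?thesis .
qed

text \<open>This lemma and the next translate between the equation \<open>\<phi>' = \<phi> + d\<psi>\<close> in the group of cochains and the
  relation between values that enters the calculations.\<close>

lemma add_coboundary_cohomologous:
  assumes \<phi>: "\<phi> \<in> carrier (gs_group K U A 2)" and \<psi>: "\<psi> \<in> carrier (gs_group K U A (Suc 0))"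
    and \<phi>': "\<phi>' = \<phi> \<otimes>\<^bsub>gs_group K U A 2\<^esub> gs_differential U A (Suc 0) \<psi>"
  shows "cohomologous K U A (\<phi> 0) (\<phi> (Suc 0)) (\<phi> 2) (\<psi> 0) (\<psi> (Suc 0)) (\<phi>' 0) (\<phi>' (Suc 0)) (\<phi>' 2)"
proof -
  interpret two_cochain K U A "\<phi> 0" "\<phi> (Suc 0)" "\<phi> 2" using gs_group_2_two_cochain[OF \<phi>] .
  interpret one_cochain K U A "\<psi> 0" "\<psi> (Suc 0)" using gs_group_1_one_cochain[OF \<psi>] .
  note d = differential_0_2[of \<psi>, OF refl refl] differential_1_1[of \<psi>, OF refl refl, simplified] differential_2_0[of \<psi>, OF refl refl]
  show ?thesis unfolding \<phi>' by unfold_locales (auto simp: gs_group_2_mult d)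
qed

lemma cohomologous_class_eq:
  assumes \<phi>: "\<phi> \<in> carrier (gs_group K U A 2)" and \<phi>': "\<phi>' \<in> carrier (gs_group K U A 2)"
    and coh: "cohomologous K U A (\<phi> 0) (\<phi> (Suc 0)) (\<phi> 2) g t (\<phi>' 0) (\<phi>' (Suc 0)) (\<phi>' 2)"
  shows "gs_class K U A 2 \<phi> = gs_class K U A 2 \<phi>'"
proof -
  interpret cohomologous K U A "\<phi> 0" "\<phi> (Suc 0)" "\<phi> 2" g t "\<phi>' 0" "\<phi>' (Suc 0)" "\<phi>' 2" by fact
  define \<psi> where "\<psi> = (\<lambda>p\<in>{..Suc 0}. if p = 0 then g else t)"
  have [simp]: "\<psi> 0 = g" "\<psi> (Suc 0) = t" by (simp_all add: \<psi>_def)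
  have "\<psi> \<in> carrier (gs_group K U A (Suc 0))"
    unfolding gs_group_carrier atMost_low using g t by (auto simp: \<psi>_def PiE_iff atMost_low)
  moreover have "\<phi>' = \<phi> \<otimes>\<^bsub>gs_group K U A 2\<^esub> gs_differential U A (Suc 0) \<psi>"
    using m'_cohomologous f'_cohomologous c'_cohomologous
    by (intro gs_group_2_eqI[OF gs_group_extensional(1)[OF \<phi>'] gs_group_extensional(2)])
      (simp_all add: gs_group_2_mult differential_0_2 differential_1_1[simplified] differential_2_0)
  ultimately show ?thesis using gs_class_eq_iff[OF \<phi> \<phi>'] by blast
qed

end

section \<open>Cocycles of degree two and their normalization\<close>

context prestack_on_category
begin

definition prestack_equations where
  "prestack_equations m f c \<longleftrightarrow>
    (\<forall>X P0 P1 P2 P3 a1 a2 a3. X \<in> Obj U \<and> P0 \<in> Objs X \<and> P1 \<in> Objs X \<and> P2 \<in> Objs X \<and> P3 \<in> Objs X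
      \<and> a1 \<in> Hom_set X P2 P3 \<and> a2 \<in> Hom_set X P1 P2 \<and> a3 \<in> Hom_set X P0 P1
      \<longrightarrow> associativity_defect m X P0 P1 P2 P3 a1 a2 a3 = \<zero>\<^bsub>Hom X P0 P3\<^esub>) \<and>
    (\<forall>u P0 P1 P2 a1 a2. u \<in> Arr U \<and> P0 \<in> Objs (Cod U u) \<and> P1 \<in> Objs (Cod U u) \<and> P2 \<in> Objs (Cod U u)
      \<and> a1 \<in> Hom_set (Cod U u) P1 P2 \<and> a2 \<in> Hom_set (Cod U u) P0 P1
      \<longrightarrow> functoriality_defect m f u P0 P1 P2 a1 a2 = \<zero>\<^bsub>Hom (Dom U u) (Robj A u P0) (Robj A u P2)\<^esub>) \<and>
    (\<forall>u v P Q a. u \<in> Arr U \<and> v \<in> Arr U \<and> Cod U v = Dom U u \<and> P \<in> Objs (Cod U u) \<and> Q \<in> Objs (Cod U u)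
      \<and> a \<in> Hom_set (Cod U u) P Q
      \<longrightarrow> naturality_defect m f c u v P Q a = \<zero>\<^bsub>Hom (Dom U v) (Robj A v (Robj A u P)) (Robj A (Cmp U u v) Q)\<^esub>) \<and>
    (\<forall>u v w P. u \<in> Arr U \<and> v \<in> Arr U \<and> w \<in> Arr U \<and> Cod U v = Dom U u \<and> Cod U w = Dom U v \<and> P \<in> Objs (Cod U u)
      \<longrightarrow> coherence_defect m f c u v w P
        = \<zero>\<^bsub>Hom (Dom U w) (Robj A w (Robj A v (Robj A u P))) (Robj A (Cmp U u (Cmp U v w)) P)\<^esub>)"

lemma prestack_equationsD:
  assumes "prestack_equations m f c"
  shows "\<lbrakk>X \<in> Obj U; P0 \<in> Objs X; P1 \<in> Objs X; P2 \<in> Objs X; P3 \<in> Objs X;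
      a1 \<in> Hom_set X P2 P3; a2 \<in> Hom_set X P1 P2; a3 \<in> Hom_set X P0 P1\<rbrakk>
      \<Longrightarrow> associativity_defect m X P0 P1 P2 P3 a1 a2 a3 = \<zero>\<^bsub>Hom X P0 P3\<^esub>"
    "\<lbrakk>u \<in> Arr U; P0 \<in> Objs (Cod U u); P1 \<in> Objs (Cod U u); P2 \<in> Objs (Cod U u);
      a1 \<in> Hom_set (Cod U u) P1 P2; a2 \<in> Hom_set (Cod U u) P0 P1\<rbrakk>
      \<Longrightarrow> functoriality_defect m f u P0 P1 P2 a1 a2 = \<zero>\<^bsub>Hom (Dom U u) (Robj A u P0) (Robj A u P2)\<^esub>"
    "\<lbrakk>u \<in> Arr U; v \<in> Arr U; Cod U v = Dom U u; P \<in> Objs (Cod U u); Q \<in> Objs (Cod U u);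
      a \<in> Hom_set (Cod U u) P Q\<rbrakk>
      \<Longrightarrow> naturality_defect m f c u v P Q a = \<zero>\<^bsub>Hom (Dom U v) (Robj A v (Robj A u P)) (Robj A (Cmp U u v) Q)\<^esub>"
    "\<lbrakk>u \<in> Arr U; v \<in> Arr U; w \<in> Arr U; Cod U v = Dom U u; Cod U w = Dom U v; P \<in> Objs (Cod U u)\<rbrakk>
      \<Longrightarrow> coherence_defect m f c u v w P
        = \<zero>\<^bsub>Hom (Dom U w) (Robj A w (Robj A v (Robj A u P))) (Robj A (Cmp U u (Cmp U v w)) P)\<^esub>"
  using assms[unfolded prestack_equations_def] by simp_all

lemma index_0_3_cases:
  assumes "x \<in> cochain_index U A 0 3"
  obtains X P Q R S h b a where "x = ((X, []), [P, Q, R, S], [h, b, a])" "X \<in> Obj U" "P \<in> Objs X" "Q \<in> Objs X"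
    "R \<in> Objs X" "S \<in> Objs X" "h \<in> Hom_set X R S" "b \<in> Hom_set X Q R" "a \<in> Hom_set X P Q"
  using assms by (rule index_3_cases) (auto simp: index_3)

lemma index_1_2_cases:
  assumes "x \<in> cochain_index U A 1 2"
  obtains u P Q R b a where "x = ((Dom U u, [u]), [P, Q, R], [b, a])" "u \<in> Arr U" "P \<in> Objs (Cod U u)" "Q \<in> Objs (Cod U u)"
    "R \<in> Objs (Cod U u)" "b \<in> Hom_set (Cod U u) Q R" "a \<in> Hom_set (Cod U u) P Q"
  using assms by (rule index_2_cases) (auto simp: index_2 length_Suc_conv)

lemma index_2_1_cases:
  assumes "x \<in> cochain_index U A 2 1"
  obtains u v P Q a where "x = ((Dom U v, [v, u]), [P, Q], [a])" "u \<in> Arr U" "v \<in> Arr U" "Cod U v = Dom U u"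
    "P \<in> Objs (Cod U u)" "Q \<in> Objs (Cod U u)" "a \<in> Hom_set (Cod U u) P Q"
proof -
  have "x \<in> cochain_index U A (Suc (Suc 0)) (Suc 0)" using assms by (simp add: numeral_2_eq_2)
  then show thesis by (rule index_1_cases) (use that in \<open>auto simp: index_1 length_Suc_conv\<close>)
qed

lemma index_3_0_cases:
  assumes "x \<in> cochain_index U A 3 0"
  obtains u v w P where "x = ((Dom U w, [w, v, u]), [P], [])" "u \<in> Arr U" "v \<in> Arr U" "w \<in> Arr U" "Cod U v = Dom U u" "Cod U w = Dom U v"
    "P \<in> Objs (Cod U u)"
proof -
  have "x \<in> cochain_index U A (Suc (Suc (Suc 0))) 0" using assms by (simp add: numeral_3_eq_3)
  then show thesis by (rule index_0_cases) (use that in \<open>auto simp: index_0 length_Suc_conv\<close>)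
qed

lemma cocycle_iff:
  assumes \<phi>: "\<phi> \<in> carrier (gs_group K U A 2)"
  shows "\<phi> \<in> gs_cocycles K U A 2 \<longleftrightarrow> prestack_equations (\<phi> 0) (\<phi> (Suc 0)) (\<phi> 2)"
proof -
  interpret two_cochain K U A "\<phi> 0" "\<phi> (Suc 0)" "\<phi> 2" using gs_group_2_two_cochain[OF \<phi>] .
  note d = differential_0_3[of \<phi>, OF refl refl refl] differential_1_2[of \<phi>, OF refl refl refl]
    differential_2_1[of \<phi>, OF refl refl refl] differential_3_0[of \<phi>, OF refl refl refl]
  let ?d = "gs_differential U A 2 \<phi>"
  have Suc2: "Suc 2 = 3" by simp
  have one: "\<one>\<^bsub>gs_group K U A 3\<^esub> p x = \<zero>\<^bsub>value_module U A x\<^esub>" if "p \<le> 3" "x \<in> cochain_index U A p (3 - p)" for p x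
    using gs_group_one that .
  have "\<phi> \<in> gs_cocycles K U A 2 \<longleftrightarrow> ?d = \<one>\<^bsub>gs_group K U A 3\<^esub>"
    using \<phi> by (simp add: gs_cocycles_def kernel_def)
  also have "\<dots> \<longleftrightarrow> prestack_equations (\<phi> 0) (\<phi> (Suc 0)) (\<phi> 2)"
  proof
    assume d0: "?d = \<one>\<^bsub>gs_group K U A 3\<^esub>"
    show "prestack_equations (\<phi> 0) (\<phi> (Suc 0)) (\<phi> 2)"
      unfolding prestack_equations_def
    proof ((intro conjI allI impI; elim conjE), goal_cases)
      case (1 X P0 P1 P2 P3 a1 a2 a3)
      then show ?case
        using d(1)[of X P0 P1 P2 P3 a1 a2 a3] one[of 0 "((X, []), [P0, P1, P2, P3], [a1, a2, a3])"]
        by (simp add: d0 index_3 value_module_simps closure_rules)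
    next
      case (2 u P0 P1 P2 a1 a2)
      then show ?case
        using d(2)[of u _ _ P0 P1 P2 a1 a2, OF _ refl refl] one[of 1 "((Dom U u, [u]), [P0, P1, P2], [a1, a2])"]
        by (simp add: d0 index_2 value_module_simps closure_rules)
    next
      case (3 u v P Q a)
      then show ?case
        using d(3)[of u v _ _ _ P Q a, OF _ _ refl refl] one[of 2 "((Dom U v, [v, u]), [P, Q], [a])"]
        by (simp add: d0 index_1 value_module_simps closure_rules)
    next
      case (4 u v w P)
      then show ?case
        using d(4)[of u v w _ _ _ _ P, OF _ _ _ refl refl refl] one[of 3 "((Dom U w, [w, v, u]), [P], [])"]
        by (simp add: d0 index_0 value_module_simps closure_rules)
    qed
  next
    assume eqs: "prestack_equations (\<phi> 0) (\<phi> (Suc 0)) (\<phi> 2)"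
    show "?d = \<one>\<^bsub>gs_group K U A 3\<^esub>"
    proof (rule gs_group_eqI[OF differential_extensional[of 2, unfolded Suc2] gs_group_extensional(3)])
      fix p :: nat and x assume p: "p \<le> 3" and x: "x \<in> cochain_index U A p (3 - p)"
      have p_cases: "p = 0 \<or> p = 1 \<or> p = 2 \<or> p = 3" using p by linarith
      have "?d p x = \<zero>\<^bsub>value_module U A x\<^esub>"
        using p_cases
      proof (elim disjE)
        assume p: "p = 0"
        then have "x \<in> cochain_index U A 0 3" using x by simp
        then show ?thesis by (rule index_0_3_cases) (simp add: d p prestack_equationsD[OF eqs] value_module_simps)
      next
        assume p: "p = 1"
        then have "x \<in> cochain_index U A 1 2" using x by simp
        then show ?thesis by (rule index_1_2_cases) (simp add: d[simplified] p prestack_equationsD[OF eqs] value_module_simps)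
      next
        assume p: "p = 2"
        then have "x \<in> cochain_index U A 2 1" using x by simp
        then show ?thesis by (rule index_2_1_cases) (simp add: d p prestack_equationsD[OF eqs] value_module_simps)
      next
        assume p: "p = 3"
        then have "x \<in> cochain_index U A 3 0" using x by simp
        then show ?thesis by (rule index_3_0_cases) (simp add: d p prestack_equationsD[OF eqs] value_module_simps)
      qed
      then show "?d p x = \<one>\<^bsub>gs_group K U A 3\<^esub> p x" using one[OF p x] by simp
    qed
  qed
  finally show ?thesis .
qed

text \<open>The coefficients of \<open>\<epsilon>\<close> in the axioms about identities, which amount to normalization and reducedness
  (\<open>normalized_reduced_iff\<close>).\<close>

definition unit_conditions where
  "unit_conditions m f c \<longleftrightarrow>
    (\<forall>X P Q a. X \<in> Obj U \<and> P \<in> Objs X \<and> Q \<in> Objs X \<and> a \<in> Hom_set X P Q \<longrightarrow>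
      m ((X, []), [P, P, Q], [a, idm X P]) = \<zero>\<^bsub>Hom X P Q\<^esub> \<and>
      m ((X, []), [P, Q, Q], [idm X Q, a]) = \<zero>\<^bsub>Hom X P Q\<^esub>) \<and>
    (\<forall>X P Q a. X \<in> Obj U \<and> P \<in> Objs X \<and> Q \<in> Objs X \<and> a \<in> Hom_set X P Q \<longrightarrow>
      f ((X, [Ident U X]), [P, Q], [a]) = \<zero>\<^bsub>Hom X P Q\<^esub>) \<and>
    (\<forall>u P. u \<in> Arr U \<and> P \<in> Objs (Cod U u) \<longrightarrow>
      f ((Dom U u, [u]), [P, P], [idm (Cod U u) P]) = \<zero>\<^bsub>Hom (Dom U u) (Robj A u P) (Robj A u P)\<^esub>) \<and>
    (\<forall>u P. u \<in> Arr U \<and> P \<in> Objs (Cod U u) \<longrightarrow>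
      c ((Dom U u, [u, Ident U (Cod U u)]), [P], []) = \<zero>\<^bsub>Hom (Dom U u) (Robj A u P) (Robj A u P)\<^esub> \<and>
      c ((Dom U u, [Ident U (Dom U u), u]), [P], []) = \<zero>\<^bsub>Hom (Dom U u) (Robj A u P) (Robj A u P)\<^esub>)"

lemma unit_conditionsD:
  assumes "unit_conditions m f c"
  shows "\<lbrakk>X \<in> Obj U; P \<in> Objs X; Q \<in> Objs X; a \<in> Hom_set X P Q\<rbrakk>
      \<Longrightarrow> m ((X, []), [P, P, Q], [a, idm X P]) = \<zero>\<^bsub>Hom X P Q\<^esub>"
    "\<lbrakk>X \<in> Obj U; P \<in> Objs X; Q \<in> Objs X; a \<in> Hom_set X P Q\<rbrakk>
      \<Longrightarrow> m ((X, []), [P, Q, Q], [idm X Q, a]) = \<zero>\<^bsub>Hom X P Q\<^esub>"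
    "\<lbrakk>X \<in> Obj U; P \<in> Objs X; Q \<in> Objs X; a \<in> Hom_set X P Q\<rbrakk>
      \<Longrightarrow> f ((X, [Ident U X]), [P, Q], [a]) = \<zero>\<^bsub>Hom X P Q\<^esub>"
    "\<lbrakk>u \<in> Arr U; Dom U u = V; Cod U u = X; P \<in> Objs X\<rbrakk>
      \<Longrightarrow> f ((V, [u]), [P, P], [idm X P]) = \<zero>\<^bsub>Hom V (Robj A u P) (Robj A u P)\<^esub>"
    "\<lbrakk>u \<in> Arr U; Dom U u = V; Cod U u = X; P \<in> Objs X\<rbrakk>
      \<Longrightarrow> c ((V, [u, Ident U X]), [P], []) = \<zero>\<^bsub>Hom V (Robj A u P) (Robj A u P)\<^esub>"
    "\<lbrakk>u \<in> Arr U; Dom U u = V; P \<in> Objs (Cod U u)\<rbrakk>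
      \<Longrightarrow> c ((V, [Ident U V, u]), [P], []) = \<zero>\<^bsub>Hom V (Robj A u P) (Robj A u P)\<^esub>"
  using assms[unfolded unit_conditions_def] by auto

lemma normalized_0_2_iff:
  "normalized U A 0 2 m \<longleftrightarrow> (\<forall>X P Q a. X \<in> Obj U \<and> P \<in> Objs X \<and> Q \<in> Objs X \<and> a \<in> Hom_set X P Q \<longrightarrow>
      m ((X, []), [P, P, Q], [a, idm X P]) = \<zero>\<^bsub>Hom X P Q\<^esub> \<and>
      m ((X, []), [P, Q, Q], [idm X Q, a]) = \<zero>\<^bsub>Hom X P Q\<^esub>)" (is "_ = ?R")
proof
  assume n: "normalized U A 0 2 m"
  show ?R
  proof (intro allI impI)
    fix X P Q a assume "X \<in> Obj U \<and> P \<in> Objs X \<and> Q \<in> Objs X \<and> a \<in> Hom_set X P Q"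
    then show "m ((X, []), [P, P, Q], [a, idm X P]) = \<zero>\<^bsub>Hom X P Q\<^esub> \<and>
      m ((X, []), [P, Q, Q], [idm X Q, a]) = \<zero>\<^bsub>Hom X P Q\<^esub>"
      using bspec[OF n[unfolded normalized_def], of "((X, []), [P, P, Q], [a, idm X P])"]
        bspec[OF n[unfolded normalized_def], of "((X, []), [P, Q, Q], [idm X Q, a])"]
      by (simp add: index_2 value_module_simps Hom_closed last_vertex_def atLeastAtMost_numerals)
  qed
next
  assume R: ?R
  show "normalized U A 0 2 m" unfolding normalized_def
  proof
    fix x assume "x \<in> cochain_index U A 0 2"
    then show "case x of (\<sigma>, Ps, as) \<Rightarrow> (\<exists>i\<in>{1..2}. Ps ! (2 - i) = Ps ! (2 - i + 1) \<and> as ! (i - 1) = idm (last_vertex U \<sigma>) (Ps ! (2 - i)))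
        \<longrightarrow> m (\<sigma>, Ps, as) = \<zero>\<^bsub>value_module U A (\<sigma>, Ps, as)\<^esub>"
      by (rule index_0_2_cases) (use R in \<open>auto simp: value_module_simps last_vertex_def atLeastAtMost_numerals\<close>)
  qed
qed

lemma normalized_1_1_iff:
  "normalized U A 1 1 f \<longleftrightarrow> (\<forall>u P. u \<in> Arr U \<and> P \<in> Objs (Cod U u) \<longrightarrow>
      f ((Dom U u, [u]), [P, P], [idm (Cod U u) P]) = \<zero>\<^bsub>Hom (Dom U u) (Robj A u P) (Robj A u P)\<^esub>)" (is "_ = ?R")
proof
  assume n: "normalized U A 1 1 f"
  show ?R
  proof (intro allI impI)
    fix u P assume "u \<in> Arr U \<and> P \<in> Objs (Cod U u)"
    then show "f ((Dom U u, [u]), [P, P], [idm (Cod U u) P]) = \<zero>\<^bsub>Hom (Dom U u) (Robj A u P) (Robj A u P)\<^esub>"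
      using bspec[OF n[unfolded normalized_def], of "((Dom U u, [u]), [P, P], [idm (Cod U u) P])"]
      by (simp add: index_1 value_module_simps Hom_closed Cod_closed last_vertex_def)
  qed
next
  assume R: ?R
  show "normalized U A 1 1 f" unfolding normalized_def
  proof
    fix x assume "x \<in> cochain_index U A 1 1"
    then show "case x of (\<sigma>, Ps, as) \<Rightarrow> (\<exists>i\<in>{1..1}. Ps ! (1 - i) = Ps ! (1 - i + 1) \<and> as ! (i - 1) = idm (last_vertex U \<sigma>) (Ps ! (1 - i)))
        \<longrightarrow> f (\<sigma>, Ps, as) = \<zero>\<^bsub>value_module U A (\<sigma>, Ps, as)\<^esub>"
      by (rule index_1_1_cases) (use R in \<open>auto simp: value_module_simps last_vertex_def\<close>)
  qed
qed

lemma reduced_1_1_iff: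
  "reduced U A 1 1 f \<longleftrightarrow> (\<forall>X P Q a. X \<in> Obj U \<and> P \<in> Objs X \<and> Q \<in> Objs X \<and> a \<in> Hom_set X P Q \<longrightarrow>
      f ((X, [Ident U X]), [P, Q], [a]) = \<zero>\<^bsub>Hom X P Q\<^esub>)" (is "_ = ?R")
proof
  assume n: "reduced U A 1 1 f"
  show ?R
  proof (intro allI impI)
    fix X P Q a assume "X \<in> Obj U \<and> P \<in> Objs X \<and> Q \<in> Objs X \<and> a \<in> Hom_set X P Q"
    then show "f ((X, [Ident U X]), [P, Q], [a]) = \<zero>\<^bsub>Hom X P Q\<^esub>"
      using bspec[OF n[unfolded reduced_def], of "((X, [Ident U X]), [P, Q], [a])"]
      by (auto simp: index_1 value_module_simps category_rules restriction_Ident)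
  qed
next
  assume R: ?R
  show "reduced U A 1 1 f" unfolding reduced_def
  proof
    fix x assume "x \<in> cochain_index U A 1 1"
    then show "case x of (\<sigma>, Ps, as) \<Rightarrow> (\<exists>X\<in>Obj U. Ident U X \<in> set (snd \<sigma>))
        \<longrightarrow> f (\<sigma>, Ps, as) = \<zero>\<^bsub>value_module U A (\<sigma>, Ps, as)\<^esub>"
      by (rule index_1_1_cases) (use R in \<open>auto simp: value_module_simps category_rules restriction_Ident\<close>)
  qed
qed

lemma composite_Ident_right: "\<lbrakk>u \<in> Arr U; Dom U u = V\<rbrakk> \<Longrightarrow> Cmp U u (Ident U V) = u"
  using Cmp_Ident_right by blast

lemma reduced_2_0_iff:
  "reduced U A 2 0 c \<longleftrightarrow> (\<forall>u P. u \<in> Arr U \<and> P \<in> Objs (Cod U u) \<longrightarrow>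
      c ((Dom U u, [u, Ident U (Cod U u)]), [P], []) = \<zero>\<^bsub>Hom (Dom U u) (Robj A u P) (Robj A u P)\<^esub> \<and>
      c ((Dom U u, [Ident U (Dom U u), u]), [P], []) = \<zero>\<^bsub>Hom (Dom U u) (Robj A u P) (Robj A u P)\<^esub>)" (is "_ = ?R")
proof
  assume n: "reduced U A 2 0 c"
  show ?R
  proof (intro allI impI)
    fix u P assume u: "u \<in> Arr U \<and> P \<in> Objs (Cod U u)"
    then have "Dom U u \<in> Obj U" "Cod U u \<in> Obj U" "Robj A u P \<in> Objs (Dom U u)" by (auto simp: closure_rules)
    with u show "c ((Dom U u, [u, Ident U (Cod U u)]), [P], []) = \<zero>\<^bsub>Hom (Dom U u) (Robj A u P) (Robj A u P)\<^esub> \<and>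
      c ((Dom U u, [Ident U (Dom U u), u]), [P], []) = \<zero>\<^bsub>Hom (Dom U u) (Robj A u P) (Robj A u P)\<^esub>"
      using bspec[OF n[unfolded reduced_def], of "((Dom U u, [u, Ident U (Cod U u)]), [P], [])"]
         bspec[OF n[unfolded reduced_def], of "((Dom U u, [Ident U (Dom U u), u]), [P], [])"]
      by (auto simp: index_0 value_module_simps category_rules restriction_Ident composite_single composite_Ident_right)
  qed
next
  assume R: ?R
  show "reduced U A 2 0 c" unfolding reduced_def
  proof
    fix x assume "x \<in> cochain_index U A 2 0"
    then show "case x of (\<sigma>, Ps, as) \<Rightarrow> (\<exists>X\<in>Obj U. Ident U X \<in> set (snd \<sigma>))
        \<longrightarrow> c (\<sigma>, Ps, as) = \<zero>\<^bsub>value_module U A (\<sigma>, Ps, as)\<^esub>"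
    proof (rule index_2_0_cases)
      fix u v P assume x: "x = ((Dom U v, [v, u]), [P], [])" and u: "u \<in> Arr U" "v \<in> Arr U" "Cod U v = Dom U u" "P \<in> Objs (Cod U u)"
      have obj: "Dom U v \<in> Obj U" "Robj A u P \<in> Objs (Dom U u)" using u by (auto simp: closure_rules)
      show ?thesis
      proof (simp add: x, intro impI, elim bexE disjE)
        fix X assume X: "X \<in> Obj U" "Ident U X = v"
        then have "X = Dom U u" "Dom U v = X" using u by (auto simp: category_rules)
        then show "c ((Dom U v, [v, u]), [P], []) = \<zero>\<^bsub>value_module U A ((Dom U v, [v, u]), [P], [])\<^esub>"
          using X R u obj by (auto simp: value_module_simps restriction_Ident composite_Ident_right)
      next
        fix X assume X: "X \<in> Obj U" "Ident U X = u"
        then have u_eq: "Ident U (Cod U v) = u" and P: "P \<in> Objs (Cod U v)" and X_eq: "X = Cod U v"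
          using u by (auto simp: category_rules)
        have "c ((Dom U v, [v, u]), [P], []) = \<zero>\<^bsub>Hom (Dom U v) (Robj A v P) (Robj A v P)\<^esub>"
          using R[rule_format, of v P, unfolded u_eq] u(2) P by blast
        moreover have "Robj A u P = P" "Cmp U u v = v"
          using u_eq P u X X_eq restriction_Ident(1) Cmp_Ident_left by metis+
        ultimately show "c ((Dom U v, [v, u]), [P], []) = \<zero>\<^bsub>value_module U A ((Dom U v, [v, u]), [P], [])\<^esub>"
          using u by (simp add: value_module_simps)
      qed
    qed
  qed
qed

lemma normalized_reduced_iff:
  "normalized_reduced U A 2 \<phi> \<longleftrightarrow> unit_conditions (\<phi> 0) (\<phi> (Suc 0)) (\<phi> 2)"
proof -
  have "(\<forall>p\<le>2. Q p) \<longleftrightarrow> Q 0 \<and> Q 1 \<and> Q (2::nat)" for Q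
    by (metis One_nat_def le_Suc_eq le_zero_eq numeral_2_eq_2)
  then have "normalized_reduced U A 2 \<phi> \<longleftrightarrow>
      (normalized U A 0 2 (\<phi> 0) \<and> reduced U A 0 2 (\<phi> 0)) \<and>
      (normalized U A 1 1 (\<phi> (Suc 0)) \<and> reduced U A 1 1 (\<phi> (Suc 0))) \<and>
      (normalized U A 2 0 (\<phi> 2) \<and> reduced U A 2 0 (\<phi> 2))"
    unfolding normalized_reduced_def by simp
  moreover have "reduced U A 0 2 (\<phi> 0)" by (auto simp: reduced_def cochain_index_def nerve_def)
  moreover have "normalized U A 2 0 (\<phi> 2)" by (auto simp: normalized_def)
  moreover have "unit_conditions (\<phi> 0) (\<phi> (Suc 0)) (\<phi> 2) \<longleftrightarrow>
      normalized U A 0 2 (\<phi> 0) \<and> reduced U A 1 1 (\<phi> (Suc 0)) \<and> normalized U A 1 1 (\<phi> (Suc 0)) \<and> reduced U A 2 0 (\<phi> 2)"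
    unfolding unit_conditions_def normalized_0_2_iff normalized_1_1_iff reduced_1_1_iff reduced_2_0_iff ..
  ultimately show ?thesis by blast
qed

end

locale two_cocycle = two_cochain +
  assumes equations: "prestack_equations m f c"
begin

text \<open>Associativity for \<open>1, 1, a\<close> gives \<open>m(1, a) = m(1, 1) a\<close>, and for \<open>a, 1, 1\<close> it gives \<open>m(a, 1) = a m(1, 1)\<close>.
  Then functoriality for \<open>1, 1\<close> gives \<open>f(1) = 0\<close>, naturality for the arrows \<open>1, 1\<close> gives
  \<open>f\<^bsup>1\<^esup>(a) = a c\<^bsup>(1,1)\<^esup> - c\<^bsup>(1,1)\<^esup> a\<close>, and coherence for \<open>1, 1, u\<close> and \<open>u, 1, 1\<close> makes \<open>c\<close> vanish on the pairs
  consisting of \<open>u\<close> and an identity.\<close>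

lemma normalized_if_units_vanish:
  assumes m1: "\<And>X P. \<lbrakk>X \<in> Obj U; P \<in> Objs X\<rbrakk> \<Longrightarrow> m ((X, []), [P, P, P], [idm X P, idm X P]) = \<zero>\<^bsub>Hom X P P\<^esub>"
    and c1: "\<And>X P. \<lbrakk>X \<in> Obj U; P \<in> Objs X\<rbrakk> \<Longrightarrow> c ((X, [Ident U X, Ident U X]), [P], []) = \<zero>\<^bsub>Hom X P P\<^esub>"
  shows "unit_conditions m f c"
proof -
  note rules = two_cochain_rules Hom_Id Hom_distrib Hom_zero m1 c1 restriction_Ident Tw_Ident Rmor_functor Rmor_distrib
    composite_single composite_Ident_right
  have m_left: "m ((X, []), [P, Q, Q], [idm X Q, a]) = \<zero>\<^bsub>Hom X P Q\<^esub>"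
    and m_right: "m ((X, []), [P, P, Q], [a, idm X P]) = \<zero>\<^bsub>Hom X P Q\<^esub>"
    if [simp]: "X \<in> Obj U" "P \<in> Objs X" "Q \<in> Objs X" "a \<in> Hom_set X P Q" for X P Q a
  proof -
    have e: "associativity_defect m X P Q Q Q (idm X Q) (idm X Q) a = \<zero>\<^bsub>Hom X P Q\<^esub>"
      by (rule prestack_equationsD(1)[OF equations]) (simp_all add: rules)
    show "m ((X, []), [P, Q, Q], [idm X Q, a]) = \<zero>\<^bsub>Hom X P Q\<^esub>"
      by (rule Hom_eq_from[OF e[unfolded associativity_defect_def, simplified, simplified rules that]],
        (rule combination_intros | rule combination_atom, simp add: rules; fail)+, (simp add: rules algebra_simps)+)
    have e: "associativity_defect m X P P P Q a (idm X P) (idm X P) = \<zero>\<^bsub>Hom X P Q\<^esub>"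
      by (rule prestack_equationsD(1)[OF equations]) (simp_all add: rules)
    show "m ((X, []), [P, P, Q], [a, idm X P]) = \<zero>\<^bsub>Hom X P Q\<^esub>"
      by (rule Hom_eq_from[OF e[unfolded associativity_defect_def, simplified, simplified rules that, symmetric]],
        (rule combination_intros | rule combination_atom, simp add: rules; fail)+, (simp add: rules algebra_simps)+)
  qed
  have f_unit: "f ((V, [u]), [P, P], [idm X P]) = \<zero>\<^bsub>Hom V (Robj A u P) (Robj A u P)\<^esub>"
    if [simp]: "u \<in> Arr U" "Dom U u = V" "Cod U u = X" "P \<in> Objs X" for u V X P
  proof -
    have [simp]: "V \<in> Obj U" "X \<in> Obj U" using Dom_closed[of u] Cod_closed[of u] by simp_all
    have e: "functoriality_defect m f u P P P (idm X P) (idm X P) = \<zero>\<^bsub>Hom V (Robj A u P) (Robj A u P)\<^esub>"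
      using prestack_equationsD(2)[OF equations, of u P P P "idm X P" "idm X P"] by (simp add: rules)
    show ?thesis
      apply (rule Hom_eq_from[OF e[unfolded functoriality_defect_def Let_def]])
      by ((rule combination_intros | rule combination_atom, simp add: rules; fail)+, (simp add: rules algebra_simps)+)
  qed
  have f_ident: "f ((X, [Ident U X]), [P, Q], [a]) = \<zero>\<^bsub>Hom X P Q\<^esub>"
    if [simp]: "X \<in> Obj U" "P \<in> Objs X" "Q \<in> Objs X" "a \<in> Hom_set X P Q" for X P Q a
  proof -
    have [simp]: "f ((X, [Ident U X]), [P, Q], [a]) \<in> Hom_set X P Q"
      using f_closed[of "Ident U X" X P Q a] by (simp add: rules)
    have e: "naturality_defect m f c (Ident U X) (Ident U X) P Q a = \<zero>\<^bsub>Hom X P Q\<^esub>"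
      using prestack_equationsD(3)[OF equations, of "Ident U X" "Ident U X" P Q a] by (simp add: rules)
    show ?thesis
      apply (insert e)
      apply (simp add: naturality_defect_def Let_def rules m_left m_right)
      apply (erule Hom_eq_from[OF sym])
      by ((rule combination_intros | rule combination_atom, simp add: rules; fail)+, (simp add: rules algebra_simps)+)
  qed
  have c_right: "c ((V, [u, Ident U X]), [P], []) = \<zero>\<^bsub>Hom V (Robj A u P) (Robj A u P)\<^esub>"
    if [simp]: "u \<in> Arr U" "Dom U u = V" "Cod U u = X" "P \<in> Objs X" for u V X P
  proof -
    have [simp]: "V \<in> Obj U" "X \<in> Obj U" using Dom_closed[of u] Cod_closed[of u] by simp_all
    have [simp]: "c ((V, [u, Ident U X]), [P], []) \<in> Hom_set V (Robj A u P) (Robj A u P)"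
      using twist_cochain[OF c, of "Ident U X" u V P] by (simp add: rules)
    have e: "coherence_defect m f c (Ident U X) (Ident U X) u P = \<zero>\<^bsub>Hom V (Robj A u P) (Robj A u P)\<^esub>"
      using prestack_equationsD(4)[OF equations, of "Ident U X" "Ident U X" u P] by (simp add: rules)
    show ?thesis
      apply (insert e)
      apply (simp add: coherence_defect_def Let_def rules m_left m_right f_unit)
      apply (erule Hom_eq_from)
      by ((rule combination_intros | rule combination_atom, simp add: rules; fail)+, (simp add: rules algebra_simps)+)
  qed
  have c_left: "c ((V, [Ident U V, u]), [P], []) = \<zero>\<^bsub>Hom V (Robj A u P) (Robj A u P)\<^esub>"
    if [simp]: "u \<in> Arr U" "Dom U u = V" "Cod U u = X" "P \<in> Objs X" for u V X P
  proof -
    have [simp]: "V \<in> Obj U" "X \<in> Obj U" using Dom_closed[of u] Cod_closed[of u] by simp_all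
    have [simp]: "c ((V, [Ident U V, u]), [P], []) \<in> Hom_set V (Robj A u P) (Robj A u P)"
      using twist_cochain[OF c, of u "Ident U V" V P] by (simp add: rules)
    have e: "coherence_defect m f c u (Ident U V) (Ident U V) P = \<zero>\<^bsub>Hom V (Robj A u P) (Robj A u P)\<^esub>"
      using prestack_equationsD(4)[OF equations, of u "Ident U V" "Ident U V" P] by (simp add: rules)
    show ?thesis
      apply (insert e)
      apply (simp add: coherence_defect_def Let_def rules m_left m_right f_unit f_ident)
      apply (erule Hom_eq_from[OF sym])
      by ((rule combination_intros | rule combination_atom, simp add: rules; fail)+, (simp add: rules algebra_simps)+)
  qed
  show ?thesis
    unfolding unit_conditions_def by (simp add: m_left m_right f_unit f_ident c_right c_left)
qed

end

context cohomologous
begin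

lemma prestack_equations_invariant:
  "prestack_equations m' f' c' \<longleftrightarrow> prestack_equations m f c"
  unfolding prestack_equations_def
  by (intro conj_cong all_cong1 imp_cong refl; elim conjE;
      simp add: associativity_defect_invariant functoriality_defect_invariant[OF _ refl refl]
        naturality_defect_invariant[OF _ _ refl refl _ refl] coherence_defect_invariant[OF _ _ _ refl refl refl _ refl])

end

context prestack_on_category
begin

text \<open>Let \<open>h\<^sub>P = m(1\<^sub>P, 1\<^sub>P)\<close> and let \<open>k\<^sub>P\<close> be the value of \<open>c\<close> at \<open>P\<close> on two identities. At identities, the components of
  \<open>d(g, t)\<close> that are compared with \<open>m\<close> and \<open>c\<close> are \<open>g(1)\<close> and \<open>t\<^bsup>1\<^esup> - g(1)\<close>. Therefore \<open>g(a) = a h\<close> and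
  \<open>t\<^bsup>u\<^esup> = k + h\<close>, taken at the restriction \<open>u\<^sup>* P\<close>, satisfy \<open>g(1) = h\<close> and \<open>t\<^bsup>1\<^esup> - g(1) = k\<close>.\<close>

lemma cocycle_normalization:
  assumes \<phi>: "\<phi> \<in> gs_cocycles K U A 2"
  shows "\<exists>\<phi>'\<in>gs_cocycles K U A 2. normalized_reduced U A 2 \<phi>' \<and> gs_class K U A 2 \<phi>' = gs_class K U A 2 \<phi>"
proof -
  have \<phi>C: "\<phi> \<in> carrier (gs_group K U A 2)" using \<phi> by (simp add: gs_cocycles_def kernel_def)
  interpret C2: comm_group "gs_group K U A 2" by (rule gs_group_comm_group)
  interpret old: two_cochain K U A "\<phi> 0" "\<phi> (Suc 0)" "\<phi> 2" using gs_group_2_two_cochain[OF \<phi>C] .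
  define h where "h X P = \<phi> 0 ((X, []), [P, P, P], [idm X P, idm X P])" for X P
  have h: "h X P \<in> Hom_set X P P" if "X \<in> Obj U" "P \<in> Objs X" for X P
    unfolding h_def using that by (simp add: old.two_cochain_rules)
  define k where "k X P = \<phi> 2 ((X, [Ident U X, Ident U X]), [P], [])" for X P
  have k: "k X P \<in> Hom_set X P P" if "X \<in> Obj U" "P \<in> Objs X" for X P
    unfolding k_def using that twist_cochain[OF old.c, of "Ident U X" "Ident U X" X P]
    by (simp add: category_rules restriction_Ident composite_single)
  define g where "g = (\<lambda>x\<in>cochain_index U A 0 1. case x of (\<sigma>, Ps, as) \<Rightarrow>
      cmp (fst \<sigma>) (Ps ! 0) (Ps ! 0) (Ps ! 1) (as ! 0) (h (fst \<sigma>) (Ps ! 0)))"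
  define t where "t = (\<lambda>x\<in>cochain_index U A 1 0. case x of (\<sigma>, Ps, as) \<Rightarrow>
      let V = fst \<sigma>; P = Robj A (hd (snd \<sigma>)) (Ps ! 0) in k V P \<oplus>\<^bsub>Hom V P P\<^esub> h V P)"
  have g_eq: "g ((X, []), [P, Q], [a]) = cmp X P P Q a (h X P)"
    if "X \<in> Obj U" "P \<in> Objs X" "Q \<in> Objs X" "a \<in> Hom_set X P Q" for X P Q a
    using that by (simp add: g_def index_1)
  have t_eq: "t ((V, [u]), [P], []) = k V (Robj A u P) \<oplus>\<^bsub>Hom V (Robj A u P) (Robj A u P)\<^esub> h V (Robj A u P)"
    if "u \<in> Arr U" "Dom U u = V" "P \<in> Objs (Cod U u)" for u V P
    using that by (simp add: t_def index_0 Cod_closed Let_def)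
  define \<psi> where "\<psi> = (\<lambda>p\<in>{..Suc 0}. if p = 0 then g else t)"
  have \<psi>_simps: "\<psi> 0 = g" "\<psi> (Suc 0) = t" by (simp_all add: \<psi>_def)
  have "g \<in> cochains K U A 0 1"
  proof (rule functor_cochainI)
    show "g \<in> extensional (cochain_index U A 0 1)" by (simp add: g_def)
  qed (rule linear_map_cong[OF Hom_linear_left]; simp add: g_eq h Hom_module)
  moreover have "t \<in> cochains K U A 1 0"
  proof (rule transformation_cochainI)
    show "t \<in> extensional (cochain_index U A 1 0)" by (simp add: t_def)
  qed (simp add: t_eq h k closure_rules)
  ultimately have \<psi>: "\<psi> \<in> carrier (gs_group K U A (Suc 0))"
    unfolding gs_group_carrier atMost_low by (auto simp: \<psi>_def PiE_iff atMost_low)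
  let ?b = "gs_differential U A (Suc 0) \<psi>"
  define \<phi>' where "\<phi>' = \<phi> \<otimes>\<^bsub>gs_group K U A 2\<^esub> inv\<^bsub>gs_group K U A 2\<^esub> ?b"
  have b: "?b \<in> carrier (gs_group K U A 2)" using differential_1_closed[OF \<psi>] .
  have \<phi>': "\<phi>' \<in> carrier (gs_group K U A 2)" unfolding \<phi>'_def using \<phi>C b by simp
  have \<phi>_eq: "\<phi> = \<phi>' \<otimes>\<^bsub>gs_group K U A 2\<^esub> ?b" unfolding \<phi>'_def using \<phi>C b by (simp add: C2.m_assoc)
  interpret cohomologous K U A "\<phi>' 0" "\<phi>' (Suc 0)" "\<phi>' 2" "\<psi> 0" "\<psi> (Suc 0)" "\<phi> 0" "\<phi> (Suc 0)" "\<phi> 2"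
    using add_coboundary_cohomologous[OF \<phi>' \<psi> \<phi>_eq] .
  have eqs: "prestack_equations (\<phi>' 0) (\<phi>' (Suc 0)) (\<phi>' 2)"
    using cocycle_iff[OF \<phi>C] \<phi> prestack_equations_invariant by simp
  then interpret two_cocycle K U A "\<phi>' 0" "\<phi>' (Suc 0)" "\<phi>' 2" by unfold_locales
  have "unit_conditions (\<phi>' 0) (\<phi>' (Suc 0)) (\<phi>' 2)"
  proof (rule normalized_if_units_vanish)
    fix X P assume [simp]: "X \<in> Obj U" "P \<in> Objs X"
    note rules = calculation_closed h k g_eq t_eq Hom_Id restriction_Ident composite_single Tw_Ident Rmor_Id
    have [simp]: "\<phi>' 2 ((X, [Ident U X, Ident U X]), [P], []) \<in> Hom_set X P P"
      using twist_cochain[OF c, of "Ident U X" "Ident U X" X P] by (simp add: rules)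
    have e: "h X P = \<phi>' 0 ((X, []), [P, P, P], [idm X P, idm X P]) \<oplus>\<^bsub>Hom X P P\<^esub>
       (h X P \<ominus>\<^bsub>Hom X P P\<^esub> h X P \<oplus>\<^bsub>Hom X P P\<^esub> h X P)"
      by (subst h_def, subst m'_cohomologous) (simp_all add: multiplication_coboundary_def \<psi>_simps rules)
    show "\<phi>' 0 ((X, []), [P, P, P], [idm X P, idm X P]) = \<zero>\<^bsub>Hom X P P\<^esub>"
      by (rule Hom_eq_from[OF e[symmetric]],
        (rule combination_intros | rule combination_atom, simp add: rules; fail)+, (simp add: rules algebra_simps)+)
    have e: "k X P = \<phi>' 2 ((X, [Ident U X, Ident U X]), [P], []) \<oplus>\<^bsub>Hom X P P\<^esub>
       (k X P \<oplus>\<^bsub>Hom X P P\<^esub> h X P \<ominus>\<^bsub>Hom X P P\<^esub> (k X P \<oplus>\<^bsub>Hom X P P\<^esub> h X P)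
        \<oplus>\<^bsub>Hom X P P\<^esub> (k X P \<oplus>\<^bsub>Hom X P P\<^esub> h X P) \<ominus>\<^bsub>Hom X P P\<^esub> h X P)"
      by (subst k_def, subst c'_cohomologous) (simp_all add: twist_coboundary_def Let_def \<psi>_simps rules)
    show "\<phi>' 2 ((X, [Ident U X, Ident U X]), [P], []) = \<zero>\<^bsub>Hom X P P\<^esub>"
      by (rule Hom_eq_from[OF e[symmetric]],
        (rule combination_intros | rule combination_atom, simp add: rules; fail)+, (simp add: rules algebra_simps)+)
  qed
  then have "normalized_reduced U A 2 \<phi>'" by (simp add: normalized_reduced_iff)
  moreover have "\<phi>' \<in> gs_cocycles K U A 2" using cocycle_iff[OF \<phi>'] eqs by simp
  moreover have "gs_class K U A 2 \<phi>' = gs_class K U A 2 \<phi>" using gs_class_eq_iff[OF \<phi>' \<phi>C] \<psi> \<phi>_eq by blast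
  ultimately show ?thesis by blast
qed

end

section \<open>Dual numbers\<close>

lemma dual_ring_simps:
  "carrier (dual_ring K) = carrier K \<times> carrier K"
  "(x, x') \<otimes>\<^bsub>dual_ring K\<^esub> (y, y') = (x \<otimes>\<^bsub>K\<^esub> y, x \<otimes>\<^bsub>K\<^esub> y' \<oplus>\<^bsub>K\<^esub> x' \<otimes>\<^bsub>K\<^esub> y)"
  "\<one>\<^bsub>dual_ring K\<^esub> = (\<one>\<^bsub>K\<^esub>, \<zero>\<^bsub>K\<^esub>)"
  "\<zero>\<^bsub>dual_ring K\<^esub> = (\<zero>\<^bsub>K\<^esub>, \<zero>\<^bsub>K\<^esub>)"
  "(x, x') \<oplus>\<^bsub>dual_ring K\<^esub> (y, y') = (x \<oplus>\<^bsub>K\<^esub> y, x' \<oplus>\<^bsub>K\<^esub> y')"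
  by (simp_all add: dual_ring_def)

lemma dual_module_simps:
  "carrier (dual_module M) = carrier M \<times> carrier M"
  "\<zero>\<^bsub>dual_module M\<^esub> = (\<zero>\<^bsub>M\<^esub>, \<zero>\<^bsub>M\<^esub>)"
  "(x, x') \<oplus>\<^bsub>dual_module M\<^esub> (y, y') = (x \<oplus>\<^bsub>M\<^esub> y, x' \<oplus>\<^bsub>M\<^esub> y')"
  "(s, s') \<odot>\<^bsub>dual_module M\<^esub> (x, x') = (s \<odot>\<^bsub>M\<^esub> x, s \<odot>\<^bsub>M\<^esub> x' \<oplus>\<^bsub>M\<^esub> s' \<odot>\<^bsub>M\<^esub> x)"
  by (simp_all add: dual_module_def)

lemma dual_ring_cring:
  assumes "cring K" shows "cring (dual_ring K)"
proof -
  interpret cring K by fact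
  show ?thesis
  proof (rule cringI)
    show "abelian_group (dual_ring K)"
    proof (rule abelian_groupI)
      fix x assume "x \<in> carrier (dual_ring K)"
      then show "\<exists>y\<in>carrier (dual_ring K). y \<oplus>\<^bsub>dual_ring K\<^esub> x = \<zero>\<^bsub>dual_ring K\<^esub>"
        by (intro bexI[of _ "(\<ominus>\<^bsub>K\<^esub> fst x, \<ominus>\<^bsub>K\<^esub> snd x)"]) (auto simp: dual_ring_simps l_neg)
    qed (auto simp: dual_ring_simps a_ac)
    show "comm_monoid (dual_ring K)"
      by (rule comm_monoidI) (auto simp: dual_ring_simps l_distr r_distr m_ac a_ac)
  qed (auto simp: dual_ring_simps l_distr a_ac)
qed

lemma dual_module_module:
  assumes "module K M" shows "module (dual_ring K) (dual_module M)"
proof -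
  interpret module K M by fact
  show ?thesis
  proof (rule moduleI)
    show "cring (dual_ring K)" by (rule dual_ring_cring) unfold_locales
    show "abelian_group (dual_module M)"
    proof (rule abelian_groupI)
      fix x assume "x \<in> carrier (dual_module M)"
      then show "\<exists>y\<in>carrier (dual_module M). y \<oplus>\<^bsub>dual_module M\<^esub> x = \<zero>\<^bsub>dual_module M\<^esub>"
        by (intro bexI[of _ "(\<ominus>\<^bsub>M\<^esub> fst x, \<ominus>\<^bsub>M\<^esub> snd x)"]) (auto simp: dual_module_simps M.l_neg)
    qed (auto simp: dual_module_simps M.a_ac)
  qed (auto simp: dual_module_simps dual_ring_simps smult_l_distr smult_r_distr smult_assoc1 M.a_ac)
qed

text \<open>The \<open>k[\<epsilon>]\<close>-linear extension of \<open>x \<mapsto> f x + (h x) \<epsilon>\<close>.\<close>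

lemma dual_linear_map:
  assumes f: "linear_map K M N f" and h: "linear_map K M N h" and "module K M" "module K N"
  shows "linear_map (dual_ring K) (dual_module M) (dual_module N) (\<lambda>(x, x'). (f x, f x' \<oplus>\<^bsub>N\<^esub> h x))"
proof -
  interpret M: module K M by fact
  interpret N: module K N by fact
  note closed = linear_map_closed[OF f] linear_map_closed[OF h]
  show ?thesis
    unfolding linear_map_def
    by (auto simp: dual_module_simps dual_ring_simps closed linear_map_add[OF f] linear_map_add[OF h]
      linear_map_smult[OF f] linear_map_smult[OF h] N.smult_r_distr N.a_ac)
qed

lemma (in linear_category) iso_if_inverses:
  assumes "P \<in> Ob C" "Q \<in> Ob C" "f \<in> carrier (Mor C P Q)"
    and g: "g \<in> carrier (Mor C Q P)" "Comp C P Q P g f = Id C P"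
    and h: "h \<in> carrier (Mor C Q P)" "Comp C Q P Q f h = Id C Q"
  shows "is_iso C P Q f"
proof -
  have "g = Comp C Q Q P g (Comp C Q P Q f h)" using assms by (simp add: Comp_Id_right)
  also have "\<dots> = Comp C Q P P (Comp C P Q P g f) h" using assms by (intro Comp_assoc[symmetric])
  also have "\<dots> = h" using assms by (simp add: Comp_Id_left)
  finally show ?thesis using assms unfolding is_iso_def by blast
qed

section \<open>First order deformations\<close>

lemma deformed_simps:
  "Ob (Fib (deformed U A (m, f, c)) X) = Ob (Fib A X)"
  "Mor (Fib (deformed U A (m, f, c)) X) P Q = dual_module (Mor (Fib A X) P Q)"
  "Id (Fib (deformed U A (m, f, c)) X) P = (Id (Fib A X) P, \<zero>\<^bsub>Mor (Fib A X) P P\<^esub>)"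
  "Comp (Fib (deformed U A (m, f, c)) X) P Q R (b, b') (a, a') =
     (Comp (Fib A X) P Q R b a,
      Comp (Fib A X) P Q R b a' \<oplus>\<^bsub>Mor (Fib A X) P R\<^esub> Comp (Fib A X) P Q R b' a
        \<oplus>\<^bsub>Mor (Fib A X) P R\<^esub> m ((X, []), [P, Q, R], [b, a]))"
  "Robj (deformed U A (m, f, c)) = Robj A"
  "Rmor (deformed U A (m, f, c)) u P Q (a, a') =
     (Rmor A u P Q a, Rmor A u P Q a' \<oplus>\<^bsub>Mor (Fib A (Dom U u)) (Robj A u P) (Robj A u Q)\<^esub> f ((Dom U u, [u]), [P, Q], [a]))"
  "Tw (deformed U A (m, f, c)) u v P = (Tw A u v P, c ((Dom U v, [v, u]), [P], []))"
  by (simp_all add: deformed_def Let_def)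

context two_cochain
begin

abbreviation D where "D \<equiv> deformed U A (m, f, c)"

lemma deformation_Comp_linear:
  assumes [simp]: "X \<in> Obj U" "P \<in> Objs X" "Q \<in> Objs X" "R \<in> Objs X"
  shows "b \<in> carrier (dual_module (Hom X Q R)) \<Longrightarrow>
      linear_map (dual_ring K) (dual_module (Hom X P Q)) (dual_module (Hom X P R)) (\<lambda>a. Comp (Fib D X) P Q R b a)"
    and "a \<in> carrier (dual_module (Hom X P Q)) \<Longrightarrow>
      linear_map (dual_ring K) (dual_module (Hom X Q R)) (dual_module (Hom X P R)) (\<lambda>b. Comp (Fib D X) P Q R b a)"
proof -
  interpret M: abelian_group "Hom X P R" by (rule Hom_abelian_group) simp_all
  assume "b \<in> carrier (dual_module (Hom X Q R))"
  then obtain b0 b1 where b [simp]: "b = (b0, b1)" "b0 \<in> Hom_set X Q R" "b1 \<in> Hom_set X Q R"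
    by (auto simp: dual_module_simps)
  show "linear_map (dual_ring K) (dual_module (Hom X P Q)) (dual_module (Hom X P R)) (\<lambda>a. Comp (Fib D X) P Q R b a)"
  proof (rule linear_map_cong[OF dual_linear_map[OF Hom_linear_right linear_map_plus[OF Hom_linear_right m_linear_right]]])
    show "module (dual_ring K) (dual_module (Hom X P Q))" by (simp add: dual_module_module Hom_module)
    fix a assume "a \<in> carrier (dual_module (Hom X P Q))"
    then show "Comp (Fib D X) P Q R b a = (case a of (x, x') \<Rightarrow> (cmp X P Q R b0 x, cmp X P Q R b0 x'
        \<oplus>\<^bsub>Hom X P R\<^esub> (cmp X P Q R b1 x \<oplus>\<^bsub>Hom X P R\<^esub> m ((X, []), [P, Q, R], [b0, x]))))"
      by (auto simp: deformed_simps dual_module_simps two_cochain_rules M.a_assoc)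
  qed (simp_all add: Hom_module)
next
  interpret M: abelian_group "Hom X P R" by (rule Hom_abelian_group) simp_all
  assume "a \<in> carrier (dual_module (Hom X P Q))"
  then obtain a0 a1 where a [simp]: "a = (a0, a1)" "a0 \<in> Hom_set X P Q" "a1 \<in> Hom_set X P Q"
    by (auto simp: dual_module_simps)
  show "linear_map (dual_ring K) (dual_module (Hom X Q R)) (dual_module (Hom X P R)) (\<lambda>b. Comp (Fib D X) P Q R b a)"
  proof (rule linear_map_cong[OF dual_linear_map[OF Hom_linear_left linear_map_plus[OF Hom_linear_left m_linear_left]]])
    show "module (dual_ring K) (dual_module (Hom X Q R))" by (simp add: dual_module_module Hom_module)
    fix b assume "b \<in> carrier (dual_module (Hom X Q R))"
    then show "Comp (Fib D X) P Q R b a = (case b of (x, x') \<Rightarrow> (cmp X P Q R x a0, cmp X P Q R x' a0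
        \<oplus>\<^bsub>Hom X P R\<^esub> (cmp X P Q R x a1 \<oplus>\<^bsub>Hom X P R\<^esub> m ((X, []), [P, Q, R], [x, a0]))))"
      by (auto simp: deformed_simps dual_module_simps two_cochain_rules M.a_ac)
  qed (simp_all add: Hom_module)
qed

context
  assumes equations: "prestack_equations m f c" and units: "unit_conditions m f c"
begin

lemmas D_rules = two_cochain_rules deformed_simps dual_module_simps Hom_Id Hom_zero Hom_distrib Rmor_functor Rmor_distrib
  two_cochain_distrib Hom_assoc restriction_Ident unit_conditionsD[OF units] Tw_Ident

lemma deformation_linear_category:
  assumes [simp]: "X \<in> Obj U"
  shows "linear_category (dual_ring K) (Fib D X)"
proof (rule linear_category.intro, goal_cases)
  case (1 P Q)
  then show ?case by (simp add: deformed_simps dual_module_module Hom_module)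
next
  case (2 P)
  then show ?case by (simp add: D_rules)
next
  case (3 P Q R g)
  then show ?case unfolding deformed_simps(1,2) by (intro deformation_Comp_linear(1)) simp_all
next
  case (4 P Q R h)
  then show ?case unfolding deformed_simps(1,2) by (intro deformation_Comp_linear(2)) simp_all
next
  case (5 P Q h)
  then show ?case by (auto simp: D_rules)
next
  case (6 P Q h)
  then show ?case by (auto simp: D_rules)
next
  case (7 P Q R S h0 h1 h2)
  then have [simp]: "P \<in> Objs X" "Q \<in> Objs X" "R \<in> Objs X" "S \<in> Objs X" by (simp_all add: deformed_simps)
  obtain a a' b b' h h' where [simp]: "h0 = (a, a')" "h1 = (b, b')" "h2 = (h, h')"
    "a \<in> Hom_set X P Q" "a' \<in> Hom_set X P Q" "b \<in> Hom_set X Q R" "b' \<in> Hom_set X Q R" "h \<in> Hom_set X R S" "h' \<in> Hom_set X R S"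
    using 7 by (auto simp: deformed_simps dual_module_simps)
  have e: "associativity_defect m X P Q R S h b a = \<zero>\<^bsub>Hom X P S\<^esub>"
    by (rule prestack_equationsD[OF equations]) simp_all
  show ?case
    apply (simp add: D_rules)
    apply (rule Hom_eq_from[OF e[unfolded associativity_defect_def, symmetric]])
    by ((rule combination_intros | rule combination_atom, simp add: D_rules; fail)+, (simp add: D_rules algebra_simps)+)
qed

lemma deformation_restriction_functor:
  assumes [simp]: "u \<in> Arr U"
  shows "linear_functor (dual_ring K) (Fib D (Cod U u)) (Fib D (Dom U u)) (Robj D u) (Rmor D u)"
proof -
  define V X where VX: "V = Dom U u" "X = Cod U u"
  have [simp]: "V \<in> Obj U" "X \<in> Obj U" "Dom U u = V" "Cod U u = X" by (simp_all add: VX closure_rules)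
  have "linear_functor (dual_ring K) (Fib D X) (Fib D V) (Robj D u) (Rmor D u)"
  proof (rule linear_functor.intro, goal_cases)
    case (1 P)
    then show ?case by (simp add: deformed_simps Robj_closed)
  next
    case (2 P Q)
    then have [simp]: "P \<in> Objs X" "Q \<in> Objs X" by (simp_all add: deformed_simps)
    show ?case
      unfolding deformed_simps
      by (rule linear_map_cong[OF dual_linear_map[OF Rmor_linear[of u V X P Q] f_linear[of u V X P Q]]])
        (auto simp: D_rules Hom_module dual_module_module)
  next
    case (3 P)
    then show ?case by (simp add: D_rules)
  next
    case (4 P Q R h0 h1)
    then have [simp]: "P \<in> Objs X" "Q \<in> Objs X" "R \<in> Objs X" by (simp_all add: deformed_simps)
    obtain a a' b b' where [simp]: "h0 = (a, a')" "h1 = (b, b')"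
      "a \<in> Hom_set X P Q" "a' \<in> Hom_set X P Q" "b \<in> Hom_set X Q R" "b' \<in> Hom_set X Q R"
      using 4 by (auto simp: deformed_simps dual_module_simps)
    have e: "functoriality_defect m f u P Q R b a = \<zero>\<^bsub>Hom V (Robj A u P) (Robj A u R)\<^esub>"
      using prestack_equationsD(2)[OF equations, of u P Q R b a] by simp
    show ?case
      apply (simp add: D_rules)
      apply (rule Hom_eq_from[OF e[unfolded functoriality_defect_def Let_def, simplified, symmetric]])
      by ((rule combination_intros | rule combination_atom, simp add: D_rules; fail)+, (simp add: D_rules algebra_simps)+)
  qed
  then show ?thesis by simp
qed

text \<open>If \<open>x\<close> is inverse to the twist \<open>w\<close>, then \<open>x - (x c + m(x, w)) x \<epsilon>\<close> is a left inverse of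
  \<open>w + c \<epsilon>\<close> and \<open>x - x (c x + m(w, x)) \<epsilon>\<close> is a right inverse. The two agree because the deformed
  composition is associative.\<close>

lemma deformation_Tw_iso:
  assumes [simp]: "u \<in> Arr U" "v \<in> Arr U" "Cod U v = Dom U u" "P \<in> Objs (Cod U u)"
  shows "is_iso (Fib D (Dom U v)) (Robj D v (Robj D u P)) (Robj D (Cmp U u v) P) (Tw D u v P)"
proof -
  define W where "W = Dom U v"
  have [simp]: "Dom U v = W" "W \<in> Obj U" by (simp_all add: W_def closure_rules)
  let ?src = "Robj A v (Robj A u P)" and ?tgt = "Robj A (Cmp U u v) P"
  interpret D: linear_category "dual_ring K" "Fib D W" by (rule deformation_linear_category) simp
  have [simp]: "?src \<in> Objs W" "?tgt \<in> Objs W" by (simp_all add: closure_rules)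
  obtain x where [simp]: "x \<in> Hom_set W ?tgt ?src" and x: "cmp W ?src ?tgt ?src x (Tw A u v P) = idm W ?src"
      "cmp W ?tgt ?src ?tgt (Tw A u v P) x = idm W ?tgt"
    using Tw_iso[of u v P] unfolding is_iso_def by auto
  let ?c = "c ((W, [v, u]), [P], [])"
  define y where "y = \<ominus>\<^bsub>Hom W ?tgt ?src\<^esub> cmp W ?tgt ?src ?src
      (cmp W ?src ?tgt ?src x ?c \<oplus>\<^bsub>Hom W ?src ?src\<^esub> m ((W, []), [?src, ?tgt, ?src], [x, Tw A u v P])) x"
  define z where "z = \<ominus>\<^bsub>Hom W ?tgt ?src\<^esub> cmp W ?tgt ?tgt ?src x
      (cmp W ?tgt ?src ?tgt ?c x \<oplus>\<^bsub>Hom W ?tgt ?tgt\<^esub> m ((W, []), [?tgt, ?src, ?tgt], [Tw A u v P, x]))"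
  have [simp]: "y \<in> Hom_set W ?tgt ?src" "z \<in> Hom_set W ?tgt ?src" by (simp_all add: y_def z_def D_rules)
  have "is_iso (Fib D W) ?src ?tgt (Tw A u v P, ?c)"
  proof (rule D.iso_if_inverses[of _ _ _ "(x, y)" "(x, z)"])
    have "cmp W ?src ?tgt ?src y (Tw A u v P) = \<ominus>\<^bsub>Hom W ?src ?src\<^esub>
      (cmp W ?src ?tgt ?src x ?c \<oplus>\<^bsub>Hom W ?src ?src\<^esub> m ((W, []), [?src, ?tgt, ?src], [x, Tw A u v P]))"
      by (simp add: y_def D_rules x)
    then show "Comp (Fib D W) ?src ?tgt ?src (x, y) (Tw A u v P, ?c) = Id (Fib D W) ?src"
      apply (simp add: deformed_simps x)
      by (rule Hom_eqI, (rule combination_intros | rule combination_atom, simp add: D_rules; fail)+,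
          (simp add: D_rules algebra_simps)+)
    have "cmp W ?tgt ?src ?tgt (Tw A u v P) z = \<ominus>\<^bsub>Hom W ?tgt ?tgt\<^esub>
      (cmp W ?tgt ?src ?tgt ?c x \<oplus>\<^bsub>Hom W ?tgt ?tgt\<^esub> m ((W, []), [?tgt, ?src, ?tgt], [Tw A u v P, x]))"
      by (simp add: z_def D_rules x Hom_assoc[symmetric] del: Hom_assoc)
    then show "Comp (Fib D W) ?tgt ?src ?tgt (Tw A u v P, ?c) (x, z) = Id (Fib D W) ?tgt"
      apply (simp add: deformed_simps x)
      by (rule Hom_eqI, (rule combination_intros | rule combination_atom, simp add: D_rules; fail)+,
          (simp add: D_rules algebra_simps)+)
  qed (simp_all add: D_rules)
  then show ?thesis by (simp add: deformed_simps)
qed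

lemma deformation_prestack: "prestack (dual_ring K) U D"
proof (rule prestack.intro, goal_cases)
  case (1 X)
  then show ?case by (rule deformation_linear_category)
next
  case (2 u)
  then show ?case by (rule deformation_restriction_functor)
next
  case (5 u v P)
  then show ?case by (intro deformation_Tw_iso) (simp_all add: deformed_simps)
next
  case (6 u v P Q a)
  define V X W where VX: "V = Dom U u" "X = Cod U u" "W = Dom U v"
  have [simp]: "V \<in> Obj U" "X \<in> Obj U" "W \<in> Obj U" "Dom U u = V" "Cod U u = X" "Dom U v = W" "Cod U v = V"
    "u \<in> Arr U" "v \<in> Arr U" "P \<in> Objs X" "Q \<in> Objs X"
    using 6 by (simp_all add: VX closure_rules deformed_simps)
  obtain b b' where [simp]: "a = (b, b')" "b \<in> Hom_set X P Q" "b' \<in> Hom_set X P Q"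
    using 6 by (auto simp: deformed_simps dual_module_simps)
  have e: "naturality_defect m f c u v P Q b = \<zero>\<^bsub>Hom W (Robj A v (Robj A u P)) (Robj A (Cmp U u v) Q)\<^esub>"
    using prestack_equationsD(3)[OF equations, of u v P Q b] by simp
  show ?case
    \<comment> \<open>the terms in \<open>b'\<close> cancel by naturality of the twists of \<open>A\<close>\<close>
    apply (simp add: D_rules Tw_natural_square)
    apply (rule Hom_eq_from[OF e[unfolded naturality_defect_def Let_def, simplified]])
    by ((rule combination_intros | rule combination_atom, simp add: D_rules; fail)+, (simp add: D_rules algebra_simps)+)
next
  case (9 u v w P)
  define V X W T where VX: "V = Dom U u" "X = Cod U u" "W = Dom U v" "T = Dom U w"
  have [simp]: "V \<in> Obj U" "X \<in> Obj U" "W \<in> Obj U" "T \<in> Obj U" "Dom U u = V" "Cod U u = X" "Dom U v = W" "Cod U v = V" "Dom U w = T" "Cod U w = W"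
    "u \<in> Arr U" "v \<in> Arr U" "w \<in> Arr U" "P \<in> Objs X"
    using 9 by (simp_all add: VX closure_rules deformed_simps)
  note [simp] = triple_composite[of u v w T P, simplified]
  have e: "coherence_defect m f c u v w P = \<zero>\<^bsub>Hom T (Robj A w (Robj A v (Robj A u P))) (Robj A (Cmp U u (Cmp U v w)) P)\<^esub>"
    using prestack_equationsD(4)[OF equations, of u v w P] by simp
  show ?case
    apply (simp add: D_rules Tw_coherence_square)
    apply (rule Hom_eq_from[OF e[unfolded coherence_defect_def Let_def, simplified]])
    by ((rule combination_intros | rule combination_atom, simp add: D_rules; fail)+, (simp add: D_rules algebra_simps)+)
qed (auto simp: D_rules)

end

text \<open>Each equation is the coefficient of \<open>\<epsilon>\<close> in the corresponding axiom, applied to morphisms of the form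
  \<open>a + 0 \<epsilon>\<close>.\<close>

lemma deformation_equations:
  assumes D: "prestack (dual_ring K) U D"
  shows "prestack_equations m f c" and "unit_conditions m f c"
proof -
  interpret D: prestack "dual_ring K" U D by fact
  note rules = two_cochain_rules deformed_simps dual_module_simps Hom_Id Hom_zero Hom_distrib Rmor_functor Rmor_distrib
    two_cochain_distrib Hom_assoc restriction_Ident Tw_Ident Tw_natural_square Tw_coherence_square
  show "unit_conditions m f c"
    unfolding unit_conditions_def
  proof ((intro conjI allI impI; elim conjE), goal_cases)
    case (1 X P Q a)
    then show ?case
      using linear_category.Comp_Id_right[OF D.Fib_linear_category, of X P Q "(a, \<zero>\<^bsub>Hom X P Q\<^esub>)"] by (simp add: rules)
  next
    case (2 X P Q a)
    then show ?case
      using linear_category.Comp_Id_left[OF D.Fib_linear_category, of X P Q "(a, \<zero>\<^bsub>Hom X P Q\<^esub>)"] by (simp add: rules)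
  next
    case (3 X P Q a)
    then show ?case
      using D.Rmor_Ident[of X P Q "(a, \<zero>\<^bsub>Hom X P Q\<^esub>)"] f_closed[of "Ident U X" X P Q a] by (simp add: rules)
  next
    case (4 u P)
    then show ?case
      using linear_functor.fm_Id[OF D.restriction_functor, of u P] by (simp add: rules)
  next
    case (5 u P)
    then show ?case using D.Tw_Ident_left[of u P] by (simp add: rules)
  next
    case (6 u P)
    then show ?case using D.Tw_Ident_right[of u P] by (simp add: rules)
  qed
  show "prestack_equations m f c"
    unfolding prestack_equations_def
  proof ((intro conjI allI impI; elim conjE), goal_cases)
    case [simp]: (1 X P0 P1 P2 P3 a1 a2 a3)
    show ?case
      unfolding associativity_defect_def
      using linear_category.Comp_assoc[OF D.Fib_linear_category, of X P0 P1 P2 P3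
          "(a3, \<zero>\<^bsub>Hom X P0 P1\<^esub>)" "(a2, \<zero>\<^bsub>Hom X P1 P2\<^esub>)" "(a1, \<zero>\<^bsub>Hom X P2 P3\<^esub>)"]
      apply (simp add: rules)
      apply (erule Hom_eq_from[OF sym])
      by ((rule combination_intros | rule combination_atom, simp add: rules; fail)+, (simp add: rules algebra_simps)+)
  next
    case (2 u P0 P1 P2 a1 a2)
    define V X where VX: "V = Dom U u" "X = Cod U u"
    have [simp]: "V \<in> Obj U" "X \<in> Obj U" "Dom U u = V" "Cod U u = X" "u \<in> Arr U"
      "P0 \<in> Objs X" "P1 \<in> Objs X" "P2 \<in> Objs X" "a1 \<in> Hom_set X P1 P2" "a2 \<in> Hom_set X P0 P1"
      using 2 by (simp_all add: VX closure_rules)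
    show ?case
      unfolding functoriality_defect_def Let_def
      using linear_functor.fm_Comp[OF D.restriction_functor, of u P0 P1 P2 "(a2, \<zero>\<^bsub>Hom X P0 P1\<^esub>)" "(a1, \<zero>\<^bsub>Hom X P1 P2\<^esub>)"]
      apply (simp add: rules)
      apply (erule Hom_eq_from[OF sym])
      by ((rule combination_intros | rule combination_atom, simp add: rules; fail)+, (simp add: rules algebra_simps)+)
  next
    case (3 u v P Q a)
    define V X W where VX: "V = Dom U u" "X = Cod U u" "W = Dom U v"
    have [simp]: "V \<in> Obj U" "X \<in> Obj U" "W \<in> Obj U" "Dom U u = V" "Cod U u = X" "Dom U v = W" "Cod U v = V"
        "u \<in> Arr U" "v \<in> Arr U" "P \<in> Objs X" "Q \<in> Objs X" "a \<in> Hom_set X P Q"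
      using 3 by (simp_all add: VX closure_rules)
    show ?case
      unfolding naturality_defect_def Let_def
      using D.Tw_natural[of u v P Q "(a, \<zero>\<^bsub>Hom X P Q\<^esub>)"]
      apply (simp add: rules)
      apply (erule Hom_eq_from)
      by ((rule combination_intros | rule combination_atom, simp add: rules; fail)+, (simp add: rules algebra_simps)+)
  next
    case (4 u v w P)
    define V X W T where VX: "V = Dom U u" "X = Cod U u" "W = Dom U v" "T = Dom U w"
    have [simp]: "V \<in> Obj U" "X \<in> Obj U" "W \<in> Obj U" "T \<in> Obj U" "Dom U u = V" "Cod U u = X" "Dom U v = W" "Cod U v = V" "Dom U w = T" "Cod U w = W"
        "u \<in> Arr U" "v \<in> Arr U" "w \<in> Arr U" "P \<in> Objs X"
      using 4 by (simp_all add: VX closure_rules)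
    note [simp] = triple_composite[of u v w T P, simplified]
    show ?case
      unfolding coherence_defect_def Let_def
      using D.Tw_coherence[of u v w P]
      apply (simp add: rules)
      apply (erule Hom_eq_from)
      by ((rule combination_intros | rule combination_atom, simp add: rules; fail)+, (simp add: rules algebra_simps)+)
  qed
qed

end

section \<open>Equivalences of deformations\<close>

text \<open>The morphisms in question go from the deformation by \<open>(m, f, c)\<close> to the one by \<open>(m', f', c')\<close> and have the form
  \<open>(1 + g\<epsilon>, 1 + s\<epsilon>)\<close>. With \<open>s = - t\<close> the conditions on them become \<open>(m, f, c) = (m', f', c') + d(g, t)\<close>; the sign
  comes from naturality of \<open>1 + s\<epsilon>\<close>, which gives \<open>f(a) + g(u\<^sup>* a) + (u\<^sup>* a) s = f'(a) + u\<^sup>* g(a) + s (u\<^sup>* a)\<close>. Both \<open>t\<close>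
  and \<open>s\<close> are parameters because either of them can be the given cochain.\<close>

locale pair_of_deformations =
  two_cochain K U A m f c + second: two_cochain K U A m' f' c' + one_cochain K U A g t
  for K :: "('k, 'z) ring_scheme" and U :: "('o, 'u) cat" and A :: "('o, 'u, 'a, 'm, 'k) prestack_data" and m f c m' f' c' g t +
  fixes s :: "('o, 'u, 'a, 'm) cochain"
  assumes unit: "unit_conditions m f c" and unit': "unit_conditions m' f' c'"
    and s_eq: "\<lbrakk>u \<in> Arr U; Dom U u = V; P \<in> Objs (Cod U u)\<rbrakk>
      \<Longrightarrow> s ((V, [u]), [P], []) = \<ominus>\<^bsub>Hom V (Robj A u P) (Robj A u P)\<^esub> t ((V, [u]), [P], [])"
begin

abbreviation functor_part where
  "functor_part \<equiv> (\<lambda>X P Q (a, a'). (a, a' \<oplus>\<^bsub>Hom X P Q\<^esub> g ((X, []), [P, Q], [a])))"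

abbreviation transformation_part where
  "transformation_part \<equiv> (\<lambda>u P. (idm (Dom U u) (Robj A u P), s ((Dom U u, [u]), [P], [])))"

abbreviation is_morphism where
  "is_morphism \<equiv> prestack_morphism (dual_ring K) U D second.D (\<lambda>X P. P) functor_part transformation_part"

lemmas pair_rules = two_cochain_rules second.two_cochain_closed one_cochain_closed deformed_simps dual_module_simps
  Hom_Id Hom_zero Hom_distrib Rmor_functor Rmor_distrib
  two_cochain_distrib second.two_cochain_distrib one_cochain_distrib Hom_assoc restriction_Ident Tw_Ident Tw_natural_square Tw_coherence_square
  unit_conditionsD[OF unit] unit_conditionsD[OF unit'] s_eq

lemma morphism_cohomologous:
  assumes is_morphism
  shows "cohomologous K U A m' f' c' g t m f c"
proof -
  interpret F: prestack_morphism "dual_ring K" U D second.D "\<lambda>X P. P" functor_part transformation_part by fact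
  show ?thesis
  proof
    fix X P Q R b a assume [simp]: "X \<in> Obj U" "P \<in> Objs X" "Q \<in> Objs X" "R \<in> Objs X" "b \<in> Hom_set X Q R" "a \<in> Hom_set X P Q"
    show "m ((X, []), [P, Q, R], [b, a]) = m' ((X, []), [P, Q, R], [b, a]) \<oplus>\<^bsub>Hom X P R\<^esub> multiplication_coboundary g X P Q R b a"
      unfolding multiplication_coboundary_def
      using linear_functor.fm_Comp[OF F.g_functor, of X P Q R "(a, \<zero>\<^bsub>Hom X P Q\<^esub>)" "(b, \<zero>\<^bsub>Hom X Q R\<^esub>)"]
      apply (simp add: pair_rules)
      apply (erule Hom_eq_from)
      by ((rule combination_intros | rule combination_atom, simp add: pair_rules; fail)+, (simp add: pair_rules algebra_simps)+)
  next
    fix u V X P Q a assume [simp]: "u \<in> Arr U" "Dom U u = V" "Cod U u = X" "P \<in> Objs X" "Q \<in> Objs X" "a \<in> Hom_set X P Q"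
    have [simp]: "V \<in> Obj U" "X \<in> Obj U" using Dom_closed[of u] Cod_closed[of u] by simp_all
    show "f ((V, [u]), [P, Q], [a]) = f' ((V, [u]), [P, Q], [a]) \<oplus>\<^bsub>Hom V (Robj A u P) (Robj A u Q)\<^esub> restriction_coboundary g t u P Q a"
      unfolding restriction_coboundary_def Let_def
      using F.t_natural[of u P Q "(a, \<zero>\<^bsub>Hom X P Q\<^esub>)"]
      apply (simp add: pair_rules)
      apply (erule Hom_eq_from)
      by ((rule combination_intros | rule combination_atom, simp add: pair_rules; fail)+, (simp add: pair_rules algebra_simps)+)
  next
    fix u v W P assume [simp]: "u \<in> Arr U" "v \<in> Arr U" and uv: "Cod U v = Dom U u" and [simp]: "Dom U v = W" and P: "P \<in> Objs (Cod U u)"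
    define V X where VX: "V = Dom U u" "X = Cod U u"
    have [simp]: "V \<in> Obj U" "X \<in> Obj U" "W \<in> Obj U" "Dom U u = V" "Cod U u = X" "Cod U v = V" "P \<in> Objs X"
      using uv P Dom_closed[of v] by (simp_all add: VX closure_rules)
    show "c ((W, [v, u]), [P], []) = c' ((W, [v, u]), [P], []) \<oplus>\<^bsub>Hom W (Robj A v (Robj A u P)) (Robj A (Cmp U u v) P)\<^esub> twist_coboundary g t u v P"
      unfolding twist_coboundary_def Let_def
      using F.t_coherence[of u v P]
      apply (simp add: pair_rules)
      apply (erule Hom_eq_from[OF sym])
      by ((rule combination_intros | rule combination_atom, simp add: pair_rules; fail)+, (simp add: pair_rules algebra_simps)+)
  qed
qed

text \<open>On identities \<open>m\<close>, \<open>m'\<close>, \<open>c\<close> and \<open>c'\<close> vanish, while the coboundary terms are \<open>g(1)\<close> and \<open>t\<^bsup>1\<^esup> - g(1)\<close>.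
  So \<open>1 + g\<epsilon>\<close> preserves identities and \<open>1 - t\<epsilon>\<close> is the identity at identity arrows.\<close>

lemma cohomologous_units:
  assumes "cohomologous K U A m' f' c' g t m f c"
  shows "\<lbrakk>X \<in> Obj U; P \<in> Objs X\<rbrakk> \<Longrightarrow> g ((X, []), [P, P], [idm X P]) = \<zero>\<^bsub>Hom X P P\<^esub>"
    and "\<lbrakk>X \<in> Obj U; P \<in> Objs X\<rbrakk> \<Longrightarrow> t ((X, [Ident U X]), [P], []) = \<zero>\<^bsub>Hom X P P\<^esub>"
proof -
  interpret C: cohomologous K U A m' f' c' g t m f c by fact
  assume [simp]: "X \<in> Obj U" "P \<in> Objs X"
  have e: "m ((X, []), [P, P, P], [idm X P, idm X P]) = m' ((X, []), [P, P, P], [idm X P, idm X P])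
      \<oplus>\<^bsub>Hom X P P\<^esub> multiplication_coboundary g X P P P (idm X P) (idm X P)"
    by (rule C.m'_cohomologous) (simp_all add: pair_rules)
  show g1: "g ((X, []), [P, P], [idm X P]) = \<zero>\<^bsub>Hom X P P\<^esub>"
    apply (insert e)
    apply (simp (no_asm_use) add: pair_rules multiplication_coboundary_def)
    apply (erule Hom_eq_from[OF sym])
    by ((rule combination_intros | rule combination_atom, simp add: pair_rules; fail)+, (simp add: pair_rules algebra_simps)+)
  have [simp]: "t ((X, [Ident U X]), [P], []) \<in> Hom_set X P P"
    using transformation_cochain[OF t, of "Ident U X" X P] by (simp add: pair_rules)
  have e: "c ((X, [Ident U X, Ident U X]), [P], []) = c' ((X, [Ident U X, Ident U X]), [P], [])
      \<oplus>\<^bsub>Hom X P P\<^esub> twist_coboundary g t (Ident U X) (Ident U X) P"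
    using C.c'_cohomologous[of "Ident U X" "Ident U X" X P] by (simp add: pair_rules composite_single)
  show "t ((X, [Ident U X]), [P], []) = \<zero>\<^bsub>Hom X P P\<^esub>"
    apply (insert e unit_conditionsD(5)[OF unit, of "Ident U X" X X P] unit_conditionsD(5)[OF unit', of "Ident U X" X X P])
    apply (simp (no_asm_use) add: pair_rules twist_coboundary_def Let_def composite_single g1)
    apply (erule Hom_eq_from[OF sym])
    by ((rule combination_intros | rule combination_atom, simp add: pair_rules; fail)+, (simp add: pair_rules algebra_simps)+)
qed

lemma cohomologous_morphism:
  assumes coh: "cohomologous K U A m' f' c' g t m f c"
  shows is_morphism
proof -
  interpret C: cohomologous K U A m' f' c' g t m f c by fact
  note rules = pair_rules cohomologous_units[OF coh]
  have fiberwise: "linear_functor (dual_ring K) (Fib D X) (Fib second.D X) (\<lambda>P. P) (functor_part X)" if [simp]: "X \<in> Obj U" for X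
  proof (rule linear_functor.intro, goal_cases)
    case (1 P)
    then show ?case by (simp add: deformed_simps)
  next
    case (2 P Q)
    then show ?case
      unfolding deformed_simps by (intro dual_linear_map linear_map_ident g_linear) (simp_all add: Hom_module)
  next
    case (3 P)
    then show ?case by (simp add: rules)
  next
    case (4 P Q R h0 h1)
    then have [simp]: "P \<in> Objs X" "Q \<in> Objs X" "R \<in> Objs X" by (simp_all add: deformed_simps)
    obtain a a' b b' where [simp]: "h0 = (a, a')" "h1 = (b, b')"
      "a \<in> Hom_set X P Q" "a' \<in> Hom_set X P Q" "b \<in> Hom_set X Q R" "b' \<in> Hom_set X Q R"
      using 4 by (auto simp: deformed_simps dual_module_simps)
    show ?case
      apply (simp add: rules C.m'_cohomologous multiplication_coboundary_def)
      by (rule Hom_eqI, (rule combination_intros | rule combination_atom, simp add: rules; fail)+,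
          (simp add: rules algebra_simps)+)
  qed
  show ?thesis
  proof (rule prestack_morphism.intro, goal_cases)
    case (1 X)
    then show ?case by (rule fiberwise)
  next
    case (2 u P)
    then show ?case by (simp add: rules)
  next
    case (3 u P Q a)
    define V X where VX: "V = Dom U u" "X = Cod U u"
    have [simp]: "u \<in> Arr U" "V \<in> Obj U" "X \<in> Obj U" "Dom U u = V" "Cod U u = X" "P \<in> Objs X" "Q \<in> Objs X"
      using 3 by (simp_all add: VX closure_rules deformed_simps)
    obtain b b' where [simp]: "a = (b, b')" "b \<in> Hom_set X P Q" "b' \<in> Hom_set X P Q"
      using 3 by (auto simp: deformed_simps dual_module_simps)
    show ?case
      apply (simp add: rules C.f'_cohomologous restriction_coboundary_def Let_def)
      by (rule Hom_eqI, (rule combination_intros | rule combination_atom, simp add: rules; fail)+,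
          (simp add: rules algebra_simps)+)
  next
    case (4 u v P)
    define V X W where VX: "V = Dom U u" "X = Cod U u" "W = Dom U v"
    have [simp]: "u \<in> Arr U" "v \<in> Arr U" "V \<in> Obj U" "X \<in> Obj U" "W \<in> Obj U" "Dom U u = V" "Cod U u = X" "Cod U v = V" "Dom U v = W"
      "P \<in> Objs X"
      using 4 by (simp_all add: VX closure_rules deformed_simps)
    show ?case
      apply (simp add: rules C.c'_cohomologous twist_coboundary_def Let_def)
      by (rule Hom_eqI, (rule combination_intros | rule combination_atom, simp add: rules; fail)+,
          (simp add: rules algebra_simps)+)
  next
    case (5 X P)
    then show ?case using s_eq[of "Ident U X" X P] by (simp add: rules)
  qed
qed

lemma composite_with_inverse:
  assumes coh: "cohomologous K U A m' f' c' g t m f c"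
    and h: "\<And>X P Q a. \<lbrakk>X \<in> Obj U; P \<in> Objs X; Q \<in> Objs X; a \<in> Hom_set X P Q\<rbrakk>
      \<Longrightarrow> h ((X, []), [P, Q], [a]) = \<ominus>\<^bsub>Hom X P Q\<^esub> g ((X, []), [P, Q], [a])"
    and r: "\<And>u P. \<lbrakk>u \<in> Arr U; P \<in> Objs (Cod U u)\<rbrakk>
      \<Longrightarrow> r ((Dom U u, [u]), [P], []) = t ((Dom U u, [u]), [P], [])"
  shows "composite_is_identity U D second.D (\<lambda>X P. P) functor_part transformation_part
    (\<lambda>X P. P) (\<lambda>X P Q (a, a'). (a, a' \<oplus>\<^bsub>Hom X P Q\<^esub> h ((X, []), [P, Q], [a])))
    (\<lambda>u P. (idm (Dom U u) (Robj A u P), r ((Dom U u, [u]), [P], [])))"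
  unfolding composite_is_identity_def
proof (intro conjI ballI)
  note rules = pair_rules cohomologous_units[OF coh] h r
  fix X P Q a assume [simp]: "X \<in> Obj U" and "P \<in> Ob (Fib D X)" "Q \<in> Ob (Fib D X)" and a: "a \<in> carrier (Mor (Fib D X) P Q)"
  then have [simp]: "P \<in> Objs X" "Q \<in> Objs X" by (simp_all add: deformed_simps)
  obtain b b' where [simp]: "a = (b, b')" "b \<in> Hom_set X P Q" "b' \<in> Hom_set X P Q"
    using a by (auto simp: deformed_simps dual_module_simps)
  show "(case functor_part X P Q a of (a, a') \<Rightarrow> (a, a' \<oplus>\<^bsub>Hom X P Q\<^esub> h ((X, []), [P, Q], [a]))) = a"
    apply (simp add: rules)
    by (rule Hom_eqI, (rule combination_intros | rule combination_atom, simp add: rules; fail)+,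
      (simp add: rules algebra_simps)+)
next
  note rules = pair_rules cohomologous_units[OF coh] h r
  fix u P assume [simp]: "u \<in> Arr U" and "P \<in> Ob (Fib D (Cod U u))"
  then have [simp]: "P \<in> Objs (Cod U u)" "Robj A u P \<in> Objs (Dom U u)" "Dom U u \<in> Obj U"
    by (simp_all add: deformed_simps closure_rules)
  show "Comp (Fib D (Dom U u)) (Robj D u P) (Robj second.D u P) (Robj D u P)
      (case transformation_part u P of (a, a') \<Rightarrow>
          (a, a' \<oplus>\<^bsub>Hom (Dom U u) (Robj second.D u P) (Robj D u P)\<^esub>
            h ((Dom U u, []), [Robj second.D u P, Robj D u P], [a])))
      (idm (Dom U u) (Robj A u P), r ((Dom U u, [u]), [P], []))
    = Id (Fib D (Dom U u)) (Robj D u P)"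
    apply (simp add: rules)
    by (rule Hom_eqI, (rule combination_intros | rule combination_atom, simp add: rules; fail)+,
      (simp add: rules algebra_simps)+)
qed simp

text \<open>The inverse is \<open>(1 - g\<epsilon>, 1 + t\<epsilon>)\<close>. It is a morphism because \<open>(m', f', c') = (m, f, c) + d(- g, - t)\<close>.\<close>

lemma isomorphism_iff_cohomologous:
  "prestack_isomorphism (dual_ring K) U D second.D (\<lambda>X P. P) functor_part transformation_part
    \<longleftrightarrow> cohomologous K U A m' f' c' g t m f c"
proof
  assume "prestack_isomorphism (dual_ring K) U D second.D (\<lambda>X P. P) functor_part transformation_part"
  then show "cohomologous K U A m' f' c' g t m f c"
    unfolding prestack_isomorphism_def by (blast intro: morphism_cohomologous)
next
  assume coh: "cohomologous K U A m' f' c' g t m f c"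
  interpret C: cohomologous K U A m' f' c' g t m f c by fact
  define h where "h = (\<lambda>x\<in>cochain_index U A 0 1. \<ominus>\<^bsub>value_module U A x\<^esub> g x)"
  define r where "r = (\<lambda>x\<in>cochain_index U A 1 0. \<ominus>\<^bsub>value_module U A x\<^esub> t x)"
  have h: "h ((X, []), [P, Q], [a]) = \<ominus>\<^bsub>Hom X P Q\<^esub> g ((X, []), [P, Q], [a])"
    if "X \<in> Obj U" "P \<in> Objs X" "Q \<in> Objs X" "a \<in> Hom_set X P Q" for X P Q a
    using that by (simp add: h_def index_1 value_module_simps)
  have r: "r ((V, [u]), [P], []) = \<ominus>\<^bsub>Hom V (Robj A u P) (Robj A u P)\<^esub> t ((V, [u]), [P], [])"
    if "u \<in> Arr U" "Dom U u = V" "P \<in> Objs (Cod U u)" for u V P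
    using that by (simp add: r_def index_0 value_module_simps Cod_closed)
  have minus_minus: "\<ominus>\<^bsub>Hom X P Q\<^esub> (\<ominus>\<^bsub>Hom X P Q\<^esub> x) = x"
    if "X \<in> Obj U" "P \<in> Objs X" "Q \<in> Objs X" "x \<in> Hom_set X P Q" for X P Q x
    using abelian_group.minus_minus[OF Hom_abelian_group] that .
  have t_minus_minus: "\<ominus>\<^bsub>Hom V (Robj A u P) (Robj A u P)\<^esub> (\<ominus>\<^bsub>Hom V (Robj A u P) (Robj A u P)\<^esub> t ((V, [u]), [P], []))
      = t ((V, [u]), [P], [])" if u: "u \<in> Arr U" "Dom U u = V" "P \<in> Objs (Cod U u)" for u V P
    using transformation_cochain[OF t u] u Dom_closed[OF u(1)] by (simp add: minus_minus Robj_closed)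
  interpret inverse: one_cochain K U A h r
    using cochain_uminus[OF g] cochain_uminus[OF t] by unfold_locales (simp_all add: h_def r_def)
  interpret inverse: pair_of_deformations K U A m' f' c' m f c h r t
    using unit unit' by unfold_locales (simp_all add: r t_minus_minus)
  note rules = C.calculation_closed two_cochain_closed pair_rules h r
  have inverse_coh: "cohomologous K U A m f c h r m' f' c'"
  proof
    fix X P Q R b a assume [simp]: "X \<in> Obj U" "P \<in> Objs X" "Q \<in> Objs X" "R \<in> Objs X" "b \<in> Hom_set X Q R" "a \<in> Hom_set X P Q"
    show "m' ((X, []), [P, Q, R], [b, a]) = m ((X, []), [P, Q, R], [b, a]) \<oplus>\<^bsub>Hom X P R\<^esub> multiplication_coboundary h X P Q R b a"
      apply (simp add: C.m'_cohomologous multiplication_coboundary_def rules)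
      by (rule sym, rule Hom_eqI, (rule combination_intros | rule combination_atom, simp add: rules; fail)+,
      (simp add: rules algebra_simps)+)
  next
    fix u V X P Q a assume [simp]: "u \<in> Arr U" "Dom U u = V" "Cod U u = X" "P \<in> Objs X" "Q \<in> Objs X" "a \<in> Hom_set X P Q"
    have [simp]: "V \<in> Obj U" "X \<in> Obj U" using Dom_closed[of u] Cod_closed[of u] by simp_all
    show "f' ((V, [u]), [P, Q], [a]) = f ((V, [u]), [P, Q], [a]) \<oplus>\<^bsub>Hom V (Robj A u P) (Robj A u Q)\<^esub> restriction_coboundary h r u P Q a"
      apply (simp add: C.f'_cohomologous restriction_coboundary_def Let_def rules)
      by (rule sym, rule Hom_eqI, (rule combination_intros | rule combination_atom, simp add: rules; fail)+,
      (simp add: rules algebra_simps)+)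
  next
    fix u v W P assume [simp]: "u \<in> Arr U" "v \<in> Arr U" and uv: "Cod U v = Dom U u" and [simp]: "Dom U v = W" and P: "P \<in> Objs (Cod U u)"
    define V X where VX: "V = Dom U u" "X = Cod U u"
    have [simp]: "V \<in> Obj U" "X \<in> Obj U" "W \<in> Obj U" "Dom U u = V" "Cod U u = X" "Cod U v = V" "P \<in> Objs X"
      using uv P Dom_closed[of v] by (simp_all add: VX closure_rules)
    show "c' ((W, [v, u]), [P], []) = c ((W, [v, u]), [P], []) \<oplus>\<^bsub>Hom W (Robj A v (Robj A u P)) (Robj A (Cmp U u v) P)\<^esub> twist_coboundary h r u v P"
      apply (simp add: C.c'_cohomologous twist_coboundary_def Let_def rules)
      by (rule sym, rule Hom_eqI, (rule combination_intros | rule combination_atom, simp add: rules; fail)+,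
      (simp add: rules algebra_simps)+)
  qed
  have "composite_is_identity U D second.D (\<lambda>X P. P) functor_part transformation_part
      (\<lambda>X P. P) inverse.functor_part inverse.transformation_part"
    using h by (intro composite_with_inverse[OF coh]) simp_all
  moreover have "composite_is_identity U second.D D (\<lambda>X P. P) inverse.functor_part inverse.transformation_part
      (\<lambda>X P. P) functor_part transformation_part"
    by (intro inverse.composite_with_inverse[OF inverse_coh]) (simp_all add: h r minus_minus s_eq pair_rules)
  ultimately show "prestack_isomorphism (dual_ring K) U D second.D (\<lambda>X P. P) functor_part transformation_part"
    unfolding prestack_isomorphism_def
    using cohomologous_morphism[OF coh] inverse.cohomologous_morphism[OF inverse_coh] by blast
qed

end

section \<open>Classification\<close>

context prestack_on_category
begin

lemma cocycle_carrier: "\<phi> \<in> gs_cocycles K U A 2 \<Longrightarrow> \<phi> \<in> carrier (gs_group K U A 2)"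
  by (simp add: gs_cocycles_def kernel_def)

lemma triple_of_deformation_iff:
  assumes \<phi>: "\<phi> \<in> carrier (gs_group K U A 2)"
  shows "triple_of \<phi> \<in> deformations K U A \<longleftrightarrow> \<phi> \<in> gs_cocycles K U A 2 \<and> normalized_reduced U A 2 \<phi>"
proof -
  interpret two_cochain K U A "\<phi> 0" "\<phi> (Suc 0)" "\<phi> 2" using gs_group_2_two_cochain[OF \<phi>] .
  have "triple_of \<phi> \<in> deformations K U A \<longleftrightarrow> prestack (dual_ring K) U D"
    using m f c by (simp add: deformations_def triple_of_def)
  also have "\<dots> \<longleftrightarrow> prestack_equations (\<phi> 0) (\<phi> (Suc 0)) (\<phi> 2) \<and> unit_conditions (\<phi> 0) (\<phi> (Suc 0)) (\<phi> 2)"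
    using deformation_prestack deformation_equations by blast
  finally show ?thesis using cocycle_iff[OF \<phi>] normalized_reduced_iff by simp
qed

lemma deformation_triple:
  assumes "D \<in> deformations K U A"
  obtains \<phi> where "\<phi> \<in> gs_cocycles K U A 2" "normalized_reduced U A 2 \<phi>" "D = triple_of \<phi>"
proof -
  obtain m f c where D: "D = (m, f, c)" by (metis prod.exhaust)
  then have mfc: "m \<in> cochains K U A 0 2" "f \<in> cochains K U A 1 1" "c \<in> cochains K U A 2 0"
    using assms by (auto simp: deformations_def)
  define \<phi> where "\<phi> = (\<lambda>p\<in>{..2::nat}. if p = 0 then m else if p = 1 then f else c)"
  have \<phi>_simps: "\<phi> 0 = m" "\<phi> (Suc 0) = f" "\<phi> 2 = c" by (simp_all add: \<phi>_def)
  have \<phi>: "\<phi> \<in> carrier (gs_group K U A 2)"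
    using mfc by (intro gs_group_2_carrier) (simp_all add: \<phi>_simps, simp add: \<phi>_def)
  have "D = triple_of \<phi>" by (simp add: D triple_of_def \<phi>_simps)
  then show thesis using that triple_of_deformation_iff[OF \<phi>] assms by blast
qed

lemma triple_of_inj:
  assumes "\<phi> \<in> carrier (gs_group K U A 2)" "\<phi>' \<in> carrier (gs_group K U A 2)" "triple_of \<phi> = triple_of \<phi>'"
  shows "\<phi> = \<phi>'"
  using assms by (intro gs_group_2_eqI gs_group_extensional(1)) (auto simp: triple_of_def)

text \<open>By \<open>isomorphism_iff_cohomologous\<close>, an equivalence amounts to \<open>\<phi> = \<phi>' + d(g, t)\<close>. The two directions differ in
  which of \<open>t\<close> and \<open>s = - t\<close> is given, and the other one is defined by negation.\<close>

lemma deformation_equivalence_iff: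
  assumes \<phi>: "\<phi> \<in> gs_cocycles K U A 2" "normalized_reduced U A 2 \<phi>"
    and \<phi>': "\<phi>' \<in> gs_cocycles K U A 2" "normalized_reduced U A 2 \<phi>'"
  shows "(triple_of \<phi>, triple_of \<phi>') \<in> deformation_equivalence K U A \<longleftrightarrow> gs_class K U A 2 \<phi> = gs_class K U A 2 \<phi>'"
proof -
  have \<phi>C: "\<phi> \<in> carrier (gs_group K U A 2)" and \<phi>'C: "\<phi>' \<in> carrier (gs_group K U A 2)"
    using \<phi> \<phi>' by (simp_all add: cocycle_carrier)
  interpret two_cochain K U A "\<phi> 0" "\<phi> (Suc 0)" "\<phi> 2" using gs_group_2_two_cochain[OF \<phi>C] .
  interpret second: two_cochain K U A "\<phi>' 0" "\<phi>' (Suc 0)" "\<phi>' 2" using gs_group_2_two_cochain[OF \<phi>'C] .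
  have unit: "unit_conditions (\<phi> 0) (\<phi> (Suc 0)) (\<phi> 2)" "unit_conditions (\<phi>' 0) (\<phi>' (Suc 0)) (\<phi>' 2)"
    using \<phi> \<phi>' normalized_reduced_iff by simp_all
  let ?neg = "\<lambda>t. (\<lambda>x\<in>cochain_index U A 1 0. \<ominus>\<^bsub>value_module U A x\<^esub> t x)"
  have neg: "?neg t ((V, [u]), [P], []) = \<ominus>\<^bsub>Hom V (Robj A u P) (Robj A u P)\<^esub> t ((V, [u]), [P], [])"
    if "u \<in> Arr U" "Dom U u = V" "P \<in> Objs (Cod U u)" for t u V P
    using that by (simp add: index_0 value_module_simps Cod_closed)
  have minus_minus: "\<ominus>\<^bsub>Hom X P Q\<^esub> (\<ominus>\<^bsub>Hom X P Q\<^esub> x) = x"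
    if "X \<in> Obj U" "P \<in> Objs X" "Q \<in> Objs X" "x \<in> Hom_set X P Q" for X P Q x
    using abelian_group.minus_minus[OF Hom_abelian_group] that .
  have def: "triple_of \<phi> \<in> deformations K U A" "triple_of \<phi>' \<in> deformations K U A"
    using triple_of_deformation_iff \<phi>C \<phi>'C \<phi> \<phi>' by blast+
  have pair: "pair_of_deformations K U A (\<phi> 0) (\<phi> (Suc 0)) (\<phi> 2) (\<phi>' 0) (\<phi>' (Suc 0)) (\<phi>' 2) g t s"
    if gt: "g \<in> cochains K U A 0 1" "t \<in> cochains K U A 1 0"
      and s: "\<And>u V P. \<lbrakk>u \<in> Arr U; Dom U u = V; P \<in> Objs (Cod U u)\<rbrakk>
      \<Longrightarrow> s ((V, [u]), [P], []) = \<ominus>\<^bsub>Hom V (Robj A u P) (Robj A u P)\<^esub> t ((V, [u]), [P], [])" for g t s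
  proof -
    interpret one_cochain K U A g t using gt by unfold_locales
    show ?thesis using unit s by unfold_locales
  qed
  show ?thesis
  proof
    assume "(triple_of \<phi>, triple_of \<phi>') \<in> deformation_equivalence K U A"
    then obtain g s where g: "g \<in> cochains K U A 0 1" and s: "s \<in> cochains K U A 1 0"
      and iso: "prestack_isomorphism (dual_ring K) U D second.D (\<lambda>X P. P)
             (\<lambda>X P Q (a, a'). (a, a' \<oplus>\<^bsub>Hom X P Q\<^esub> g ((X, []), [P, Q], [a])))
             (\<lambda>u P. (idm (Dom U u) (Robj A u P), s ((Dom U u, [u]), [P], [])))"
      by (auto simp: deformation_equivalence_def triple_of_def)
    interpret pair_of_deformations K U A "\<phi> 0" "\<phi> (Suc 0)" "\<phi> 2" "\<phi>' 0" "\<phi>' (Suc 0)" "\<phi>' 2" g "?neg s" s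
    proof (rule pair[OF g cochain_uminus[OF s]])
      fix u V P assume u: "u \<in> Arr U" "Dom U u = V" "P \<in> Objs (Cod U u)"
      then show "s ((V, [u]), [P], []) = \<ominus>\<^bsub>Hom V (Robj A u P) (Robj A u P)\<^esub> ?neg s ((V, [u]), [P], [])"
        unfolding neg[OF u] using transformation_cochain[OF s u] Dom_closed[OF u(1)] by (simp add: minus_minus Robj_closed)
    qed
    show "gs_class K U A 2 \<phi> = gs_class K U A 2 \<phi>'"
      using iso cohomologous_class_eq[OF \<phi>'C \<phi>C] isomorphism_iff_cohomologous by simp
  next
    assume "gs_class K U A 2 \<phi> = gs_class K U A 2 \<phi>'"
    then obtain \<psi> where \<psi>: "\<psi> \<in> carrier (gs_group K U A (Suc 0))"
      and eq: "\<phi> = \<phi>' \<otimes>\<^bsub>gs_group K U A 2\<^esub> gs_differential U A (Suc 0) \<psi>"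
      using gs_class_eq_iff[OF \<phi>'C \<phi>C] by auto
    interpret one: one_cochain K U A "\<psi> 0" "\<psi> (Suc 0)" using gs_group_1_one_cochain[OF \<psi>] .
    interpret pair_of_deformations K U A "\<phi> 0" "\<phi> (Suc 0)" "\<phi> 2" "\<phi>' 0" "\<phi>' (Suc 0)" "\<phi>' 2" "\<psi> 0" "\<psi> (Suc 0)" "?neg (\<psi> (Suc 0))"
      using neg by (rule pair[OF one.g one.t])
    have "prestack_isomorphism (dual_ring K) U D second.D (\<lambda>X P. P) functor_part transformation_part"
      using isomorphism_iff_cohomologous add_coboundary_cohomologous[OF \<phi>'C \<psi> eq] by simp
    then show "(triple_of \<phi>, triple_of \<phi>') \<in> deformation_equivalence K U A"
      using def one.g cochain_uminus[OF one.t] unfolding deformation_equivalence_def triple_of_def One_nat_def by blast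
  qed
qed

lemma cohomology_carrier: "carrier (gs_cohomology K U A 2) = gs_class K U A 2 ` gs_cocycles K U A 2"
  by (auto simp: gs_cohomology_def FactGroup_def RCOSETS_def r_coset_def gs_class_def)

end

theorem theorem1p1:
  fixes K :: "('k, 'z) ring_scheme"
    and U :: "('o, 'u) cat"
    and A :: "('o, 'u, 'a, 'm, 'k) prestack_data"
  assumes "field K" and "small_category U" and "prestack K U A"
  shows "(\<forall>X\<in>carrier (gs_cohomology K U A 2).
            \<exists>\<phi>\<in>gs_cocycles K U A 2. normalized_reduced U A 2 \<phi> \<and> gs_class K U A 2 \<phi> = X)
    \<and> (\<forall>\<phi>\<in>gs_cocycles K U A 2. normalized_reduced U A 2 \<phi> \<longrightarrow> triple_of \<phi> \<in> deformations K U A)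
    \<and> equiv (deformations K U A) (deformation_equivalence K U A)
    \<and> (\<exists>\<Phi>. bij_betw \<Phi> (carrier (gs_cohomology K U A 2))
              (deformations K U A // deformation_equivalence K U A)
          \<and> (\<forall>\<phi>\<in>gs_cocycles K U A 2. normalized_reduced U A 2 \<phi> \<longrightarrow>
                \<Phi> (gs_class K U A 2 \<phi>) = deformation_equivalence K U A `` {triple_of \<phi>}))"
proof -
  interpret prestack K U A by fact
  interpret small_category U by fact
  interpret prestack_on_category K U A by unfold_locales
  let ?H = "carrier (gs_cohomology K U A 2)" and ?Z = "gs_cocycles K U A 2" and ?N = "normalized_reduced U A 2"
  let ?Def = "deformations K U A" and ?E = "deformation_equivalence K U A" and ?cls = "gs_class K U A 2"
  have representatives: "\<exists>\<phi>\<in>?Z. ?N \<phi> \<and> ?cls \<phi> = X" if "X \<in> ?H" for X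
    using that cocycle_normalization unfolding cohomology_carrier by blast
  have triple: "triple_of \<phi> \<in> ?Def" if "\<phi> \<in> ?Z" "?N \<phi>" for \<phi>
    using that triple_of_deformation_iff cocycle_carrier by blast
  \<comment> \<open>\<open>triple_of\<close> is a bijection from the normalized reduced cocycles to the deformations; \<open>cocycle\<close> is its inverse\<close>
  define cocycle where "cocycle D = (THE \<phi>. \<phi> \<in> ?Z \<and> ?N \<phi> \<and> D = triple_of \<phi>)" for D
  have cocycle_triple: "cocycle (triple_of \<phi>) = \<phi>" if "\<phi> \<in> ?Z" "?N \<phi>" for \<phi>
    unfolding cocycle_def using that triple_of_inj cocycle_carrier by (intro the_equality) auto
  have E_iff: "(D, D') \<in> ?E \<longleftrightarrow> D \<in> ?Def \<and> D' \<in> ?Def \<and> ?cls (cocycle D) = ?cls (cocycle D')" for D D'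
  proof -
    have "(D, D') \<in> ?E \<Longrightarrow> D \<in> ?Def \<and> D' \<in> ?Def" by (auto simp: deformation_equivalence_def)
    then show ?thesis
      by (metis deformation_triple deformation_equivalence_iff cocycle_triple)
  qed
  have equiv: "equiv ?Def ?E"
    unfolding equiv_def refl_on_def sym_def trans_def by (auto simp: E_iff)
  \<comment> \<open>the fibres of \<open>D \<mapsto> [cocycle D]\<close>, which are the equivalence classes of deformations\<close>
  define \<Phi> where "\<Phi> X = {D \<in> ?Def. ?cls (cocycle D) = X}" for X
  have \<Phi>: "\<Phi> (?cls \<phi>) = ?E `` {triple_of \<phi>}" if "\<phi> \<in> ?Z" "?N \<phi>" for \<phi>
    using that triple[OF that] cocycle_triple[OF that] by (auto simp: \<Phi>_def E_iff)
  have "bij_betw \<Phi> ?H (?Def // ?E)"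
  proof (rule bij_betwI')
    fix X Y assume X: "X \<in> ?H" and Y: "Y \<in> ?H"
    show "\<Phi> X = \<Phi> Y \<longleftrightarrow> X = Y"
    proof
      assume eq: "\<Phi> X = \<Phi> Y"
      obtain \<phi> where "\<phi> \<in> ?Z" "?N \<phi>" "?cls \<phi> = X" using representatives[OF X] by blast
      \<comment> \<open>a fibre determines its class because it is nonempty\<close>
      then have "triple_of \<phi> \<in> \<Phi> X" using triple cocycle_triple by (auto simp: \<Phi>_def)
      then show "X = Y" using eq by (auto simp: \<Phi>_def)
    qed simp
  next
    fix X assume "X \<in> ?H"
    then obtain \<phi> where "\<phi> \<in> ?Z" "?N \<phi>" "?cls \<phi> = X" using representatives by blast
    then show "\<Phi> X \<in> ?Def // ?E" using \<Phi>[of \<phi>] quotientI[OF triple[of \<phi>], of ?E] by simp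
  next
    fix Y assume "Y \<in> ?Def // ?E"
    then obtain D where "D \<in> ?Def" "Y = ?E `` {D}" by (rule quotientE)
    then obtain \<phi> where "\<phi> \<in> ?Z" "?N \<phi>" "Y = ?E `` {triple_of \<phi>}" by (metis deformation_triple)
    then show "\<exists>X\<in>?H. Y = \<Phi> X" using \<Phi> unfolding cohomology_carrier by blast
  qed
  then show ?thesis using representatives triple equiv \<Phi> by blast
qed

end
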